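(* Let $\alpha>0$ be an arbitrarily small constant and let $p=p(n)$ satisfy $pn\to\infty$. (a) For every integer $r\ge 4$, asymptotically almost surely $\mathcal{G}(n,p)\to\left(P_{(1/r-\alpha)n}\right)_r$; hence $c_r\ge 1/r$. (b) Asymptotically almost surely $\mathcal{G}(n,p)\to\left(P_{(1/2-\alpha)n}\right)_3$; this is optimal and $c_3=1/2$.
   Context: $\mathcal{G}(n,p)$ is the binomial random graph on $\{1,\dots,n\}$ with each pair an edge independently with probability $p$. $P_m$ is the path on $m$ vertices (with $m$ rounded to an integer). $G\to(P_m)_r$ means every colouring of the edges of $G$ with $r$ colours yields a monochromatic copy of $P_m$. Asymptotically almost surely (a.a.s.) means with probability tending to $1$ as $n\to\infty$. For $r\in\mathbb{N}$, $c_r=\sup\{c\in[0,1] : \mathcal{G}(n,p)\to(P_{cn})_r \text{ a.a.s. whenever } np\to\infty\}$. *)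

theory Defs
  imports "HOL-Probability.Probability" "HOL-Library.Ramsey"
begin

text \<open>A simple graph is a pair of a vertex set and a set of two-element subsets of it.\<close>

type_synonym 'a ugraph = "'a set \<times> 'a set set"

definition path_graph :: "nat \<Rightarrow> nat ugraph" where
  "path_graph m = ({..<m}, {{i, Suc i} | i. Suc i < m})"

text \<open>Copies are subgraphs that need not be induced.\<close>

definition has_copy :: "'a ugraph \<Rightarrow> 'b ugraph \<Rightarrow> bool" where
  "has_copy G H \<longleftrightarrow>
     (\<exists>f. inj_on f (fst H) \<and> f ` fst H \<subseteq> fst G \<and> (\<forall>e\<in>snd H. f ` e \<in> snd G))"

text \<open>
  \<open>arrows G H r\<close> is $G \to (H)_r$. A monochromatic copy of \<open>H\<close> is a copy of \<open>H\<close> in the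
  spanning subgraph formed by the edges of a single colour.
\<close>

definition arrows :: "'a ugraph \<Rightarrow> 'b ugraph \<Rightarrow> nat \<Rightarrow> bool" where
  "arrows G H r \<longleftrightarrow>
     (\<forall>col \<in> snd G \<rightarrow> {..<r}. \<exists>k<r. has_copy (fst G, {e \<in> snd G. col e = k}) H)"

definition binomial_graph :: "nat \<Rightarrow> real \<Rightarrow> nat ugraph pmf" where
  "binomial_graph n p =
     map_pmf (\<lambda>b. ({1..n}, {e \<in> nsets {1..n} 2. b e}))
       (Pi_pmf (nsets {1..n} 2) False (\<lambda>_. bernoulli_pmf p))"

definition aas :: "(nat \<Rightarrow> real) \<Rightarrow> (nat \<Rightarrow> nat ugraph \<Rightarrow> bool) \<Rightarrow> bool" where
  "aas p Q \<longleftrightarrow>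
     (\<lambda>n. measure_pmf.prob (binomial_graph n (p n)) {G. Q n G}) \<longlonglongrightarrow> 1"

definition admissible :: "(nat \<Rightarrow> real) \<Rightarrow> bool" where
  "admissible p \<longleftrightarrow>
     (\<forall>n. 0 \<le> p n \<and> p n \<le> 1) \<and> filterlim (\<lambda>n. real n * p n) at_top sequentially"

text \<open>
  The path on \<open>x\<close> vertices for real \<open>x\<close>, rounded to the nearest integer; negative values
  yield the empty path.
\<close>

definition rpath :: "real \<Rightarrow> nat ugraph" where
  "rpath x = path_graph (nat (round x))"

definition path_const :: "nat \<Rightarrow> real" where
  "path_const r = Sup {c \<in> {0..1}. \<forall>p. admissible p \<longrightarrow>
     aas p (\<lambda>n G. arrows G (rpath (c * real n)) r)}"

end

theory Submission
  imports Defs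
begin

text \<open>
  The only property of \<open>G(n, p)\<close> used for the positive parts is that, for every \<open>\<eta> > 0\<close>,
  a.a.s. any two vertex sets of size \<open>\<eta> n\<close> span an edge; this is a union bound.

  No densities are needed for a regularity lemma in this setting. Call a pair of blocks regular if
  every colour that occurs between them occurs between any two not too small subsets. If many pairs
  are irregular, cutting out the empty witnesses decreases the number of triples (colour, vertex,
  vertex) whose blocks see the colour by a positive proportion, so boundedly many refinements
  suffice. A matching inside a component of the reduced graph of one colour can be followed by a
  monochromatic path in \<open>G\<close>. If there is no long path, Koenig's theorem on the
  bipartite double cover of each component gives half-integral vertex covers of small weight, and
  almost every pair of vertices is covered in some colour.

  For \<open>r\<close> colours, counting covered pairs gives the constant \<open>1/r\<close>. For three
  colours, a random bounded sample of vertices reduces the claim to complete graphs with all pairs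
  covered, which is settled by a case analysis on the component structure.
\<close>

section \<open>Koenig's theorem\<close>

text \<open>The edges of \<open>G\<close> may be too sparse for densities to be informative; only
  which colours occur between large sets can be used, so regularity is purely qualitative.
  Components of a reduced graph need not be bipartite, hence may have no vertex cover as small as a
  maximum matching. Ordered pairs of blocks avoid this: a block may be matched once as first and
  once as second entry, halving every block turns such a matching into a path, and the dual is a
  cover with weights 0, 1/2, 1, stored doubled in \<open>h\<close>. For three colours the bound 1/2
  is attained by a colouring modelled on the three perfect matchings of a K4, so the case analysis
  has to isolate exactly this structure. It also needs every pair covered, whereas the covers leave
  a small proportion out. A sample of fixed size avoids all uncovered pairs; since the number of
  components is unbounded, a second moment summed over all of them replaces a union bound.\<close>

definition covers :: "('a \<times> 'b) set \<Rightarrow> 'a set \<Rightarrow> 'b set \<Rightarrow> bool" where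
  "covers D A B \<longleftrightarrow> finite A \<and> finite B \<and> (\<forall>(x, y)\<in>D. x \<in> A \<or> y \<in> B)"

text \<open>Uncrossing the two cheap covers obtained by deleting either of two edges with a common end.\<close>

lemma critical_inj_fst:
  assumes min: "\<And>A B. covers D A B \<Longrightarrow> c \<le> card A + card B"
    and crit: "\<And>e. e \<in> D \<Longrightarrow> \<exists>A B. covers (D - {e}) A B \<and> card A + card B < c"
  shows "inj_on fst D"
proof (rule inj_onI, rule ccontr)
  fix e e' assume e: "e \<in> D" "e' \<in> D" "fst e = fst e'" "e \<noteq> e'"
  obtain x y y' where xy: "e = (x, y)" "e' = (x, y')" "y \<noteq> y'"
    using e by (metis prod.collapse)
  obtain A B where AB: "covers (D - {e}) A B" "card A + card B < c" using crit e by blast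
  obtain A' B' where AB': "covers (D - {e'}) A' B'" "card A' + card B' < c" using crit e by blast
  have fin: "finite A" "finite B" "finite A'" "finite B'" using AB AB' by (auto simp: covers_def)
  have "\<not> covers D A B" "\<not> covers D A' B'" using min[of A B] min[of A' B'] AB AB' by linarith+
  then have no: "x \<notin> A" "y \<notin> B" "x \<notin> A'" "y' \<notin> B'"
    using AB(1) AB'(1) xy e by (auto simp: covers_def)
  then have yes: "y' \<in> B" "y \<in> B'" using AB(1) AB'(1) xy e by (auto simp: covers_def)
  have "covers D (A \<inter> A') (B \<union> B')"
    using AB(1) AB'(1) xy yes unfolding covers_def by fastforce
  then have 1: "c \<le> card (A \<inter> A') + card (B \<union> B')" by (rule min)
  have "covers D (insert x (A \<union> A')) (B \<inter> B')"
    using AB(1) AB'(1) xy unfolding covers_def by fastforce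
  then have "c \<le> card (insert x (A \<union> A')) + card (B \<inter> B')" by (rule min)
  also have "card (insert x (A \<union> A')) \<le> Suc (card (A \<union> A'))" by (simp add: card_insert_le_m1 fin card_insert_if)
  finally have 2: "c \<le> Suc (card (A \<union> A')) + card (B \<inter> B')" by simp
  \<comment> \<open>Adding both bounds gives \<open>2 * c\<close> on the left, while the two cheap
    covers total at most \<open>2 * c - 2\<close> and inserting \<open>x\<close> costs one.\<close>
  show False using 1 2 AB(2) AB'(2) card_Un_Int[OF fin(1,3)] card_Un_Int[OF fin(2,4)] by linarith
qed

text \<open>Deleting an edge that does not lower the least cover size leaves a smaller instance; if
  every edge lowers it, uncrossing shows that the edges themselves form a matching.\<close>

theorem koenig:
  assumes "finite D"
  shows "\<exists>M A B. M \<subseteq> D \<and> inj_on fst M \<and> inj_on snd M \<and> covers D A B \<and> card A + card B \<le> card M"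
  using assms
proof (induction "card D" arbitrary: D rule: less_induct)
  case less
  define P where "P c \<longleftrightarrow> (\<exists>A B. covers D A B \<and> card A + card B = c)" for c
  have "covers D (fst ` D) {}" using less.prems by (auto simp: covers_def intro: rev_image_eqI)
  then have "P (card (fst ` D) + card ({} :: 'b set))" unfolding P_def by blast
  then have "P (LEAST c. P c)" by (rule LeastI)
  then obtain A B where AB: "covers D A B" "card A + card B = (LEAST c. P c)" unfolding P_def by blast
  define c where "c = (LEAST c. P c)"
  have min: "c \<le> card A + card B" if "covers D A B" for A B
    unfolding c_def by (rule Least_le) (use that P_def in blast)
  show ?case
  proof (cases "\<exists>e\<in>D. \<forall>A B. covers (D - {e}) A B \<longrightarrow> c \<le> card A + card B")
    case True
    then obtain e where e: "e \<in> D" "\<And>A B. covers (D - {e}) A B \<Longrightarrow> c \<le> card A + card B" by blast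
    have "card (D - {e}) < card D" using e(1) less.prems by (meson card_Diff1_less)
    then obtain M A' B' where "M \<subseteq> D - {e}" "inj_on fst M" "inj_on snd M"
      "covers (D - {e}) A' B'" "card A' + card B' \<le> card M"
      using less.hyps[of "D - {e}"] less.prems by blast
    \<comment> \<open>By the choice of \<open>e\<close>, the cover of the smaller instance still
      costs at least \<open>c\<close>, so a minimum cover of \<open>D\<close> is no larger.\<close>
    then show ?thesis using AB e(2) unfolding c_def by (metis Diff_subset order_trans)
  next
    case False
    then have crit: "\<exists>A B. covers (D - {e}) A B \<and> card A + card B < c" if "e \<in> D" for e
      using that by (meson not_le)
    have 1: "inj_on fst D" using critical_inj_fst[OF min crit] .
    have sw: "covers D A B \<longleftrightarrow> covers (prod.swap ` D) B A" for D :: "('a \<times> 'b) set" and A B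
      by (auto simp: covers_def)
    have "inj_on fst (prod.swap ` D)"
    proof (rule critical_inj_fst)
      fix A B assume "covers (prod.swap ` D) A B"
      then show "c \<le> card A + card B" using min[of B A] sw by fastforce
    next
      fix e assume "e \<in> prod.swap ` D"
      then obtain e' where e': "e' \<in> D" "e = prod.swap e'" by blast
      then obtain A B where "covers (D - {e'}) A B" "card A + card B < c" using crit by blast
      moreover have "prod.swap ` (D - {e'}) = prod.swap ` D - {e}"
        using e'(2) by (simp add: image_set_diff inj_on_inverseI[of _ prod.swap])
      ultimately show "\<exists>A B. covers (prod.swap ` D - {e}) A B \<and> card A + card B < c"
        using sw[of "D - {e'}" A B] by (metis add.commute)
    qed
    then have 2: "inj_on snd D" by (force simp: inj_on_def)
    have "covers D (fst ` D) {}" "card (fst ` D) = card D"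
      using less.prems 1 by (auto simp: covers_def card_image intro: rev_image_eqI)
    then show ?thesis using 1 2 by (metis add.right_neutral card.empty order_refl)
  qed
qed

section \<open>Covered triples of colours\<close>

text \<open>Here \<open>p\<close> is the size of one class, \<open>a\<close>, \<open>b\<close>,
  \<open>d\<close> the sizes of three others, and \<open>x\<close>, \<open>y\<close>,
  \<open>z\<close> the weights on the first. Summing the bounds shows that the sizes in the first
  alternative total more than \<open>n / 2\<close>. Each of them is below \<open>n / 2 - p\<close>,
  and with \<open>n \<le> 4 * p\<close> this excludes none, one, two or three of them.\<close>

lemma four_arith_real:
  fixes n p a b d x y z Hi Hj Hk :: real
  assumes "a + x \<le> Hi \<and> 2 * (p + a) < n \<or> 2 * a + x \<le> Hi"
    "b + y \<le> Hj \<and> 2 * (p + b) < n \<or> 2 * b + y \<le> Hj"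
    "d + z \<le> Hk \<and> 2 * (p + d) < n \<or> 2 * d + z \<le> Hk"
    and "2 * p \<le> x + y + z" "n = p + a + b + d" "2 * Hi < n" "2 * Hj < n" "2 * Hk < n" "n \<le> 4 * p"
    and "0 \<le> p" "0 \<le> a" "0 \<le> b" "0 \<le> d"
  shows False
  using assms by argo

lemma four_arith:
  fixes n p a b d x y z Hi Hj Hk :: nat
  assumes "a + x \<le> Hi \<and> 2 * (p + a) < n \<or> 2 * a + x \<le> Hi"
    "b + y \<le> Hj \<and> 2 * (p + b) < n \<or> 2 * b + y \<le> Hj"
    "d + z \<le> Hk \<and> 2 * (p + d) < n \<or> 2 * d + z \<le> Hk"
    and "2 * p \<le> x + y + z" "n = p + a + b + d" "2 * Hi < n" "2 * Hj < n" "2 * Hk < n" "n \<le> 4 * p"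
  shows False
proof (rule four_arith_real[of a x Hi p n b y Hj d z Hk])
  show "real a + x \<le> Hi \<and> 2 * (real p + a) < n \<or> 2 * real a + x \<le> Hi"
    using assms(1) unfolding of_nat_le_iff[symmetric, where 'a = real] of_nat_less_iff[symmetric, where 'a = real] by simp
  show "real b + y \<le> Hj \<and> 2 * (real p + b) < n \<or> 2 * real b + y \<le> Hj"
    using assms(2) unfolding of_nat_le_iff[symmetric, where 'a = real] of_nat_less_iff[symmetric, where 'a = real] by simp
  show "real d + z \<le> Hk \<and> 2 * (real p + d) < n \<or> 2 * real d + z \<le> Hk"
    using assms(3) unfolding of_nat_le_iff[symmetric, where 'a = real] of_nat_less_iff[symmetric, where 'a = real] by simp
qed (use assms(4-) in linarith)+

locale covered_triple =
  fixes V :: "'b set" and c :: "nat \<Rightarrow> 'b \<Rightarrow> 'c" and h :: "nat \<Rightarrow> 'b \<Rightarrow> nat"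
  assumes fin: "finite V" and ne: "V \<noteq> {}"
    and h_le: "h k v \<le> 2"
    and pair0: "u \<in> V \<Longrightarrow> v \<in> V \<Longrightarrow> \<exists>k<3. c k u = c k v \<and> 2 \<le> h k u + h k v"
    and small: "k < 3 \<Longrightarrow> 2 * (\<Sum>v | v \<in> V \<and> c k v = x. h k v) < card V"
begin

definition H :: "nat \<Rightarrow> 'c \<Rightarrow> nat" where "H k x = (\<Sum>v | v \<in> V \<and> c k v = x. h k v)"

text \<open>Arbitrary orderings of the three colours, so that each case is treated only up to
  symmetry.\<close>

definition tri :: "nat \<Rightarrow> nat \<Rightarrow> nat \<Rightarrow> bool" where "tri i j k \<longleftrightarrow> {i, j, k} = {0, 1, 2}"

lemma triD: assumes "tri i j k" shows "i < 3" "j < 3" "k < 3" "i \<noteq> j" "i \<noteq> k" "j \<noteq> k"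
  "l < 3 \<Longrightarrow> l = i \<or> l = j \<or> l = k"
proof -
  have e: "{i, j, k} = {0, 1, 2::nat}" using assms by (simp add: tri_def)
  have "i \<in> {0,1,2}" "j \<in> {0,1,2}" "k \<in> {0,1,2}" using e by blast+
  then show "i < 3" "j < 3" "k < 3" by auto
  have "card {i,j,k} = 3" using e by simp
  then show "i \<noteq> j" "i \<noteq> k" "j \<noteq> k" by (auto simp: card_insert_if split: if_splits)
  assume "l < 3" then have "l \<in> {0,1,2}" by auto
  then show "l = i \<or> l = j \<or> l = k" using e by blast
qed

lemma tri_perm: "tri i j k \<Longrightarrow> tri j i k" "tri i j k \<Longrightarrow> tri i k j"
  by (auto simp: tri_def insert_commute)

lemma pair: "tri i j k \<Longrightarrow> u \<in> V \<Longrightarrow> v \<in> V \<Longrightarrow>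
    (c i u = c i v \<and> 2 \<le> h i u + h i v) \<or> (c j u = c j v \<and> 2 \<le> h j u + h j v) \<or>
    (c k u = c k v \<and> 2 \<le> h k u + h k v)"
proof -
  assume t: "tri i j k" and uv: "u \<in> V" "v \<in> V"
  obtain l where l: "l < 3" "c l u = c l v \<and> 2 \<le> h l u + h l v" using pair0[OF uv] by blast
  from triD(7)[OF t l(1)] l(2) show ?thesis by blast
qed

lemma agree: "tri i j k \<Longrightarrow> u \<in> V \<Longrightarrow> v \<in> V \<Longrightarrow> c i u = c i v \<or> c j u = c j v \<or> c k u = c k v"
  using pair by blast

lemma H_small: "k < 3 \<Longrightarrow> 2 * H k x < card V" unfolding H_def by (rule small)

lemma H_ge: assumes "A \<subseteq> V" "\<And>v. v \<in> A \<Longrightarrow> c k v = x \<and> d \<le> h k v" shows "d * card A \<le> H k x"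
proof -
  have "d * card A = (\<Sum>v\<in>A. d)" by simp
  also have "\<dots> \<le> (\<Sum>v\<in>A. h k v)" by (rule sum_mono) (use assms in auto)
  also have "\<dots> \<le> H k x" unfolding H_def by (rule sum_mono2) (use assms fin in auto)
  finally show ?thesis .
qed

text \<open>Such a vertex forces every vertex into one of its components, with weight 2 in colour
  \<open>i\<close> or \<open>j\<close> or weight at least 1 in colour \<open>k\<close>. These fill
  less than a quarter, a quarter and a half of \<open>V\<close>.\<close>

lemma no_light:
  assumes t: "tri i j k" and u: "u \<in> V" and h0: "h i u = 0" "h j u = 0" "h k u \<le> 1"
  shows False
proof -
  let ?I = "{v\<in>V. c i v = c i u \<and> 2 \<le> h i v}"
  let ?J = "{v\<in>V. c j v = c j u \<and> 2 \<le> h j v}"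
  let ?K = "{v\<in>V. c k v = c k u \<and> 1 \<le> h k v}"
  have "V \<subseteq> ?I \<union> ?J \<union> ?K"
  proof
    fix v assume v: "v \<in> V"
    show "v \<in> ?I \<union> ?J \<union> ?K" using pair[OF t u v] h0 v by auto
  qed
  then have "card V \<le> card (?I \<union> ?J \<union> ?K)" using fin by (intro card_mono) auto
  also have "\<dots> \<le> card ?I + card ?J + card ?K"
    by (meson card_Un_le add_le_mono order_refl order_trans)
  finally have "card V \<le> card ?I + card ?J + card ?K" .
  moreover have "2 * card ?I \<le> H i (c i u)" "2 * card ?J \<le> H j (c j u)" "1 * card ?K \<le> H k (c k u)"
    by (rule H_ge; auto)+
  moreover have "2 * H i (c i u) < card V" "2 * H j (c j u) < card V" "2 * H k (c k u) < card V"
    using H_small triD[OF t] by auto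
  ultimately show False by linarith
qed

lemma full: assumes t: "tri i j k" and u: "u \<in> V" shows "2 \<le> h i u + h j u + h k u"
  using no_light[OF t u] no_light[OF tri_perm(2)[OF t] u]
    no_light[OF tri_perm(2)[OF tri_perm(1)[OF t]] u] by arith

definition contrib :: "(nat \<Rightarrow> 'c) \<Rightarrow> nat \<Rightarrow> 'b \<Rightarrow> nat" where
  "contrib a k v = (if c k v = a k then h k v else 0)"

lemma contrib_eq: "c k v = a k \<Longrightarrow> contrib a k v = h k v"
  by (simp add: contrib_def)

lemma sum_contrib: "(\<Sum>v\<in>V. contrib a k v) = H k (a k)"
  unfolding H_def contrib_def using fin by (simp add: sum.If_cases Int_def)

text \<open>Double counting for one chosen component per colour. The vertices contributing less than
  2 have weight at least 1 in the component of colour \<open>i\<close>, so they number less than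
  half of \<open>card V\<close>; together with three component weights below half this cannot reach
  \<open>2 * card V\<close>.\<close>

lemma key:
  assumes t: "tri i j k"
    and ge: "\<And>v. v \<in> V \<Longrightarrow> 2 \<le> contrib a i v + contrib a j v + contrib a k v \<or>
       (1 \<le> contrib a i v)"
  shows False
proof -
  let ?D = "{v\<in>V. contrib a i v + contrib a j v + contrib a k v < 2}"
  have D: "1 * card ?D \<le> H i (a i)"
    by (rule H_ge) (use ge in \<open>force simp: contrib_def split: if_splits\<close>)+
  have "2 * card V = (\<Sum>v\<in>V. 2)" by simp
  also have "\<dots> \<le> (\<Sum>v\<in>V. contrib a i v + contrib a j v + contrib a k v + (if v \<in> ?D then 1 else 0))"
    by (rule sum_mono) (use ge in force)
  also have "\<dots> = H i (a i) + H j (a j) + H k (a k) + card ?D"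
    using fin by (simp add: sum.distrib sum_contrib sum.If_cases Int_def)
  finally show False
    using D H_small[of i "a i"] H_small[of j "a j"] H_small[of k "a k"] triD[OF t] by linarith
qed

text \<open>More than half of the vertices have weight 0 in colour \<open>i\<close>, because the
  spanning component is light. By the same bound in colour \<open>j\<close>, one of them,
  \<open>u\<close>, also has weight 0 there, and \<open>key\<close> applies to the components of
  \<open>u\<close>.\<close>

lemma no_spanning_line:
  assumes t: "tri i j k" and span: "\<And>v. v \<in> V \<Longrightarrow> c i v = a"
    and z: "z \<in> V" and line: "\<And>v. v \<in> V \<Longrightarrow> h i v = 0 \<Longrightarrow> c j v = c j z"
  shows False
proof -
  let ?Z = "{v\<in>V. h i v = 0}"
  have "1 * card (V - ?Z) \<le> H i a" by (rule H_ge) (use span in auto)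
  moreover have "card V = card ?Z + card (V - ?Z)"
    using fin by (metis (no_types, lifting) card_Diff_subset card_mono finite_subset le_add_diff_inverse mem_Collect_eq subsetI)
  moreover note H_small[of i a] triD[OF t]
  ultimately have big: "card V < 2 * card ?Z" by linarith
  have "\<exists>u\<in>?Z. h j u = 0"
  proof (rule ccontr)
    assume "\<not> ?thesis"
    then have "1 * card ?Z \<le> H j (c j z)" by (intro H_ge) (use line in \<open>auto simp: Suc_le_eq\<close>)
    then show False using big H_small[of j "c j z"] triD[OF t] by linarith
  qed
  then obtain u where u: "u \<in> V" "h i u = 0" "h j u = 0" by auto
  show False
  proof (rule key[OF t, of "\<lambda>l. c l u"])
    fix v assume v: "v \<in> V"
    have cc: "c i v = c i u" "h i v = 0 \<Longrightarrow> c j v = c j u" using span line u v by auto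
    show "2 \<le> contrib (\<lambda>l. c l u) i v + contrib (\<lambda>l. c l u) j v + contrib (\<lambda>l. c l u) k v
        \<or> 1 \<le> contrib (\<lambda>l. c l u) i v"
    proof (cases "h i v = 0")
      case True
      \<comment> \<open>The pair cannot be covered in colour \<open>i\<close>, and in colour
        \<open>j\<close> only by \<open>v\<close> alone.\<close>
      then have "2 \<le> h j v \<or> c k v = c k u"
        using pair[OF t u(1) v] u by auto
      then show ?thesis using full[OF t v] True cc by (auto simp: contrib_eq)
    next
      case False
      then show ?thesis using cc(1) by (simp add: contrib_eq)
    qed
  qed
qed

text \<open>Vertices of weight 0 in colour \<open>i\<close> pairwise agree in colour
  \<open>j\<close> or \<open>k\<close>. Points of a grid any two of which share a row or a column
  lie on one line, so the previous lemma applies.\<close>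

lemma no_spanning: assumes t: "tri i j k" and span: "\<And>v. v \<in> V \<Longrightarrow> c i v = a" shows False
proof -
  let ?Z = "{v\<in>V. h i v = 0}"
  have ag: "c j u = c j v \<or> c k u = c k v" if "u \<in> ?Z" "v \<in> ?Z" for u v
    using pair[OF t, of u v] that by auto
  obtain v0 where v0: "v0 \<in> V" using ne by blast
  show False
  proof (cases "\<exists>z\<in>V. (\<forall>v\<in>?Z. c j v = c j z)")
    case True
    then show ?thesis using no_spanning_line[OF t span] by blast
  next
    case F1: False
    show ?thesis
    proof (cases "\<exists>z\<in>V. (\<forall>v\<in>?Z. c k v = c k z)")
      case True
      then show ?thesis using no_spanning_line[OF tri_perm(2)[OF t] span] by blast
    next
      case F2: False
      obtain z where z: "z \<in> ?Z" using F1 v0 by blast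
      obtain x where x: "x \<in> ?Z" "c j x \<noteq> c j z" using F1 z by blast
      obtain y where y: "y \<in> ?Z" "c k y \<noteq> c k z" using F2 z by blast
      \<comment> \<open>Of \<open>j\<close> and \<open>k\<close>, \<open>x\<close> shares only
        \<open>k\<close> with \<open>z\<close> and \<open>y\<close> only \<open>j\<close>, so
        \<open>x\<close> and \<open>y\<close> share neither.\<close>
      show ?thesis using ag[of x z] ag[of y z] ag[of x y] x y z by auto
    qed
  qed
qed

text \<open>A vertex outside the chosen component in one colour lies in the chosen ones of the other
  two, and its pairs with other components must be covered there. This forces weight:
  \<open>A\<close> excludes 0 in both colours, \<open>C\<close> excludes total weight 1, and after
  \<open>D\<close> every vertex contributes 2.\<close>

lemma no_majority:
  assumes maj: "\<And>i j k v. tri i j k \<Longrightarrow> v \<in> V \<Longrightarrow> c i v \<noteq> a i \<Longrightarrow> c j v = a j \<and> c k v = a k"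
  shows False
proof -
  have A: False if t: "tri i j k" and u: "u \<in> V" "c i u \<noteq> a i" "h j u = 0" "h k u = 0" for i j k u
  \<comment> \<open>The component of colour \<open>i\<close> is switched to that of the exceptional
    vertex.\<close>
  proof (rule key[OF t, of "a(i := c i u)"], rule disjI1)
    fix v assume v: "v \<in> V"
    show "2 \<le> contrib (a(i := c i u)) i v + contrib (a(i := c i u)) j v + contrib (a(i := c i u)) k v"
    proof (cases "c i v = c i u")
      case True
      then show ?thesis using full[OF t v] maj[OF t v] u(2) triD[OF t] by (simp add: contrib_eq)
    next
      case False
      then have "(c j v = a j \<and> 2 \<le> h j v) \<or> (c k v = a k \<and> 2 \<le> h k v)"
        using pair[OF t u(1) v] maj[OF t u(1,2)] u by auto
      then show ?thesis using triD[OF t] by (auto simp: contrib_def)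
    qed
  qed
  have B: "1 \<le> h j u + h k u" if t: "tri i j k" and u: "u \<in> V" "c i u \<noteq> a i" for i j k u
    using A[OF t u] by (cases "h j u"; cases "h k u") auto
  have C: False if t: "tri i j k" and u: "u \<in> V" "c i u \<noteq> a i" "h j u = 1" "h k u = 0" for i j k u
  proof -
    \<comment> \<open>Two components lighter than half cannot receive a unit from every
      vertex.\<close>
    have "1 \<le> contrib a j v + contrib a k v" if v: "v \<in> V" for v
    proof (cases "c i v = a i")
      case True
      then have "(c j v = a j \<and> 1 \<le> h j v) \<or> (c k v = a k \<and> 2 \<le> h k v)"
        using pair[OF t u(1) v] maj[OF t u(1,2)] u by auto
      then show ?thesis by (auto simp: contrib_def)
    next
      case False
      then show ?thesis using B[OF t v] maj[OF t v] by (simp add: contrib_eq)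
    qed
    then have "(\<Sum>v\<in>V. 1) \<le> (\<Sum>v\<in>V. contrib a j v + contrib a k v)" by (intro sum_mono)
    then have "card V \<le> H j (a j) + H k (a k)" by (simp add: sum.distrib sum_contrib)
    then show False using H_small[of j "a j"] H_small[of k "a k"] triD[OF t] by linarith
  qed
  have D: "2 \<le> h j u + h k u" if t: "tri i j k" and u: "u \<in> V" "c i u \<noteq> a i" for i j k u
    using A[OF t u] C[OF t u] C[OF tri_perm(2)[OF t] u] by arith
  have t: "tri 0 1 2" by (simp add: tri_def)
  have t': "tri 1 0 2" "tri 2 0 1" by (auto simp: tri_def)
  show False
  proof (rule key[OF t, of a], rule disjI1)
    fix v assume v: "v \<in> V"
    show "2 \<le> contrib a 0 v + contrib a 1 v + contrib a 2 v"
    proof -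
      consider "c 0 v \<noteq> a 0" | "c 1 v \<noteq> a 1" | "c 2 v \<noteq> a 2" | "\<forall>k\<in>{0,1,2}. c k v = a k" by auto
      then show ?thesis
      proof cases
        case 1 then show ?thesis using D[OF t v] maj[OF t v] by (simp add: contrib_eq)
      next
        case 2 then show ?thesis using D[OF t'(1) v] maj[OF t'(1) v] by (simp add: contrib_eq)
      next
        case 3 then show ?thesis using D[OF t'(2) v] maj[OF t'(2) v] by (simp add: contrib_eq)
      next
        case 4 then show ?thesis using full[OF t v] by (simp add: contrib_eq)
      qed
    qed
  qed
qed

section \<open>The extremal structure of four classes\<close>

definition same :: "'b \<Rightarrow> 'b set" where "same u = {v\<in>V. \<forall>k<3. c k v = c k u}"

lemma same_disjoint: "k < 3 \<Longrightarrow> c k u \<noteq> c k v \<Longrightarrow> same u \<inter> same v = {}"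
  unfolding same_def by force

text \<open>Pairs between the two classes are covered only in colour \<open>i\<close>, so weight 0
  somewhere in \<open>same p\<close> forces 2 on all of \<open>same q\<close>. Weight 2 throughout
  \<open>same p\<close> would reach \<open>card V / 2\<close>, as \<open>same p\<close> is at least
  a quarter. Otherwise weight 1 occurs, both classes have weight at least 1, and their union is
  below half.\<close>

lemma two_classes:
  assumes t: "tri i j k" and p: "p \<in> V" and q: "q \<in> V"
    and one: "c i p = c i q" "c j p \<noteq> c j q" "c k p \<noteq> c k q"
    and big: "card V \<le> 4 * card (same p)"
  shows "(\<forall>v\<in>same q. 2 \<le> h i v) \<or>
    ((\<forall>v\<in>same q. 1 \<le> h i v) \<and> 2 * (card (same p) + card (same q)) < card V)"
proof -
  note tt = triD[OF t]
  have pq: "2 \<le> h i x + h i y" if "x \<in> same p" "y \<in> same q" for x y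
    using pair[OF t, of x y] that one tt by (auto simp: same_def)
  have pp: "p \<in> same p" using p by (simp add: same_def)
  have fins: "finite (same x)" for x using fin by (simp add: same_def)
  consider (z) x where "x \<in> same p" "h i x = 0" | (t) "\<forall>x\<in>same p. h i x \<ge> 2"
    | (o) x where "x \<in> same p" "h i x = 1" "\<forall>x\<in>same p. h i x \<ge> 1"
    by (metis One_nat_def Suc_1 Suc_leI le_eq_less_or_eq not_gr_zero not_less_eq_eq)
  then show ?thesis
  proof cases
    case z then show ?thesis using pq[OF z(1)] by auto
  next
    case t
    then have "2 * card (same p) \<le> H i (c i p)" by (intro H_ge) (use tt in \<open>auto simp: same_def\<close>)
    then show ?thesis using big H_small[of i "c i p"] tt by linarith
  next
    case o
    then have 1: "\<forall>v\<in>same q. 1 \<le> h i v" using pq[OF o(1)] by fastforce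
    have "1 * card (same p \<union> same q) \<le> H i (c i p)"
      by (rule H_ge) (use 1 o one tt in \<open>auto simp: same_def\<close>)
    moreover have "same p \<inter> same q = {}" using one same_disjoint tt(2) by blast
    ultimately have "card (same p) + card (same q) \<le> H i (c i p)"
      by (simp add: card_Un_disjoint fins)
    then show ?thesis using 1 H_small[of i "c i p"] tt by auto
  qed
qed

text \<open>The class of \<open>p\<close> shares a different colour with each other class. Each
  shared component contains \<open>same p\<close> and one further class, whose weight
  \<open>two_classes\<close> bounds from below; \<open>four_arith\<close> refutes the resulting
  inequalities.\<close>

lemma no_four:
  assumes t: "tri i j k" and p: "p \<in> V" "q1 \<in> V" "q2 \<in> V" "q3 \<in> V"
    and q1: "c i p = c i q1" "c j p \<noteq> c j q1" "c k p \<noteq> c k q1"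
    and q2: "c j p = c j q2" "c i p \<noteq> c i q2" "c k p \<noteq> c k q2"
    and q3: "c k p = c k q3" "c i p \<noteq> c i q3" "c j p \<noteq> c j q3"
    and cov: "V = same p \<union> same q1 \<union> same q2 \<union> same q3"
    and big: "card V \<le> 4 * card (same p)"
  shows False
proof -
  note tt = triD[OF t]
  have fins: "finite (same x)" for x using fin by (simp add: same_def)
  have dj: "same p \<inter> same q1 = {}" "same p \<inter> same q2 = {}" "same p \<inter> same q3 = {}"
     "same q1 \<inter> same q2 = {}" "same q1 \<inter> same q3 = {}" "same q2 \<inter> same q3 = {}"
    by (rule same_disjoint[OF tt(2)]; use q1 q2 q3 in simp; fail | rule same_disjoint[OF tt(1)]; use q1 q2 q3 in simp; fail)+
  have n: "card V = card (same p) + card (same q1) + card (same q2) + card (same q3)"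
    by (subst cov) (simp add: card_Un_disjoint fins dj Int_Un_distrib2)
  have Hs: "d * card (same q) + (\<Sum>v\<in>same p. h l v) \<le> H l (c l p)"
    if "l < 3" "c l q = c l p" "same p \<inter> same q = {}" "\<forall>v\<in>same q. d \<le> h l v" for d q l
  proof -
    have "d * card (same q) = (\<Sum>v\<in>same q. d)" by simp
    also have "\<dots> \<le> (\<Sum>v\<in>same q. h l v)" by (rule sum_mono) (use that in auto)
    also have "\<dots> + (\<Sum>v\<in>same p. h l v) = (\<Sum>v\<in>same q \<union> same p. h l v)"
      by (rule sum.union_disjoint[symmetric]) (use that fins in auto)
    also have "\<dots> \<le> H l (c l p)" unfolding H_def
      by (rule sum_mono2) (use that fin in \<open>auto simp: same_def\<close>)
    finally show ?thesis by simp
  qed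
  have "2 * card (same p) = (\<Sum>v\<in>same p. 2)" by simp
  also have "\<dots> \<le> (\<Sum>v\<in>same p. h i v + h j v + h k v)"
    by (rule sum_mono) (use full[OF t] in \<open>auto simp: same_def\<close>)
  finally have S: "2 * card (same p) \<le> (\<Sum>v\<in>same p. h i v) + (\<Sum>v\<in>same p. h j v) + (\<Sum>v\<in>same p. h k v)"
    by (simp add: sum.distrib)
  have T1: "(\<forall>v\<in>same q1. 2 \<le> h i v) \<or>
    ((\<forall>v\<in>same q1. 1 \<le> h i v) \<and> 2 * (card (same p) + card (same q1)) < card V)"
    by (rule two_classes[OF t p(1) p(2) q1 big])
  have T2: "(\<forall>v\<in>same q2. 2 \<le> h j v) \<or>
    ((\<forall>v\<in>same q2. 1 \<le> h j v) \<and> 2 * (card (same p) + card (same q2)) < card V)"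
    by (rule two_classes[OF tri_perm(1)[OF t] p(1) p(3) q2 big])
  have T3: "(\<forall>v\<in>same q3. 2 \<le> h k v) \<or>
    ((\<forall>v\<in>same q3. 1 \<le> h k v) \<and> 2 * (card (same p) + card (same q3)) < card V)"
    by (rule two_classes[OF tri_perm(1)[OF tri_perm(2)[OF t]] p(1) p(4) q3 big])
  note Hs1 = Hs[OF tt(1) q1(1)[symmetric] dj(1), of 1] Hs[OF tt(1) q1(1)[symmetric] dj(1), of 2]
  note Hs2 = Hs[OF tt(2) q2(1)[symmetric] dj(2), of 1] Hs[OF tt(2) q2(1)[symmetric] dj(2), of 2]
  note Hs3 = Hs[OF tt(3) q3(1)[symmetric] dj(3), of 1] Hs[OF tt(3) q3(1)[symmetric] dj(3), of 2]
  note sm = H_small[OF tt(1), of "c i p"] H_small[OF tt(2), of "c j p"] H_small[OF tt(3), of "c k p"]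
  have R1: "card (same q1) + (\<Sum>v\<in>same p. h i v) \<le> H i (c i p) \<and> 2 * (card (same p) + card (same q1)) < card V
     \<or> 2 * card (same q1) + (\<Sum>v\<in>same p. h i v) \<le> H i (c i p)"
    using T1 Hs1 by auto
  have R2: "card (same q2) + (\<Sum>v\<in>same p. h j v) \<le> H j (c j p) \<and> 2 * (card (same p) + card (same q2)) < card V
     \<or> 2 * card (same q2) + (\<Sum>v\<in>same p. h j v) \<le> H j (c j p)"
    using T2 Hs2 by auto
  have R3: "card (same q3) + (\<Sum>v\<in>same p. h k v) \<le> H k (c k p) \<and> 2 * (card (same p) + card (same q3)) < card V
     \<or> 2 * card (same q3) + (\<Sum>v\<in>same p. h k v) \<le> H k (c k p)"
    using T3 Hs3 by auto
  show False by (rule four_arith[OF R1 R2 R3 S n sm big])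
qed

text \<open>Up to naming, \<open>u\<close>, \<open>v\<close>, \<open>w\<close>, \<open>x\<close> are
  the binary vectors of length 3 with even sum. Every other triple differs from one of them in all
  coordinates, so the four classes exhaust \<open>V\<close>, one contains a quarter of it, and each
  can play the part of \<open>p\<close> in \<open>no_four\<close>.\<close>

lemma four_classes:
  assumes t: "tri i j k" and V: "u \<in> V" "v \<in> V" "w \<in> V" "x \<in> V"
    and d: "c i u \<noteq> c i w" "c j u \<noteq> c j v" "c k u \<noteq> c k v"
    and v: "c i v = c i u"
    and w: "c j w = c j u" "c k w = c k v"
    and x: "c i x = c i w" "c j x = c j v" "c k x = c k u"
  shows False
proof -
  note tt = triD[OF t]
  have "y \<in> same u \<union> same v \<union> same w \<union> same x" if y: "y \<in> V" for y
  proof -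
    have all: "(\<forall>l<3. c l y = c l z) \<longleftrightarrow> c i y = c i z \<and> c j y = c j z \<and> c k y = c k z" for z
      using tt by metis
    show ?thesis
      using agree[OF t y V(1)] agree[OF t y V(2)] agree[OF t y V(3)] agree[OF t y V(4)] d v w x y
      unfolding same_def Un_iff mem_Collect_eq all by metis
  qed
  then have cov: "V = same u \<union> same v \<union> same w \<union> same x" by (auto simp: same_def)
  have "card V \<le> card (same u) + card (same v) + card (same w) + card (same x)"
    by (subst cov) (meson add_le_mono1 card_Un_le order_trans)
  then consider "card V \<le> 4 * card (same u)" | "card V \<le> 4 * card (same v)"
    | "card V \<le> 4 * card (same w)" | "card V \<le> 4 * card (same x)" by linarith
  then show False
  proof cases
    case 1 show False by (rule no_four[OF t V(1,2,3,4)]) (use 1 d v w x cov in \<open>auto\<close>)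
  next
    case 2 show False by (rule no_four[OF t V(2,1,4,3)]) (use 2 d v w x cov in \<open>auto\<close>)
  next
    case 3 show False by (rule no_four[OF t V(3,4,1,2)]) (use 3 d v w x cov in \<open>auto\<close>)
  next
    case 4 show False by (rule no_four[OF t V(4,3,2,1)]) (use 4 d v w x cov in \<open>auto\<close>)
  qed
qed

lemma contradiction: False
proof -
  have t: "tri 0 1 2" by (simp add: tri_def)
  obtain u where u: "u \<in> V" using ne by blast
  obtain i j k v where tt: "tri i j k" and v: "v \<in> V" "c i v = c i u" "c j v \<noteq> c j u" "c k v \<noteq> c k u"
  proof -
    from no_majority[of "\<lambda>l. c l u"] obtain i j k v where
      "tri i j k" "v \<in> V" "c i v \<noteq> c i u" "c j v \<noteq> c j u \<or> c k v \<noteq> c k u" by blast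
    then show thesis
      using agree[of i j k v u] u that[of k i j v] that[of j i k v] that[of i j k v] tri_perm by metis
  qed
  obtain w where w: "w \<in> V" "c i w \<noteq> c i u" using no_spanning[OF tt] by metis
  have main: False if tt: "tri i j k" and V: "u \<in> V" "v \<in> V" "w \<in> V" and
    v: "c i v = c i u" "c j v \<noteq> c j u" "c k v \<noteq> c k u" and
    w: "c i w \<noteq> c i u" "c j w = c j u" "c k w = c k v" for i j k u v w
  proof -
    note T = triD[OF tt]
    \<comment> \<open>The coordinatewise majority of \<open>u\<close>, \<open>v\<close>,
      \<open>w\<close>. A triple that differs from it in two places and agrees with each of the
      three somewhere is determined: it is the fourth even vector.\<close>
    define a where "a l = (if l = i then c i u else if l = j then c j u else c k v)" for l
    have a: "a i = c i u" "a j = c j u" "a k = c k v" using T by (auto simp: a_def)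
    from no_majority[of a] obtain i' j' k' x where
      x: "tri i' j' k'" "x \<in> V" "c i' x \<noteq> a i'" "c j' x \<noteq> a j' \<or> c k' x \<noteq> a k'" by blast
    have "(c i x \<noteq> a i \<and> c j x \<noteq> a j) \<or> (c i x \<noteq> a i \<and> c k x \<noteq> a k) \<or> (c j x \<noteq> a j \<and> c k x \<noteq> a k)"
      using x(3,4) triD[OF x(1)] T by metis
    then have "c i x = c i w \<and> c j x = c j v \<and> c k x = c k u"
      using agree[OF tt x(2) V(1)] agree[OF tt x(2) V(2)] agree[OF tt x(2) V(3)] v w unfolding a by metis
    then show False using four_classes[OF tt V x(2)] v w by metis
  qed
  have "c j w = c j u \<and> c k w = c k v \<or> c j w = c j v \<and> c k w = c k u"
    using agree[OF tt u w(1)] agree[OF tt v(1) w(1)] w v by metis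
  then show False
    using main[OF tt u v(1) w(1)] main[OF tt v(1) u w(1)] v w by metis
qed

end

text \<open>Weights are doubled, and a matching of the double cover yields about one path vertex per
  unit of \<open>h\<close>; a component of weight \<open>card V / 2\<close> thus stands for a path
  through half of the vertices.\<close>

theorem three_colour_cover:
  fixes V :: "'b set" and c :: "nat \<Rightarrow> 'b \<Rightarrow> 'c" and h :: "nat \<Rightarrow> 'b \<Rightarrow> nat"
  assumes "finite V" and "V \<noteq> {}" and "\<And>k v. h k v \<le> 2"
    and "\<And>u v. u \<in> V \<Longrightarrow> v \<in> V \<Longrightarrow> \<exists>k<3. c k u = c k v \<and> 2 \<le> h k u + h k v"
  shows "\<exists>k<3. \<exists>x. card V \<le> 2 * (\<Sum>v | v \<in> V \<and> c k v = x. h k v)"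
proof (rule ccontr)
  assume "\<not> ?thesis"
  then interpret covered_triple V c h
    using assms by unfold_locales (auto simp: not_le)
  show False by (rule contradiction)
qed

section \<open>Long paths from matchings in the reduced graph\<close>

lemma card_split:
  assumes "B \<subseteq> A" "finite A" shows "card A = card B + card (A - B)"
  using assms by (simp add: card_Diff_subset card_mono finite_subset[OF assms])

text \<open>Stands in for a regular pair; \<open>A = B\<close> is allowed.\<close>

definition joined :: "('a \<Rightarrow> 'a \<Rightarrow> bool) \<Rightarrow> nat \<Rightarrow> 'a set \<Rightarrow> 'a set \<Rightarrow> bool" where
  "joined E t A B \<longleftrightarrow>
     (\<forall>X\<subseteq>A. \<forall>Y\<subseteq>B. t \<le> card X \<longrightarrow> t \<le> card Y \<longrightarrow> (\<exists>x\<in>X. \<exists>y\<in>Y. E x y))"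

lemma joinedD:
  "joined E t A B \<Longrightarrow> X \<subseteq> A \<Longrightarrow> Y \<subseteq> B \<Longrightarrow> t \<le> card X \<Longrightarrow> t \<le> card Y \<Longrightarrow> \<exists>x\<in>X. \<exists>y\<in>Y. E x y"
  unfolding joined_def by blast

lemma joined_subset: "joined E t A B \<Longrightarrow> A' \<subseteq> A \<Longrightarrow> B' \<subseteq> B \<Longrightarrow> joined E t A' B'"
  unfolding joined_def by (meson order_trans)

lemma walk_to_path:
  assumes "successively E xs" "xs \<noteq> []"
  shows "\<exists>ys. ys \<noteq> [] \<and> distinct ys \<and> successively E ys \<and> hd ys = hd xs \<and> last ys = last xs \<and>
    set ys \<subseteq> set xs \<and> length ys \<le> length xs"
  using assms
proof (induction "length xs" arbitrary: xs rule: less_induct)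
  case less
  show ?case
  proof (cases "distinct xs")
    case True
    then show ?thesis using less.prems by blast
  next
    case False
    then obtain as y bs cs where xs: "xs = as @ [y] @ bs @ [y] @ cs"
      using not_distinct_decomp by blast
    let ?zs = "as @ y # cs"
    have "successively E ?zs"
      using less.prems unfolding xs by (auto simp: successively_append_iff successively_Cons split: if_splits)
    moreover have "length ?zs < length xs" "hd ?zs = hd xs" "last ?zs = last xs" "set ?zs \<subseteq> set xs"
      by (auto simp: xs hd_append)
    ultimately show ?thesis using less.hyps[of ?zs]
      by (smt (verit) append_is_Nil_conv le_trans less_imp_le list.distinct(1) subset_trans)
  qed
qed

lemma alternating_length:
  assumes "successively (\<lambda>x y. x \<in> L \<longleftrightarrow> y \<in> R) xs" "set xs \<subseteq> L \<union> R" "L \<inter> R = {}" "distinct xs"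
  shows "length xs \<le> 2 * card (set xs \<inter> L) + 1" "length xs \<le> 2 * card (set xs \<inter> R) + 1"
proof -
  let ?l = "\<lambda>xs. length (filter (\<lambda>x. x \<in> L) xs)" and ?r = "\<lambda>xs. length (filter (\<lambda>x. x \<in> R) xs)"
  \<comment> \<open>Which side is ahead depends on the side of the head, so the induction records
    both cases.\<close>
  have "(xs \<noteq> [] \<and> hd xs \<in> L \<longrightarrow> ?r xs \<le> ?l xs \<and> ?l xs \<le> ?r xs + 1) \<and>
        (xs \<noteq> [] \<and> hd xs \<in> R \<longrightarrow> ?l xs \<le> ?r xs \<and> ?r xs \<le> ?l xs + 1) \<and>
        ?l xs + ?r xs = length xs"
    using assms(1,2)
  proof (induction xs)
    case (Cons x xs)
    then show ?case using assms(3) by (cases xs) (auto simp: successively_Cons)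
  qed simp
  then have "?l xs \<le> ?r xs + 1" "?r xs \<le> ?l xs + 1" "?l xs + ?r xs = length xs"
    using assms(2) by (cases xs; auto)+
  moreover have "?l xs = card (set xs \<inter> L)" "?r xs = card (set xs \<inter> R)"
    using assms(4) by (simp_all add: distinct_length_filter Int_commute Collect_mem_eq)
  ultimately show "length xs \<le> 2 * card (set xs \<inter> L) + 1" "length xs \<le> 2 * card (set xs \<inter> R) + 1"
    by linarith+
qed

text \<open>
  Depth-first search, frozen at a state that maximises progress: \<open>S\<close> is the set of finished
  vertices and \<open>P\<close> the current path, whose head is the active vertex.
\<close>

lemma dfs_path:
  assumes fin: "finite L" "finite R" and LR: "L \<inter> R = {}" and sym: "\<And>x y. E x y \<Longrightarrow> E y x"
    and jn: "joined E t L R" and q: "q \<le> card L" "q \<le> card R" and t: "1 \<le> t"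
  shows "\<exists>xs. distinct xs \<and> set xs \<subseteq> L \<union> R \<and>
    successively (\<lambda>x y. E x y \<and> (x \<in> L \<longleftrightarrow> y \<in> R)) xs \<and> 2 * (q - 2 * t) \<le> length xs"
proof (cases "2 * t < q")
  case False
  then show ?thesis by (intro exI[of _ "[]"]) auto
next
  case qt: True
  define B where "B x y \<longleftrightarrow> E x y \<and> (x \<in> L \<longleftrightarrow> y \<in> R)" for x y
  define valid where "valid S P \<longleftrightarrow> S \<subseteq> L \<union> R \<and> set P \<subseteq> L \<union> R \<and> set P \<inter> S = {} \<and> distinct P \<and>
      successively B P \<and> (\<forall>x\<in>S. \<forall>y\<in>L \<union> R - S - set P. \<not> B x y) \<and>
      card (S \<inter> L) \<le> t \<and> card (S \<inter> R) \<le> t" for S P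
  have Bsym: "B y x" if "B x y" "x \<in> L \<union> R" "y \<in> L \<union> R" for x y
    using that sym LR unfolding B_def by blast
  have bnd: "2 * card S + length P \<le> 3 * card (L \<union> R)" if "valid S P" for S P
  proof -
    have "card S \<le> card (L \<union> R)" "length P \<le> card (L \<union> R)"
      using that fin unfolding valid_def by (auto simp: card_mono distinct_card[symmetric] intro!: card_mono)
    then show ?thesis by simp
  qed
  \<comment> \<open>Starting a path, extending it and retiring its head each raise
    \<open>2 * card S + length P\<close> by one, so a maximal state admits no move.\<close>
  have "\<exists>z. (\<lambda>(S, P). valid S P) z \<and>
      (\<forall>w. (\<lambda>(S, P). valid S P) w \<longrightarrow> (\<lambda>(S, P). 2 * card S + length P) w \<le> (\<lambda>(S, P). 2 * card S + length P) z)"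
  proof (rule ex_has_greatest_nat)
    show "(\<lambda>(S, P). valid S P) ({}, [])" by (simp add: valid_def)
    show "\<forall>w. (\<lambda>(S, P). valid S P) w \<longrightarrow> (\<lambda>(S, P). 2 * card S + length P) w < Suc (3 * card (L \<union> R))"
      using bnd by (auto simp: less_Suc_eq_le)
  qed
  then obtain S P where v: "valid S P"
    and mx: "\<And>S' P'. valid S' P' \<Longrightarrow> 2 * card S' + length P' \<le> 2 * card S + length P" by auto
  have finS: "finite S" using v fin unfolding valid_def by (meson finite_UnI finite_subset)
  have "card (S \<inter> L) = t \<or> card (S \<inter> R) = t"
  proof (rule ccontr)
    assume neg: "\<not> ?thesis"
    then have lt: "card (S \<inter> L) < t" "card (S \<inter> R) < t" using v unfolding valid_def by auto
    show False
    proof (cases P)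
      case Nil
      have "\<not> L \<subseteq> S"
      proof
        assume "L \<subseteq> S" then have "S \<inter> L = L" by blast
        then show False using lt qt q by simp
      qed
      then obtain y where y: "y \<in> L" "y \<notin> S" by blast
      then have "valid S [y]" using v unfolding valid_def Nil by auto
      then show False using mx[of S "[y]"] Nil by simp
    next
      case (Cons x P')
      have x: "x \<in> L \<union> R" "x \<notin> S" using v unfolding valid_def Cons by auto
      show False
      proof (cases "\<exists>y\<in>L \<union> R - S - set P. B x y")
        case True
        then obtain y where y: "y \<in> L \<union> R - S - set P" "B x y" by blast
        have "B y x" using Bsym[OF y(2)] x y by blast
        then have "valid S (y # P)" using v y unfolding valid_def Cons by auto
        then show False using mx[of S "y # P"] by simp
      next
        case False
        have "card (insert x S \<inter> L) \<le> t" "card (insert x S \<inter> R) \<le> t"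
          using lt finS by (auto simp: Int_insert_left card_insert_if)
        then have "valid (insert x S) P'"
          using v False x unfolding valid_def Cons by (auto simp: successively_Cons)
        then show False using mx[of "insert x S" P'] x finS Cons by simp
      qed
    qed
  qed
  then have "q < card (set P \<inter> R) + 2 * t \<or> q < card (set P \<inter> L) + 2 * t"
  proof
    assume S: "card (S \<inter> L) = t"
    let ?Y = "R - S - set P"
    \<comment> \<open>No edge leads from finished to unvisited vertices, so \<open>t\<close>
      finished ones in \<open>L\<close> leave fewer than \<open>t\<close> unvisited ones in
      \<open>R\<close>.\<close>
    have "card ?Y < t"
    proof (rule ccontr)
      assume "\<not> ?thesis"
      then obtain x y where xy: "x \<in> S \<inter> L" "y \<in> ?Y" "E x y" using joinedD[OF jn, of "S \<inter> L" ?Y] S by auto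
      then have "B x y" by (auto simp: B_def)
      then show False using v xy unfolding valid_def by blast
    qed
    moreover have "card R \<le> card (S \<inter> R) + card (set P \<inter> R) + card ?Y"
    proof -
      have "card R \<le> card ((S \<inter> R) \<union> (set P \<inter> R) \<union> ?Y)" by (rule card_mono) (use fin finS in auto)
      also have "\<dots> \<le> card (S \<inter> R) + card (set P \<inter> R) + card ?Y"
        by (meson card_Un_le add_le_mono order_refl order_trans)
      finally show ?thesis .
    qed
    ultimately show ?thesis using v q unfolding valid_def by linarith
  next
    assume S: "card (S \<inter> R) = t"
    let ?Y = "L - S - set P"
    have "card ?Y < t"
    proof (rule ccontr)
      assume "\<not> ?thesis"
      then obtain x y where xy: "x \<in> S \<inter> R" "y \<in> ?Y" "E y x" using joinedD[OF jn, of ?Y "S \<inter> R"] S by auto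
      then have "B y x" by (auto simp: B_def)
      then have "B x y" using Bsym xy by blast
      then show False using v xy unfolding valid_def by blast
    qed
    moreover have "card L \<le> card (S \<inter> L) + card (set P \<inter> L) + card ?Y"
    proof -
      have "card L \<le> card ((S \<inter> L) \<union> (set P \<inter> L) \<union> ?Y)" by (rule card_mono) (use fin finS in auto)
      also have "\<dots> \<le> card (S \<inter> L) + card (set P \<inter> L) + card ?Y"
        by (meson card_Un_le add_le_mono order_refl order_trans)
      finally show ?thesis .
    qed
    ultimately show ?thesis using v q unfolding valid_def by linarith
  qed
  moreover have alt: "length P \<ge> 2 * card (set P \<inter> L) - 1" "length P \<ge> 2 * card (set P \<inter> R) - 1"
  proof -
    have "successively (\<lambda>x y. x \<in> L \<longleftrightarrow> y \<in> R) P" "set P \<subseteq> L \<union> R" "distinct P"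
      using v unfolding valid_def B_def by (auto elim: successively_mono)
    note a = alternating_length[OF this(1,2) LR this(3)]
    have "set P = (set P \<inter> L) \<union> (set P \<inter> R)" using v unfolding valid_def by blast
    then have "card (set P) = card (set P \<inter> L) + card (set P \<inter> R)"
      using LR by (metis (no_types, lifting) List.finite_set card_Un_disjoint finite_Int inf_assoc inf_bot_right inf_commute)
    then have "length P = card (set P \<inter> L) + card (set P \<inter> R)" using \<open>distinct P\<close> by (simp add: distinct_card)
    then show "length P \<ge> 2 * card (set P \<inter> L) - 1" "length P \<ge> 2 * card (set P \<inter> R) - 1" using a by linarith+
  qed
  ultimately have "2 * (q - 2 * t) \<le> length P" using qt by linarith
  then show ?thesis using v unfolding valid_def B_def by blast
qed

text \<open>Sets of \<open>t\<close> reached vertices are pushed along an \<open>R\<close>-walk: all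
  but fewer than \<open>t\<close> of the \<open>2 * t\<close> vertices of \<open>U\<close> in the
  next block have a reached neighbour. The resulting walk may repeat vertices and is shortened at
  the end.\<close>

lemma connect:
  assumes R: "(A, A') \<in> R\<^sup>*" "finite R" "(A', B') \<in> R"
    and jn: "\<And>A B. (A, B) \<in> R \<Longrightarrow> joined E t A B"
    and X: "X \<subseteq> A" "t \<le> card X" and Y: "Y \<subseteq> B'" "t \<le> card Y"
    and U: "\<And>A B. (A, B) \<in> R \<Longrightarrow> finite B \<and> 2 * t \<le> card (U \<inter> B)"
  shows "\<exists>x\<in>X. \<exists>y\<in>Y. \<exists>us. distinct us \<and> set us \<subseteq> U \<and> length us \<le> card R \<and> successively E (x # us @ [y])"
proof -
  define reached where "reached n z \<longleftrightarrow>
    (\<exists>x\<in>X. \<exists>us. length us \<le> n \<and> set us \<subseteq> U \<and> successively E (x # us) \<and> last (x # us) = z)" for n z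
  have reach: "\<exists>S\<subseteq>D. t \<le> card S \<and> (\<forall>z\<in>S. reached n z)" if "(A, D) \<in> R ^^ n" for D n
    using that
  proof (induction n arbitrary: D)
    case 0
    then have "D = A" by simp
    moreover have "reached 0 z" if "z \<in> X" for z
      unfolding reached_def using that by (intro bexI[of _ z] exI[of _ "[]"]) auto
    ultimately show ?case using X by blast
  next
    case (Suc n)
    then obtain C where C: "(A, C) \<in> R ^^ n" "(C, D) \<in> R" by auto
    from Suc.IH[OF C(1)] obtain S where S: "S \<subseteq> C" "t \<le> card S" "\<forall>z\<in>S. reached n z" by blast
    let ?S = "{z \<in> U \<inter> D. \<exists>w\<in>S. E w z}" and ?N = "{z \<in> U \<inter> D. \<not> (\<exists>w\<in>S. E w z)}"
    have fD: "finite D" using U C(2) by blast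
    have "card ?N < t" using joinedD[OF jn[OF C(2)] S(1), of ?N] S(2) by (auto simp: not_le[symmetric])
    moreover have "card (U \<inter> D) = card ?S + card ?N"
    proof -
      have N: "?N = U \<inter> D - ?S" by blast
      have "?S \<subseteq> U \<inter> D" "finite (U \<inter> D)" using fD by auto
      then show ?thesis unfolding N using card_split by blast
    qed
    ultimately have "t \<le> card ?S" using U[OF C(2)] by linarith
    moreover have "reached (Suc n) z" if z: "z \<in> ?S" for z
    proof -
      obtain w where w: "w \<in> S" "E w z" using z by blast
      then obtain x us where x: "x \<in> X" "length us \<le> n" "set us \<subseteq> U" "successively E (x # us)" "last (x # us) = w"
        using S(3) unfolding reached_def by blast
      have "successively E ((x # us) @ [z])"
        unfolding successively_append_iff using x w by simp
      then show ?thesis unfolding reached_def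
        using x z by (intro bexI[of _ x] exI[of _ "us @ [z]"]) auto
    qed
    ultimately show ?case by (intro exI[of _ ?S]) blast
  qed
  obtain n where n: "(A, A') \<in> R ^^ n" "n \<le> card R"
    using R(1) rtrancl_finite_eq_relpow[OF R(2)] by auto
  obtain S where S: "S \<subseteq> A'" "t \<le> card S" "\<forall>z\<in>S. reached n z"
    using reach[OF n(1)] by blast
  obtain z y where zy: "z \<in> S" "y \<in> Y" "E z y" using joinedD[OF jn[OF R(3)] S(1) Y(1) S(2) Y(2)] by blast
  obtain x us where x: "x \<in> X" "length us \<le> n" "set us \<subseteq> U" "successively E (x # us)" "last (x # us) = z"
    using S(3) zy unfolding reached_def by blast
  show ?thesis
  proof (cases "us = []")
    case True
    then show ?thesis using x zy by (intro bexI[of _ x] bexI[of _ y] exI[of _ "[]"]) auto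
  next
    case False
    have "successively E us" using x(4) by (cases us) auto
    from walk_to_path[OF this False] obtain ys where ys: "ys \<noteq> []" "distinct ys" "successively E ys"
      "hd ys = hd us" "last ys = last us" "set ys \<subseteq> set us" "length ys \<le> length us" by blast
    have "E x (hd us)" using x(4) False by (cases us) auto
    then have "successively E (x # ys @ [y])"
      using ys x(5) zy(3) False by (simp add: successively_Cons successively_append_iff)
    then show ?thesis using x zy ys n(2) by (intro bexI[of _ x] bexI[of _ y] exI[of _ ys]) auto
  qed
qed


text \<open>The ends \<open>F\<close> and \<open>T\<close> have \<open>2 * t\<close> vertices each,
  so alternation leaves \<open>t\<close> possible entry points in \<open>R\<close> and exit points
  in \<open>L\<close>; the core \<open>C\<close> survives any choice of them.\<close>

lemma alternating_segment:
  assumes fin: "finite L" "finite R" and LR: "L \<inter> R = {}" and sym: "\<And>x y. E x y \<Longrightarrow> E y x"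
    and jn: "joined E t L R" and q: "q \<le> card L" "q \<le> card R" and t: "1 \<le> t" and big: "4 * t \<le> q"
  shows "\<exists>F C T. distinct (F @ C @ T) \<and> set (F @ C @ T) \<subseteq> L \<union> R \<and> successively E (F @ C @ T) \<and>
    t \<le> card (set F \<inter> R) \<and> t \<le> card (set T \<inter> L) \<and> 2 * q - 8 * t \<le> length C"
proof -
  obtain xs where xs: "distinct xs" "set xs \<subseteq> L \<union> R"
    "successively (\<lambda>x y. E x y \<and> (x \<in> L \<longleftrightarrow> y \<in> R)) xs" "2 * (q - 2 * t) \<le> length xs"
    using dfs_path[OF fin LR sym jn q t] by blast
  define F C T where "F = take (2 * t) xs" and "C = take (length xs - 4 * t) (drop (2 * t) xs)"
    and "T = drop (length xs - 2 * t) xs"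
  have len: "4 * t \<le> length xs" using xs(4) big by linarith
  have "drop (2 * t) xs = C @ drop (length xs - 4 * t) (drop (2 * t) xs)" unfolding C_def by (metis append_take_drop_id)
  also have "drop (length xs - 4 * t) (drop (2 * t) xs) = T"
    unfolding T_def drop_drop using len by (intro arg_cong[where f = "\<lambda>n. drop n xs"]) linarith
  finally have split: "xs = F @ C @ T" unfolding F_def by (metis append_take_drop_id)
  have sF: "successively (\<lambda>x y. E x y \<and> (x \<in> L \<longleftrightarrow> y \<in> R)) F"
    and sT: "successively (\<lambda>x y. E x y \<and> (x \<in> L \<longleftrightarrow> y \<in> R)) T"
    using xs(3) unfolding split by (auto simp: successively_append_iff)
  have dF: "distinct F" "distinct T" "set F \<subseteq> L \<union> R" "set T \<subseteq> L \<union> R" using xs(1,2) unfolding split by auto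
  have "length F \<le> 2 * card (set F \<inter> R) + 1"
    by (rule alternating_length(2)[OF successively_mono[OF sF] dF(3) LR dF(1)]) auto
  moreover have "length T \<le> 2 * card (set T \<inter> L) + 1"
    by (rule alternating_length(1)[OF successively_mono[OF sT] dF(4) LR dF(2)]) auto
  moreover have "length F = 2 * t" "length T = 2 * t" using len by (auto simp: F_def T_def)
  moreover have "length C = length xs - 4 * t" using len unfolding C_def by simp
  ultimately have "t \<le> card (set F \<inter> R)" "t \<le> card (set T \<inter> L)" "2 * q - 8 * t \<le> length C"
    using xs(4) big by linarith+
  moreover have "successively E xs" by (rule successively_mono[OF xs(3)]) auto
  ultimately show ?thesis using xs(1,2) unfolding split by blast
qed

lemma successively_overlap:
  "successively E (xs @ [x]) \<Longrightarrow> successively E (x # ys) \<Longrightarrow> successively E (xs @ x # ys)"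
  by (auto simp: successively_append_iff)

lemma splice:
  assumes P: "distinct (W @ T)" "successively E (W @ T)"
    and Q: "distinct (F @ Q)" "successively E (F @ Q)"
    and dj: "set (W @ T) \<inter> set (F @ Q) = {}"
    and x: "x \<in> set T" and y: "y \<in> set F"
    and us: "distinct us" "set us \<inter> set (W @ T) = {}" "set us \<inter> set (F @ Q) = {}"
      "successively E (x # us @ [y])"
  shows "\<exists>Z. distinct (W @ Z @ Q) \<and> successively E (W @ Z @ Q) \<and> set Z \<subseteq> set T \<union> set us \<union> set F"
proof -
  obtain t1 t2 where T: "T = t1 @ x # t2" using x by (meson split_list)
  obtain f1 f2 where F: "F = f1 @ y # f2" using y by (meson split_list)
  \<comment> \<open>The part of \<open>T\<close> behind \<open>x\<close> and the part of
    \<open>F\<close> before \<open>y\<close> are dropped.\<close>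
  let ?Z = "t1 @ (x # us @ [y]) @ f2"
  have 1: "distinct (W @ ?Z @ Q)" using P(1) Q(1) dj us(1-3) unfolding T F by auto
  have "successively E (((W @ t1) @ [x]) @ t2)" using P(2) unfolding T by simp
  then have "successively E ((W @ t1) @ [x])" unfolding successively_append_iff[of E "(W @ t1) @ [x]" t2] by blast
  moreover have "successively E (y # (f2 @ Q))" using Q(2) unfolding F by (auto simp: successively_append_iff)
  ultimately have "successively E ((W @ t1) @ x # us @ [y])" "successively E (y # (f2 @ Q))"
    using successively_overlap[OF _ us(4)] by blast+
  then have "successively E ((W @ t1 @ x # us) @ y # (f2 @ Q))"
    using successively_overlap[of E "W @ t1 @ x # us" y "f2 @ Q"] by simp
  then have "successively E (W @ ?Z @ Q)" by simp
  then show ?thesis using 1 T F by (intro exI[of _ ?Z]) auto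
qed

text \<open>
  Every block \<open>A\<close> is split into \<open>f1 A\<close>, \<open>f2 A\<close> and a reserve. A matching edge \<open>(A, B)\<close> is
  followed inside \<open>f1 A \<union> f2 B\<close>, and the segments are linked through the reserves.
\<close>

lemma long_path:
  fixes E :: "'a \<Rightarrow> 'a \<Rightarrow> bool" and \<P> :: "'a set set"
  assumes sym: "\<And>x y. E x y \<Longrightarrow> E y x"
    and fin: "finite \<P>" and dj: "\<And>A B. A \<in> \<P> \<Longrightarrow> B \<in> \<P> \<Longrightarrow> A \<noteq> B \<Longrightarrow> A \<inter> B = {}"
    and sz: "\<And>A. A \<in> \<P> \<Longrightarrow> finite A \<and> card A = s"
    and R: "R \<subseteq> \<P> \<times> \<P>" and jn: "\<And>A B. (A, B) \<in> R \<Longrightarrow> joined E t A B"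
    and M: "M \<subseteq> R" "inj_on fst M" "inj_on snd M"
    and conn: "\<And>e e'. e \<in> M \<Longrightarrow> e' \<in> M \<Longrightarrow> (fst e, fst e') \<in> R\<^sup>*"
    and t: "1 \<le> t" "card \<P> ^ 3 \<le> 2 * t"
  shows "\<exists>xs. distinct xs \<and> successively E xs \<and> set xs \<subseteq> \<Union>\<P> \<and> card M * (s - 12 * t - 1) \<le> length xs"
proof (cases "M = {} \<or> s \<le> 12 * t")
  case True
  then show ?thesis by (intro exI[of _ "[]"]) auto
next
  case False
  then have Mne: "M \<noteq> {}" and st: "12 * t < s" by auto
  \<comment> \<open>Two parts of size \<open>q\<close> leave at least \<open>4 * t\<close> vertices
    of each block for the reserve.\<close>
  define q where "q = (s - 4 * t) div 2"
  have q: "s - 4 * t - 1 \<le> 2 * q" "2 * q \<le> s - 4 * t" "4 * t \<le> q" using st unfolding q_def by linarith+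
  have "\<exists>X Y. X \<subseteq> A \<and> Y \<subseteq> A \<and> X \<inter> Y = {} \<and> card X = q \<and> card Y = q" if "A \<in> \<P>" for A
  proof -
    have "q \<le> card A" using sz[OF that] q by linarith
    then obtain X where X: "X \<subseteq> A" "card X = q" "finite X" by (meson obtain_subset_with_card_n)
    have "card (A - X) = s - q" using X sz[OF that] by (simp add: card_Diff_subset)
    then have "q \<le> card (A - X)" using q by linarith
    then obtain Y where "Y \<subseteq> A - X" "card Y = q" by (meson obtain_subset_with_card_n)
    then show ?thesis using X by (intro exI[of _ X] exI[of _ Y]) auto
  qed
  then obtain f1 f2 where f: "\<And>A. A \<in> \<P> \<Longrightarrow>
      f1 A \<subseteq> A \<and> f2 A \<subseteq> A \<and> f1 A \<inter> f2 A = {} \<and> card (f1 A) = q \<and> card (f2 A) = q" by metis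
  define U where "U = (\<Union>A\<in>\<P>. A - f1 A - f2 A)"
  define seg where "seg e = f1 (fst e) \<union> f2 (snd e)" for e
  have MP: "fst e \<in> \<P>" "snd e \<in> \<P>" if "e \<in> M" for e using that M(1) R by auto
  have UA: "4 * t \<le> card (U \<inter> A)" if A: "A \<in> \<P>" for A
  proof -
    have "A - f1 A - f2 A \<subseteq> U \<inter> A" using A unfolding U_def by blast
    moreover have "card (A - f1 A - f2 A) = s - q - q"
    proof -
      have fi: "finite (f1 A)" "finite (f2 A)" using f[OF A] sz[OF A] by (auto intro: finite_subset)
      have "card (A - f1 A) = s - q" using f[OF A] sz[OF A] fi by (simp add: card_Diff_subset)
      moreover have "f2 A \<subseteq> A - f1 A" using f[OF A] by blast
      ultimately show ?thesis using f[OF A] fi by (simp add: card_Diff_subset)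
    qed
    moreover have "finite (U \<inter> A)" using sz[OF A] by blast
    ultimately have "s - q - q \<le> card (U \<inter> A)" by (metis card_mono)
    then show ?thesis using q st by linarith
  qed
  have segU: "seg e \<inter> U = {}" if e: "e \<in> M" for e
  proof -
    have "(f1 (fst e) \<union> f2 (snd e)) \<inter> (A - f1 A - f2 A) = {}" if A: "A \<in> \<P>" for A
    proof -
      have "f1 (fst e) \<inter> (A - f1 A - f2 A) = {}"
        using f[OF MP(1)[OF e]] dj[OF MP(1)[OF e] A] by (cases "fst e = A") auto
      moreover have "f2 (snd e) \<inter> (A - f1 A - f2 A) = {}"
        using f[OF MP(2)[OF e]] dj[OF MP(2)[OF e] A] by (cases "snd e = A") auto
      ultimately show ?thesis by blast
    qed
    then show ?thesis unfolding seg_def U_def by blast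
  qed
  have segseg: "seg e \<inter> seg e' = {}" if e: "e \<in> M" "e' \<in> M" "e \<noteq> e'" for e e'
  proof -
    have "fst e \<noteq> fst e'" "snd e \<noteq> snd e'" using e M(2,3) by (auto dest: inj_onD)
    then have "f1 (fst e) \<inter> f1 (fst e') = {}" "f2 (snd e) \<inter> f2 (snd e') = {}"
      using dj[OF MP(1)[OF e(1)] MP(1)[OF e(2)]] dj[OF MP(2)[OF e(1)] MP(2)[OF e(2)]]
        f[OF MP(1)[OF e(1)]] f[OF MP(1)[OF e(2)]] f[OF MP(2)[OF e(1)]] f[OF MP(2)[OF e(2)]] by blast+
    moreover have "f1 A \<inter> f2 B = {}" if AB: "A \<in> \<P>" "B \<in> \<P>" for A B
      using f[OF AB(1)] f[OF AB(2)] dj[OF AB] by (cases "A = B") auto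
    ultimately show ?thesis using MP e unfolding seg_def by blast
  qed
  have "\<exists>F C T. distinct (F @ C @ T) \<and> set (F @ C @ T) \<subseteq> seg e \<and> successively E (F @ C @ T) \<and>
    t \<le> card (set F \<inter> f2 (snd e)) \<and> t \<le> card (set T \<inter> f1 (fst e)) \<and> 2 * q - 8 * t \<le> length C" if e: "e \<in> M" for e
    unfolding seg_def
  proof (rule alternating_segment[OF _ _ _ sym _ _ _ t(1) q(3)])
    note a = f[OF MP(1)[OF e]] f[OF MP(2)[OF e]] sz[OF MP(1)[OF e]] sz[OF MP(2)[OF e]]
    show "finite (f1 (fst e))" "finite (f2 (snd e))" using a by (auto intro: finite_subset)
    show "f1 (fst e) \<inter> f2 (snd e) = {}" using a dj[OF MP[OF e]] by (cases "fst e = snd e") auto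
    show "joined E t (f1 (fst e)) (f2 (snd e))"
      by (rule joined_subset[OF jn[of "fst e" "snd e"]]) (use a e M(1) in auto)
    show "q \<le> card (f1 (fst e))" "q \<le> card (f2 (snd e))" using a by auto
  qed
  then obtain F C T where FCT: "\<And>e. e \<in> M \<Longrightarrow> distinct (F e @ C e @ T e) \<and> set (F e @ C e @ T e) \<subseteq> seg e \<and>
    successively E (F e @ C e @ T e) \<and> t \<le> card (set (F e) \<inter> f2 (snd e)) \<and>
    t \<le> card (set (T e) \<inter> f1 (fst e)) \<and> 2 * q - 8 * t \<le> length (C e)" by metis
  have finR: "finite R" using R fin by (meson finite_SigmaI finite_subset)
  have cR: "card R \<le> card \<P> ^ 2"
    using card_mono[OF _ R] fin by (simp add: card_cartesian_product power2_eq_square)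
  have finM: "finite M" using M(1) finR finite_subset by blast
  have cM: "card M \<le> card \<P>"
    using card_inj_on_le[OF M(2) _ fin] MP by blast
  \<comment> \<open>The tail \<open>T\<close> of the newest segment stays outside \<open>W\<close>,
    since the next link may leave from any exit point in it. Edges enter at the head of
    \<open>es\<close> but at the end of the path.\<close>
  have main: "\<exists>W. distinct (W @ T (hd es)) \<and> successively E (W @ T (hd es)) \<and>
      set W \<subseteq> (\<Union>e\<in>set es. seg e) \<union> U \<and> card (set W \<inter> U) \<le> length es * card R \<and>
      length es * (2 * q - 8 * t) \<le> length W"
    if "set es \<subseteq> M" "distinct es" "es \<noteq> []" for es
    using that
  proof (induction es)
    case (Cons e' es)
    have e': "e' \<in> M" using Cons.prems by auto
    note Fe' = FCT[OF e']
    show ?case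
    proof (cases es)
      case Nil
      have "set (F e' @ C e') \<inter> U = {}" using Fe' segU[OF e'] by auto
      then show ?thesis using Fe' Nil by (intro exI[of _ "F e' @ C e'"]) auto
    next
      case (Cons e es')
      have e: "e \<in> M" and ee': "e' \<notin> set es" using Cons.prems Cons by auto
      obtain W where W: "distinct (W @ T e)" "successively E (W @ T e)"
        "set W \<subseteq> (\<Union>e\<in>set es. seg e) \<union> U" "card (set W \<inter> U) \<le> length es * card R"
        "length es * (2 * q - 8 * t) \<le> length W"
        using Cons.IH Cons.prems Cons by auto
      note Fe = FCT[OF e]
      have "length es = card (set es)" using Cons.prems by (simp add: distinct_card)
      also have "\<dots> \<le> card M" by (rule card_mono[OF finM]) (use Cons.prems in simp)
      finally have les: "length es \<le> card \<P>" using cM by simp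
      have "card (set W \<inter> U) \<le> card \<P> * card \<P> ^ 2" using W(4) mult_le_mono[OF les cR] by linarith
      \<comment> \<open>At most \<open>card \<P>\<close> links of at most \<open>card R\<close>
        vertices each spend half of a reserve; \<open>connect\<close> needs the other half.\<close>
      then have used: "card (set W \<inter> U) \<le> 2 * t" using t(2) by (simp add: power3_eq_cube power2_eq_square mult.assoc)
      have Ud: "2 * t \<le> card ((U - set W) \<inter> A)" if A: "A \<in> \<P>" for A
      proof -
        have "(U \<inter> A) - (set W \<inter> U) \<subseteq> (U - set W) \<inter> A" by blast
        then have "card ((U \<inter> A) - (set W \<inter> U)) \<le> card ((U - set W) \<inter> A)"
          using sz[OF A] by (intro card_mono) auto
        moreover have "card (U \<inter> A) - card (set W \<inter> U) \<le> card ((U \<inter> A) - (set W \<inter> U))"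
          by (rule diff_card_le_card_Diff) auto
        ultimately show ?thesis using UA[OF A] used by linarith
      qed
      have "\<exists>x\<in>set (T e) \<inter> f1 (fst e). \<exists>y\<in>set (F e') \<inter> f2 (snd e'). \<exists>us.
          distinct us \<and> set us \<subseteq> U - set W \<and> length us \<le> card R \<and> successively E (x # us @ [y])"
      \<comment> \<open>Exit points lie in \<open>fst e\<close> but entry points in
        \<open>snd e'\<close>, so the walk ends with the edge \<open>e'\<close> itself.\<close>
      proof (rule connect[of "fst e" "fst e'" R "snd e'" E t])
        show "(fst e, fst e') \<in> R\<^sup>*" by (rule conn[OF e e'])
        show "(fst e', snd e') \<in> R" using e' M(1) by auto
        show "finite R" by (rule finR)
        show "set (T e) \<inter> f1 (fst e) \<subseteq> fst e" "set (F e') \<inter> f2 (snd e') \<subseteq> snd e'"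
          using f[OF MP(1)[OF e]] f[OF MP(2)[OF e']] by auto
        show "t \<le> card (set (T e) \<inter> f1 (fst e))" "t \<le> card (set (F e') \<inter> f2 (snd e'))" using Fe Fe' by auto
        show "finite B \<and> 2 * t \<le> card ((U - set W) \<inter> B)" if "(A, B) \<in> R" for A B
          using that R sz Ud by blast
      qed (rule jn)
      then obtain x y us where xy: "x \<in> set (T e)" "y \<in> set (F e')" and us: "distinct us"
        "set us \<subseteq> U - set W" "length us \<le> card R" "successively E (x # us @ [y])" by blast
      have "seg e1 \<inter> seg e' = {}" if "e1 \<in> set es" for e1
        using segseg[OF _ e', of e1] that Cons.prems ee' by auto
      then have Wse: "set W \<inter> seg e' = {}" using W(3) segU[OF e'] by blast
      have "set (T e) \<subseteq> seg e" using Fe by auto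
      moreover have "seg e \<inter> seg e' = {}" using segseg[OF e e'] ee' Cons by auto
      ultimately have Tse: "set (T e) \<inter> seg e' = {}" by blast
      have "\<exists>Z. distinct (W @ Z @ (C e' @ T e')) \<and> successively E (W @ Z @ (C e' @ T e')) \<and>
          set Z \<subseteq> set (T e) \<union> set us \<union> set (F e')"
      proof (rule splice[OF W(1,2) _ _ _ xy us(1) _ _ us(4)])
        show "distinct (F e' @ C e' @ T e')" "successively E (F e' @ C e' @ T e')" using Fe' by auto
        have 1: "set (T e) \<subseteq> seg e" using Fe by auto
        have 2: "set (F e' @ C e' @ T e') \<subseteq> seg e'" using Fe' by blast
        show "set (W @ T e) \<inter> set (F e' @ C e' @ T e') = {}" using 2 Wse Tse unfolding set_append[of W] by blast
        show "set us \<inter> set (W @ T e) = {}" using us(2) 1 segU[OF e] unfolding set_append by blast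
        show "set us \<inter> set (F e' @ C e' @ T e') = {}" using us(2) 2 segU[OF e'] by blast
      qed
      then obtain Z where Z: "distinct (W @ Z @ (C e' @ T e'))" "successively E (W @ Z @ (C e' @ T e'))"
        "set Z \<subseteq> set (T e) \<union> set us \<union> set (F e')" by blast
      let ?W = "W @ Z @ C e'"
      have Zs: "set Z \<union> set (C e') \<subseteq> seg e \<union> seg e' \<union> set us" using Z(3) Fe Fe' by auto
      have "set ?W = set W \<union> (set Z \<union> set (C e'))" by auto
      moreover have "seg e \<union> seg e' \<subseteq> (\<Union>e\<in>set (e' # es). seg e)" using Cons by auto
      ultimately have sW: "set ?W \<subseteq> (\<Union>e\<in>set (e' # es). seg e) \<union> U"
        using W(3) Zs us(2) by auto
      have "set ?W \<inter> U \<subseteq> (set W \<inter> U) \<union> set us"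
        using Zs segU[OF e] segU[OF e'] by auto
      then have "card (set ?W \<inter> U) \<le> card (set W \<inter> U) + card (set us)"
        by (meson List.finite_set card_Un_le card_mono finite_Int finite_UnI order_trans)
      then have "card (set ?W \<inter> U) \<le> length (e' # es) * card R"
        using W(4) us(3) card_length[of us] by simp
      moreover have "length (e' # es) * (2 * q - 8 * t) \<le> length ?W" using W(5) Fe' by simp
      ultimately show ?thesis using Z sW by (intro exI[of _ ?W]) simp
    qed
  qed simp
  obtain es where es: "set es = M" "distinct es" using finite_distinct_list[OF finM] by blast
  then obtain W where W: "distinct (W @ T (hd es))" "successively E (W @ T (hd es))"
      "set W \<subseteq> (\<Union>e\<in>set es. seg e) \<union> U" "length es * (2 * q - 8 * t) \<le> length W"
    using main[of es] Mne by auto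
  have "card M * (s - 12 * t - 1) \<le> length es * (2 * q - 8 * t)"
  proof (rule mult_le_mono)
    show "card M \<le> length es" using es by (metis distinct_card order_refl)
    show "s - 12 * t - 1 \<le> 2 * q - 8 * t" using q by linarith
  qed
  moreover have "set W \<subseteq> \<Union>\<P>"
  proof -
    have "seg e \<subseteq> \<Union>\<P>" if "e \<in> M" for e using f[OF MP(1)[OF that]] f[OF MP(2)[OF that]] MP[OF that] unfolding seg_def by blast
    then show ?thesis using W(3) es(1) unfolding U_def by blast
  qed
  ultimately show ?thesis using W by (intro exI[of _ W]) (auto simp: successively_append_iff)
qed

section \<open>Regularity for empty witnesses\<close>

definition equipart :: "'a set \<Rightarrow> nat \<Rightarrow> 'a set set \<Rightarrow> bool" where
  "equipart V s \<P> \<longleftrightarrow> \<Union>\<P> \<subseteq> V \<and> (\<forall>A\<in>\<P>. \<forall>B\<in>\<P>. A \<noteq> B \<longrightarrow> A \<inter> B = {}) \<and> (\<forall>A\<in>\<P>. card A = s)"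

text \<open>The lower bound on \<open>s\<close> keeps the number of blocks at most
  \<open>1 / \<sigma>\<close>, independently of \<open>V\<close>.\<close>

definition coarse :: "real \<Rightarrow> real \<Rightarrow> 'a set \<Rightarrow> nat \<Rightarrow> 'a set set \<Rightarrow> bool" where
  "coarse \<sigma> \<mu> V s \<P> \<longleftrightarrow> equipart V s \<P> \<and> 0 < s \<and> \<sigma> * real (card V) \<le> real s \<and>
     real (card (V - \<Union>\<P>)) \<le> \<mu> * real (card V)"

definition present :: "('a \<Rightarrow> 'a \<Rightarrow> bool) \<Rightarrow> 'a set \<Rightarrow> 'a set \<Rightarrow> bool" where
  "present E A B \<longleftrightarrow> (\<exists>x\<in>A. \<exists>y\<in>B. E x y)"

definition irregular :: "nat \<Rightarrow> (nat \<Rightarrow> 'a \<Rightarrow> 'a \<Rightarrow> bool) \<Rightarrow> nat \<Rightarrow> 'a set \<Rightarrow> 'a set \<Rightarrow> bool" where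
  "irregular r E t A B \<longleftrightarrow> (\<exists>k<r. present (E k) A B \<and> \<not> joined (E k) t A B)"

definition bad_pairs :: "nat \<Rightarrow> (nat \<Rightarrow> 'a \<Rightarrow> 'a \<Rightarrow> bool) \<Rightarrow> nat \<Rightarrow> 'a set set \<Rightarrow> ('a set \<times> 'a set) set" where
  "bad_pairs r E t \<P> = {(A, B) \<in> \<P> \<times> \<P>. irregular r E t A B}"

definition shadow :: "nat \<Rightarrow> (nat \<Rightarrow> 'a \<Rightarrow> 'a \<Rightarrow> bool) \<Rightarrow> 'a set set \<Rightarrow> (nat \<times> 'a \<times> 'a) set" where
  "shadow r E \<P> = {(k, u, v). k < r \<and> (\<exists>A\<in>\<P>. \<exists>B\<in>\<P>. u \<in> A \<and> v \<in> B \<and> present (E k) A B)}"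

lemma equipart_subset: "equipart V s \<P> \<Longrightarrow> A \<in> \<P> \<Longrightarrow> A \<subseteq> V"
  unfolding equipart_def by blast

lemma equipart_block_card: "equipart V s \<P> \<Longrightarrow> A \<in> \<P> \<Longrightarrow> card A = s"
  unfolding equipart_def by blast

lemma equipart_disjoint: "equipart V s \<P> \<Longrightarrow> A \<in> \<P> \<Longrightarrow> B \<in> \<P> \<Longrightarrow> A \<noteq> B \<Longrightarrow> A \<inter> B = {}"
  unfolding equipart_def by blast

lemma equipart_finite: "equipart V s \<P> \<Longrightarrow> finite V \<Longrightarrow> finite \<P> \<and> (\<forall>A\<in>\<P>. finite A)"
  unfolding equipart_def by (meson Sup_le_iff finite_UnionD finite_subset)

lemma equipart_card: assumes "equipart V s \<P>" "finite V" shows "card \<P> * s = card (\<Union>\<P>)"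
proof -
  have "card (\<Union>\<P>) = (\<Sum>A\<in>\<P>. card A)"
    using assms equipart_finite[OF assms]
    by (intro card_Union_disjoint) (auto simp: equipart_def pairwise_def disjnt_def)
  then show ?thesis using assms by (simp add: equipart_def)
qed

lemma equipart_card_le: assumes "equipart V s \<P>" "finite V" shows "card \<P> * s \<le> card V"
  using equipart_card[OF assms] assms by (metis card_mono equipart_def)

lemma chop:
  assumes "finite A" "0 < s"
  shows "\<exists>\<Q>. equipart A s \<Q> \<and> card (A - \<Union>\<Q>) < s"
  using assms(1)
proof (induction "card A" arbitrary: A rule: less_induct)
  case less
  show ?case
  proof (cases "card A < s")
    case True
    then show ?thesis by (intro exI[of _ "{}"]) (simp add: equipart_def)
  next
    case False
    then obtain X where X: "X \<subseteq> A" "card X = s" "finite X" by (meson not_le obtain_subset_with_card_n)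
    have "card (A - X) < card A" using X less.prems assms(2) by (metis card_Diff_subset card_gt_0_iff diff_less card_mono le_trans not_gr_zero not_le False less_le_trans)
    then obtain \<Q> where Q: "equipart (A - X) s \<Q>" "card (A - X - \<Union>\<Q>) < s"
      using less.hyps[of "A - X"] less.prems by auto
    have q: "\<Union>\<Q> \<subseteq> A - X" "\<forall>A\<in>\<Q>. \<forall>B\<in>\<Q>. A \<noteq> B \<longrightarrow> A \<inter> B = {}" "\<forall>A\<in>\<Q>. card A = s"
      using Q(1) by (auto simp: equipart_def)
    have "equipart A s (insert X \<Q>)" unfolding equipart_def
    proof (intro conjI)
      show "\<Union> (insert X \<Q>) \<subseteq> A" "\<forall>A\<in>insert X \<Q>. card A = s" using q X by auto
      have "X \<inter> B = {}" "B \<inter> X = {}" if "B \<in> \<Q>" for B using q(1) that by auto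
      then show "\<forall>A\<in>insert X \<Q>. \<forall>B\<in>insert X \<Q>. A \<noteq> B \<longrightarrow> A \<inter> B = {}" using q(2) by auto
    qed
    moreover have "A - \<Union>(insert X \<Q>) = A - X - \<Union>\<Q>" by auto
    ultimately show ?thesis using Q(2) by metis
  qed
qed

text \<open>Each block is divided into the atoms of \<open>\<X>\<close>, and each atom is chopped;
  one of the \<open>card \<P> * 2 ^ card \<X>\<close> atoms wastes fewer than \<open>s'\<close>
  vertices.\<close>

lemma refine:
  assumes fin: "finite V" and P: "equipart V s \<P>" and X: "finite \<X>" and s': "0 < s'"
  shows "\<exists>\<P>'. equipart V s' \<P>' \<and> (\<forall>A'\<in>\<P>'. \<exists>A\<in>\<P>. A' \<subseteq> A) \<and>
    (\<forall>A'\<in>\<P>'. \<forall>X\<in>\<X>. A' \<subseteq> X \<or> A' \<inter> X = {}) \<and>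
    card (V - \<Union>\<P>') \<le> card (V - \<Union>\<P>) + card \<P> * 2 ^ card \<X> * s'"
proof -
  define I where "I = \<P> \<times> Pow \<X>"
  define cell where "cell i = {v \<in> fst i. {X\<in>\<X>. v \<in> X} = snd i}" for i
  have finP: "finite \<P>" "\<And>A. A \<in> \<P> \<Longrightarrow> finite A" using equipart_finite[OF P fin] by auto
  have finI: "finite I" unfolding I_def using finP X by simp
  have cI: "card I = card \<P> * 2 ^ card \<X>" unfolding I_def using X by (simp add: card_cartesian_product card_Pow)
  have fat: "finite (cell i)" if "i \<in> I" for i using that finP unfolding cell_def I_def by auto
  have "\<exists>\<Q>. equipart (cell i) s' \<Q> \<and> card (cell i - \<Union>\<Q>) < s'" if "i \<in> I" for i
    by (rule chop[OF fat[OF that] s'])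
  then obtain Q where Q: "\<And>i. i \<in> I \<Longrightarrow> equipart (cell i) s' (Q i)" "\<And>i. i \<in> I \<Longrightarrow> card (cell i - \<Union>(Q i)) < s'"
    by metis
  define \<P>' where "\<P>' = (\<Union>i\<in>I. Q i)"
  have Qat: "A \<subseteq> cell i" if "A \<in> Q i" "i \<in> I" for A i using Q(1)[OF that(2)] that unfolding equipart_def by blast
  have atdj: "cell i \<inter> cell j = {}" if "i \<in> I" "j \<in> I" "i \<noteq> j" for i j
  proof (cases "fst i = fst j")
    case True
    then have "snd i \<noteq> snd j" using that(3) by (simp add: prod_eq_iff)
    then show ?thesis unfolding cell_def by blast
  next
    case False
    moreover have "fst i \<in> \<P>" "fst j \<in> \<P>" using that unfolding I_def by auto
    ultimately have "fst i \<inter> fst j = {}" using equipart_disjoint[OF P] by blast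
    then show ?thesis unfolding cell_def by blast
  qed
  have atP: "cell i \<subseteq> fst i" "fst i \<in> \<P>" if "i \<in> I" for i using that unfolding cell_def I_def by auto
  have "equipart V s' \<P>'" unfolding equipart_def
  proof (intro conjI ballI impI)
    show "\<Union>\<P>' \<subseteq> V"
    proof (rule Union_least)
      fix A assume "A \<in> \<P>'"
      then obtain i where i: "i \<in> I" "A \<in> Q i" unfolding \<P>'_def by blast
      then show "A \<subseteq> V" using Qat[OF i(2,1)] atP[OF i(1)] equipart_subset[OF P] by (meson order_trans)
    qed
    show "card A = s'" if A: "A \<in> \<P>'" for A
    proof -
      obtain i where i: "i \<in> I" "A \<in> Q i" using A unfolding \<P>'_def by blast
      show ?thesis by (rule equipart_block_card[OF Q(1)[OF i(1)] i(2)])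
    qed
    fix A B assume AB: "A \<in> \<P>'" "B \<in> \<P>'" "A \<noteq> B"
    then obtain i j where ij: "i \<in> I" "j \<in> I" "A \<in> Q i" "B \<in> Q j" unfolding \<P>'_def by blast
    show "A \<inter> B = {}"
    proof (cases "i = j")
      case True then show ?thesis using equipart_disjoint[OF Q(1)[OF ij(1)]] ij AB by blast
    next
      case False then show ?thesis using atdj[OF ij(1,2)] Qat[OF ij(3,1)] Qat[OF ij(4,2)] by blast
    qed
  qed
  moreover have "\<forall>A'\<in>\<P>'. \<exists>A\<in>\<P>. A' \<subseteq> A"
  proof
    fix A assume "A \<in> \<P>'"
    then obtain i where i: "i \<in> I" "A \<in> Q i" unfolding \<P>'_def by blast
    then show "\<exists>B\<in>\<P>. A \<subseteq> B" using Qat[OF i(2,1)] atP[OF i(1)] by (meson order_trans)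
  qed
  moreover have "\<forall>A'\<in>\<P>'. \<forall>X\<in>\<X>. A' \<subseteq> X \<or> A' \<inter> X = {}"
  proof (intro ballI)
    fix A' X assume A: "A' \<in> \<P>'" and X: "X \<in> \<X>"
    obtain i where i: "i \<in> I" "A' \<in> Q i" using A unfolding \<P>'_def by blast
    have "A' \<subseteq> cell i" by (rule Qat[OF i(2,1)])
    then show "A' \<subseteq> X \<or> A' \<inter> X = {}" using X unfolding cell_def by (cases "X \<in> snd i") auto
  qed
  moreover have "card (V - \<Union>\<P>') \<le> card (V - \<Union>\<P>) + card \<P> * 2 ^ card \<X> * s'"
  proof -
    have "V - \<Union>\<P>' \<subseteq> (V - \<Union>\<P>) \<union> (\<Union>i\<in>I. cell i - \<Union>(Q i))"
    proof
      fix v assume v: "v \<in> V - \<Union>\<P>'"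
      show "v \<in> (V - \<Union>\<P>) \<union> (\<Union>i\<in>I. cell i - \<Union>(Q i))"
      proof (cases "v \<in> \<Union>\<P>")
        case True
        then obtain A where A: "A \<in> \<P>" "v \<in> A" by blast
        let ?i = "(A, {X\<in>\<X>. v \<in> X})"
        have "?i \<in> I" "v \<in> cell ?i" using A unfolding I_def cell_def by auto
        then show ?thesis using v unfolding \<P>'_def by blast
      qed (use v in blast)
    qed
    then have "card (V - \<Union>\<P>') \<le> card ((V - \<Union>\<P>) \<union> (\<Union>i\<in>I. cell i - \<Union>(Q i)))"
      using fin finI fat by (intro card_mono) auto
    also have "\<dots> \<le> card (V - \<Union>\<P>) + card (\<Union>i\<in>I. cell i - \<Union>(Q i))" by (rule card_Un_le)
    also have "card (\<Union>i\<in>I. cell i - \<Union>(Q i)) \<le> (\<Sum>i\<in>I. card (cell i - \<Union>(Q i)))" by (rule card_UN_le[OF finI])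
    also have "\<dots> \<le> (\<Sum>i\<in>I. s')" by (rule sum_mono) (use Q(2) in \<open>simp add: less_imp_le\<close>)
    finally show ?thesis by (simp add: cI)
  qed
  ultimately show ?thesis by blast
qed

lemma shadow_finite: assumes "\<Union>\<P> \<subseteq> V" "finite V" shows "finite (shadow r E \<P>)" "card (shadow r E \<P>) \<le> r * (card V)\<^sup>2"
proof -
  have s: "shadow r E \<P> \<subseteq> {..<r} \<times> V \<times> V" using assms(1) unfolding shadow_def by blast
  then show "finite (shadow r E \<P>)" using assms(2) by (meson finite_SigmaI finite_lessThan finite_subset)
  have "card (shadow r E \<P>) \<le> card ({..<r} \<times> V \<times> V)" by (rule card_mono[OF _ s]) (use assms in simp)
  then show "card (shadow r E \<P>) \<le> r * (card V)\<^sup>2" by (simp add: card_cartesian_product power2_eq_square)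
qed

text \<open>
  A pair with an empty witness for a present colour loses at least a \<open>\<delta>\<^sup>2\<close> fraction of its
  weight in \<^const>\<open>shadow\<close> once the witness is cut out.
\<close>

lemma shadow_decrement:
  fixes \<delta> :: real
  assumes fin: "finite V" and P: "equipart V s \<P>" and s': "0 < s'" and \<delta>: "0 \<le> \<delta>"
  defines "t \<equiv> nat \<lceil>\<delta> * s\<rceil>"
  shows "\<exists>\<P>'. equipart V s' \<P>' \<and>
    card (V - \<Union>\<P>') \<le> card (V - \<Union>\<P>) + card \<P> * 2 ^ (2 * (card \<P>)\<^sup>2) * s' \<and>
    card (shadow r E \<P>') + card (bad_pairs r E t \<P>) * (\<delta> * s)\<^sup>2 \<le> card (shadow r E \<P>)"
proof -
  let ?B = "bad_pairs r E t \<P>"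
  have finP: "finite \<P>" "\<And>A. A \<in> \<P> \<Longrightarrow> finite A" using equipart_finite[OF P fin] by auto
  have BP: "?B \<subseteq> \<P> \<times> \<P>" unfolding bad_pairs_def by auto
  have finB: "finite ?B" using BP finP by (meson finite_SigmaI finite_subset)
  have "\<exists>k X Y. k < r \<and> present (E k) (fst p) (snd p) \<and> X \<subseteq> fst p \<and> Y \<subseteq> snd p \<and> t \<le> card X \<and> t \<le> card Y \<and>
      (\<forall>x\<in>X. \<forall>y\<in>Y. \<not> E k x y)" if "p \<in> ?B" for p
    using that unfolding bad_pairs_def irregular_def joined_def by fastforce
  then obtain k X Y where w: "\<And>p. p \<in> ?B \<Longrightarrow> k p < r \<and> present (E (k p)) (fst p) (snd p) \<and> X p \<subseteq> fst p \<and>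
      Y p \<subseteq> snd p \<and> t \<le> card (X p) \<and> t \<le> card (Y p) \<and> (\<forall>x\<in>X p. \<forall>y\<in>Y p. \<not> E (k p) x y)" by metis
  let ?X = "X ` ?B \<union> Y ` ?B"
  have "finite ?X" using finB by simp
  from refine[OF fin P this s'] obtain \<P>' where P'0: "equipart V s' \<P>' \<and> (\<forall>A'\<in>\<P>'. \<exists>A\<in>\<P>. A' \<subseteq> A) \<and>
    (\<forall>A'\<in>\<P>'. \<forall>Z\<in>?X. A' \<subseteq> Z \<or> A' \<inter> Z = {}) \<and>
    card (V - \<Union>\<P>') \<le> card (V - \<Union>\<P>) + card \<P> * 2 ^ card ?X * s'" ..
  note P' = P'0[THEN conjunct1] P'0[THEN conjunct2, THEN conjunct1] P'0[THEN conjunct2, THEN conjunct2, THEN conjunct1]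
    P'0[THEN conjunct2, THEN conjunct2, THEN conjunct2]
  have "card ?X \<le> card (X ` ?B) + card (Y ` ?B)" by (rule card_Un_le)
  also have "\<dots> \<le> card ?B + card ?B" by (intro add_mono card_image_le finB)
  \<comment> \<open>Two witness sets for each ordered pair of blocks.\<close>
  also have "\<dots> \<le> 2 * (card \<P>)\<^sup>2"
    using card_mono[OF _ BP] finP by (simp add: card_cartesian_product power2_eq_square)
  finally have "card \<P> * 2 ^ card ?X * s' \<le> card \<P> * 2 ^ (2 * (card \<P>)\<^sup>2) * s'"
    by (intro mult_le_mono order_refl power_increasing) auto
  then have 1: "card (V - \<Union>\<P>') \<le> card (V - \<Union>\<P>) + card \<P> * 2 ^ (2 * (card \<P>)\<^sup>2) * s'" using P'(4) by linarith
  \<comment> \<open>One empty rectangle per irregular pair. It lies in the old shadow, because its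
    colour occurs elsewhere between the two blocks, but not in the new one, because refined blocks
    meeting a witness lie inside it.\<close>
  define D where "D = (\<Union>p\<in>?B. {k p} \<times> X p \<times> Y p)"
  have D1: "D \<subseteq> shadow r E \<P>"
  proof
    fix q assume "q \<in> D"
    then obtain p x y where p: "p \<in> ?B" "q = (k p, x, y)" "x \<in> X p" "y \<in> Y p" unfolding D_def by auto
    have "fst p \<in> \<P>" "snd p \<in> \<P>" using p(1) BP by auto
    moreover have "x \<in> fst p" "y \<in> snd p" using w[OF p(1)] p(3,4) by auto
    ultimately show "q \<in> shadow r E \<P>" using w[OF p(1)] p(2) unfolding shadow_def by blast
  qed
  have D2: "D \<inter> shadow r E \<P>' = {}"
  proof (rule ccontr)
    assume "\<not> ?thesis"
    then obtain p x y where p: "p \<in> ?B" "(k p, x, y) \<in> shadow r E \<P>'" "x \<in> X p" "y \<in> Y p" unfolding D_def by auto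
    then obtain A B where AB: "A \<in> \<P>'" "B \<in> \<P>'" "x \<in> A" "y \<in> B" "present (E (k p)) A B" unfolding shadow_def by auto
    have "X p \<in> ?X" "Y p \<in> ?X" using p(1) by auto
    then have "A \<subseteq> X p \<or> A \<inter> X p = {}" "B \<subseteq> Y p \<or> B \<inter> Y p = {}"
      using P'(3) AB(1,2) by (meson bspec)+
    then have "A \<subseteq> X p" "B \<subseteq> Y p" using AB(3,4) p(3,4) by auto
    moreover obtain a b where "a \<in> A" "b \<in> B" "E (k p) a b" using AB(5) unfolding present_def by blast
    moreover have "\<forall>x\<in>X p. \<forall>y\<in>Y p. \<not> E (k p) x y" using w[OF p(1)] by simp
    ultimately show False by blast
  qed
  have D3: "shadow r E \<P>' \<subseteq> shadow r E \<P>"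
  proof
    fix q assume "q \<in> shadow r E \<P>'"
    then obtain k u v A B where q: "q = (k, u, v)" "k < r" "A \<in> \<P>'" "B \<in> \<P>'" "u \<in> A" "v \<in> B" "present (E k) A B"
      unfolding shadow_def by auto
    obtain A0 B0 where "A0 \<in> \<P>" "A \<subseteq> A0" "B0 \<in> \<P>" "B \<subseteq> B0" using P'(2) q by metis
    moreover from this have "u \<in> A0" "v \<in> B0" "present (E k) A0 B0" using q unfolding present_def by blast+
    ultimately show "q \<in> shadow r E \<P>" using q(1,2) unfolding shadow_def by blast
  qed
  have fh: "finite (shadow r E \<P>)" by (rule shadow_finite(1)[OF _ fin]) (use P in \<open>simp add: equipart_def\<close>)
  have "card (shadow r E \<P>') + card D = card (shadow r E \<P>' \<union> D)"
    using D1 D2 D3 fh by (subst card_Un_disjoint) (auto intro: finite_subset)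
  also have "\<dots> \<le> card (shadow r E \<P>)" using D1 D3 fh by (intro card_mono) auto
  finally have 2: "card (shadow r E \<P>') + card D \<le> card (shadow r E \<P>)" .
  have fXY: "finite (X p)" "finite (Y p)" if "p \<in> ?B" for p
  proof -
    have "fst p \<in> \<P>" "snd p \<in> \<P>" using BP that by auto
    then show "finite (X p)" "finite (Y p)" using w[OF that] finP(2) finite_subset by metis+
  qed
  have "card D = (\<Sum>p\<in>?B. card ({k p} \<times> X p \<times> Y p))" unfolding D_def
  proof (rule card_UN_disjoint[OF finB])
    show "\<forall>p\<in>?B. finite ({k p} \<times> X p \<times> Y p)" using fXY by auto
    show "\<forall>p\<in>?B. \<forall>p'\<in>?B. p \<noteq> p' \<longrightarrow> ({k p} \<times> X p \<times> Y p) \<inter> ({k p'} \<times> X p' \<times> Y p') = {}"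
    proof (intro ballI impI)
      fix p p' assume p: "p \<in> ?B" "p' \<in> ?B" "p \<noteq> p'"
      have "fst p \<noteq> fst p' \<or> snd p \<noteq> snd p'" using p(3) by (simp add: prod_eq_iff)
      then have "fst p \<inter> fst p' = {} \<or> snd p \<inter> snd p' = {}" using BP p(1,2) equipart_disjoint[OF P] by (metis mem_Times_iff subsetD)
      moreover have "X p \<subseteq> fst p" "Y p \<subseteq> snd p" "X p' \<subseteq> fst p'" "Y p' \<subseteq> snd p'"
        using w[OF p(1)] w[OF p(2)] by simp_all
      ultimately have "X p \<inter> X p' = {} \<or> Y p \<inter> Y p' = {}" by blast
      then show "({k p} \<times> X p \<times> Y p) \<inter> ({k p'} \<times> X p' \<times> Y p') = {}" by auto
    qed
  qed
  then have "real (card D) = (\<Sum>p\<in>?B. real (card (X p)) * real (card (Y p)))" by (simp add: card_cartesian_product)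
  also have "\<dots> \<ge> (\<Sum>p\<in>?B. (\<delta> * s) * (\<delta> * s))"
  proof (intro sum_mono mult_mono)
    fix p assume p: "p \<in> ?B"
    have "\<delta> * s \<le> t" unfolding t_def by linarith
    then show "\<delta> * s \<le> card (X p)" "\<delta> * s \<le> card (Y p)" using w[OF p] by linarith+
  qed (use \<delta> in auto)
  finally have 3: "card ?B * (\<delta> * s)\<^sup>2 \<le> real (card D)" by (simp add: power2_eq_square)
  have "real (card (shadow r E \<P>')) + real (card D) \<le> card (shadow r E \<P>)" using 2 by linarith
  then show ?thesis using P'(1) 1 3 by (intro exI[of _ \<P>']) auto
qed

text \<open>The shadow has at most \<open>r * (card V)\<^sup>2\<close> elements and loses a share
  \<open>\<delta>\<^sup>2 * \<epsilon>\<close> of \<open>(card V)\<^sup>2\<close> in every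
  unsuccessful round, at the price of a further proportion \<open>\<beta>\<close> of left-over
  vertices.\<close>

lemma regularity_iterate:
  fixes \<epsilon> \<delta> \<beta> :: real and r j :: nat
  assumes "0 < \<epsilon>" "0 < \<delta>" "0 < \<beta>"
  shows "\<exists>(\<sigma>::real) n0. 0 < \<sigma> \<and> 1 \<le> n0 \<and> (\<forall>(V :: 'a set) E. finite V \<longrightarrow> n0 \<le> card V \<longrightarrow> (\<exists>s \<P>. coarse \<sigma> (j * \<beta>) V s \<P> \<and>
     (card (bad_pairs r E (nat \<lceil>\<delta> * s\<rceil>) \<P>) * (real s)\<^sup>2 \<le> \<epsilon> * (card V)\<^sup>2 \<or>
      card (shadow r E \<P>) \<le> (r - j * (\<delta>\<^sup>2 * \<epsilon>)) * (card V)\<^sup>2)))"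
proof (induction j)
  case 0
  have "coarse 1 (real 0 * \<beta>) V (card V) {V} \<and> card (shadow r E {V}) \<le> (real r - real 0 * (\<delta>\<^sup>2 * \<epsilon>)) * (card V)\<^sup>2"
    if "finite V" "1 \<le> card V" for V :: "'a set" and E
  proof -
    have "card (shadow r E {V}) \<le> r * (card V)\<^sup>2"
      using shadow_finite(2)[of "{V}" V r E] that by simp
    then have "real (card (shadow r E {V})) \<le> real (r * (card V)\<^sup>2)" unfolding of_nat_le_iff .
    then show ?thesis using that by (simp add: coarse_def equipart_def)
  qed
  note base = this
  show ?case
    by (rule exI[of _ "1::real"], rule exI[of _ "1::nat"],
        intro conjI allI impI zero_less_one order_refl) (metis base)
next
  case (Suc j)
  then obtain \<sigma> n0 where \<sigma>: "\<sigma> > 0" and n0: "n0 \<ge> 1" and IH: "\<And>(V :: 'a set) E. finite V \<Longrightarrow> n0 \<le> card V \<Longrightarrow> (\<exists>s \<P>. coarse \<sigma> (j * \<beta>) V s \<P> \<and>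
     (card (bad_pairs r E (nat \<lceil>\<delta> * s\<rceil>) \<P>) * (real s)\<^sup>2 \<le> \<epsilon> * (card V)\<^sup>2 \<or>
      card (shadow r E \<P>) \<le> (r - j * (\<delta>\<^sup>2 * \<epsilon>)) * (card V)\<^sup>2))" by metis
  \<comment> \<open>\<open>N\<close> bounds the number of old blocks and \<open>K\<close> that of
    the cells of the refinement. \<open>\<sigma>'\<close> makes the waste over all cells at most
    \<open>\<beta> * card V\<close>; the 2 in it pays for the ceiling in \<open>s'\<close>.\<close>
  define N where "N = nat \<lfloor>1 / \<sigma>\<rfloor>"
  define K where "K = Suc (N * 2 ^ (2 * N\<^sup>2))"
  define \<sigma>' where "\<sigma>' = min \<sigma> (\<beta> / (2 * K))"
  have "0 < K" unfolding K_def by simp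
  then have "0 < \<beta> / (2 * real K)" using assms by simp
  then have \<sigma>': "0 < \<sigma>'" "\<sigma>' \<le> \<sigma>" "\<sigma>' \<le> \<beta> / (2 * real K)" using \<sigma> unfolding \<sigma>'_def by auto
  define n1 where "n1 = max n0 (nat \<lceil>1 / \<sigma>'\<rceil>)"
  have "\<exists>s \<P>. coarse \<sigma>' (Suc j * \<beta>) V s \<P> \<and>
     (card (bad_pairs r E (nat \<lceil>\<delta> * s\<rceil>) \<P>) * (real s)\<^sup>2 \<le> \<epsilon> * (card V)\<^sup>2 \<or>
      card (shadow r E \<P>) \<le> (r - Suc j * (\<delta>\<^sup>2 * \<epsilon>)) * (card V)\<^sup>2)"
    if V: "finite V" "n1 \<le> card V" for V :: "'a set" and E
  proof -
    let ?n = "real (card V)"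
    have n: "n0 \<le> card V" "1 / \<sigma>' \<le> ?n" using V(2) unfolding n1_def by linarith+
    obtain s \<P> where s0: "coarse \<sigma> (j * \<beta>) V s \<P>" and s5:
      "card (bad_pairs r E (nat \<lceil>\<delta> * s\<rceil>) \<P>) * (real s)\<^sup>2 \<le> \<epsilon> * (card V)\<^sup>2 \<or>
      card (shadow r E \<P>) \<le> (r - j * (\<delta>\<^sup>2 * \<epsilon>)) * (card V)\<^sup>2" using IH[OF V(1) n(1)] by metis
    note s = s0[unfolded coarse_def, THEN conjunct1] s0[unfolded coarse_def, THEN conjunct2, THEN conjunct1]
      s0[unfolded coarse_def, THEN conjunct2, THEN conjunct2, THEN conjunct1]
      s0[unfolded coarse_def, THEN conjunct2, THEN conjunct2, THEN conjunct2] s5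
    have npos: "0 < ?n" using n(1) n0 by simp
    show ?thesis
    proof (cases "card (bad_pairs r E (nat \<lceil>\<delta> * s\<rceil>) \<P>) * (real s)\<^sup>2 \<le> \<epsilon> * (card V)\<^sup>2")
      case True
      have "\<sigma>' * ?n \<le> s" using s(3) mult_right_mono[OF \<sigma>'(2), of ?n] by linarith
      moreover have "real j * \<beta> * ?n \<le> real (Suc j) * \<beta> * ?n" using assms by (intro mult_right_mono) auto
      ultimately show ?thesis using True s(1,2,4) unfolding coarse_def
        by (intro exI[of _ s] exI[of _ \<P>]) auto
    next
      case False
      define s' where "s' = nat \<lceil>\<sigma>' * ?n\<rceil>"
      have "1 \<le> \<sigma>' * ?n" using n(2) \<sigma>'(1) by (simp add: field_simps)
      then have s': "0 < s'" "\<sigma>' * ?n \<le> s'" "s' \<le> 2 * (\<sigma>' * ?n)" unfolding s'_def by linarith+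
      obtain \<P>' where P': "equipart V s' \<P>'"
        "card (V - \<Union>\<P>') \<le> card (V - \<Union>\<P>) + card \<P> * 2 ^ (2 * (card \<P>)\<^sup>2) * s'"
        "card (shadow r E \<P>') + card (bad_pairs r E (nat \<lceil>\<delta> * s\<rceil>) \<P>) * (\<delta> * s)\<^sup>2 \<le> card (shadow r E \<P>)"
        using shadow_decrement[OF V(1) s(1) s'(1), of \<delta> r E] assms by auto
      have "real (card \<P>) * (\<sigma> * ?n) \<le> real (card \<P>) * s" using s(3) by (intro mult_left_mono) auto
      also have "\<dots> \<le> ?n" using equipart_card_le[OF s(1) V(1)] by (metis of_nat_le_iff of_nat_mult)
      finally have "real (card \<P>) \<le> 1 / \<sigma>" using npos \<sigma> by (simp add: field_simps)
      then have cN: "card \<P> \<le> N" unfolding N_def by linarith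
      have "card \<P> * 2 ^ (2 * (card \<P>)\<^sup>2) \<le> N * 2 ^ (2 * N\<^sup>2)"
        using cN by (intro mult_le_mono power_increasing) (auto intro: power_mono)
      then have "card \<P> * 2 ^ (2 * (card \<P>)\<^sup>2) \<le> K" unfolding K_def by linarith
      then have "card \<P> * 2 ^ (2 * (card \<P>)\<^sup>2) * s' \<le> K * s'" by (rule mult_le_mono1)
      then have "real (card (V - \<Union>\<P>')) \<le> real (card (V - \<Union>\<P>)) + real K * real s'"
        using P'(2) by (metis (no_types, lifting) add_left_mono le_trans of_nat_add of_nat_le_iff of_nat_mult)
      also have "real K * real s' \<le> real K * (2 * (\<sigma>' * ?n))" using s'(3) by (intro mult_left_mono) auto
      also have "\<dots> \<le> real K * (2 * (\<beta> / (2 * K) * ?n))" using \<sigma>'(3) npos by (intro mult_left_mono mult_right_mono) auto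
      also have "\<dots> = \<beta> * ?n" using \<open>0 < K\<close> by (simp add: field_simps)
      finally have left: "card (V - \<Union>\<P>') \<le> real (Suc j) * \<beta> * ?n" using s(4) by (simp add: algebra_simps)
      have "\<epsilon> * ?n\<^sup>2 * \<delta>\<^sup>2 \<le> card (bad_pairs r E (nat \<lceil>\<delta> * s\<rceil>) \<P>) * (real s)\<^sup>2 * \<delta>\<^sup>2"
        using False by (intro mult_right_mono) auto
      then have "card (shadow r E \<P>') \<le> card (shadow r E \<P>) - \<epsilon> * ?n\<^sup>2 * \<delta>\<^sup>2"
        using P'(3) by (simp add: power_mult_distrib algebra_simps)
      also have "\<dots> \<le> (r - j * (\<delta>\<^sup>2 * \<epsilon>)) * ?n\<^sup>2 - \<epsilon> * ?n\<^sup>2 * \<delta>\<^sup>2" using s(5) False by simp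
      also have "\<dots> = (r - Suc j * (\<delta>\<^sup>2 * \<epsilon>)) * ?n\<^sup>2" by (simp add: algebra_simps)
      finally show ?thesis using P'(1) s' left unfolding coarse_def
        by (intro exI[of _ s'] exI[of _ \<P>']) simp
    qed
  qed
  moreover have "1 \<le> n1" using n0 unfolding n1_def by linarith
  ultimately show ?case using \<sigma>'(1) by blast
qed

lemma regularity:
  fixes \<epsilon> \<delta> :: real and r :: nat
  assumes "0 < \<epsilon>" "0 < \<delta>"
  shows "\<exists>(\<sigma>::real) n0. 0 < \<sigma> \<and> 1 \<le> n0 \<and> (\<forall>(V :: 'a set) E. finite V \<longrightarrow> n0 \<le> card V \<longrightarrow> (\<exists>s \<P>. coarse \<sigma> \<epsilon> V s \<P> \<and>
     card (bad_pairs r E (nat \<lceil>\<delta> * s\<rceil>) \<P>) * (real s)\<^sup>2 \<le> \<epsilon> * (card V)\<^sup>2))"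
proof -
  \<comment> \<open>After \<open>J\<close> rounds the bound on the shadow would be negative.\<close>
  obtain J :: nat where J: "r / (\<delta>\<^sup>2 * \<epsilon>) < J" using reals_Archimedean2 by blast
  have J': "r - J * (\<delta>\<^sup>2 * \<epsilon>) < 0" using J assms by (simp add: field_simps)
  define \<beta> where "\<beta> = \<epsilon> / Suc J"
  have \<beta>: "0 < \<beta>" using assms unfolding \<beta>_def by simp
  have J\<beta>: "J * \<beta> \<le> \<epsilon>" using assms unfolding \<beta>_def by (simp add: field_simps)
  obtain \<sigma> n0 where \<sigma>: "\<sigma> > 0" "n0 \<ge> 1" and it: "\<And>(V :: 'a set) E. finite V \<Longrightarrow> n0 \<le> card V \<Longrightarrow> (\<exists>s \<P>. coarse \<sigma> (J * \<beta>) V s \<P> \<and>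
     (card (bad_pairs r E (nat \<lceil>\<delta> * s\<rceil>) \<P>) * (real s)\<^sup>2 \<le> \<epsilon> * (card V)\<^sup>2 \<or>
      card (shadow r E \<P>) \<le> (r - J * (\<delta>\<^sup>2 * \<epsilon>)) * (card V)\<^sup>2))"
    using regularity_iterate[OF assms \<beta>, of J r] by metis
  have "\<exists>s \<P>. coarse \<sigma> \<epsilon> V s \<P> \<and>
     card (bad_pairs r E (nat \<lceil>\<delta> * s\<rceil>) \<P>) * (real s)\<^sup>2 \<le> \<epsilon> * (card V)\<^sup>2"
    if V: "finite V" "n0 \<le> card V" for V :: "'a set" and E
  proof -
    obtain s \<P> where s: "coarse \<sigma> (J * \<beta>) V s \<P>"
     "card (bad_pairs r E (nat \<lceil>\<delta> * s\<rceil>) \<P>) * (real s)\<^sup>2 \<le> \<epsilon> * (card V)\<^sup>2 \<or>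
      card (shadow r E \<P>) \<le> (r - J * (\<delta>\<^sup>2 * \<epsilon>)) * (card V)\<^sup>2" using it[OF V] by metis
    have "(r - J * (\<delta>\<^sup>2 * \<epsilon>)) * (real (card V))\<^sup>2 < 0" using J' V \<sigma>(2) by (intro mult_neg_pos) auto
    moreover have "real J * \<beta> * card V \<le> \<epsilon> * card V" using J\<beta> by (intro mult_right_mono) auto
    ultimately show ?thesis using s unfolding coarse_def by (intro exI[of _ s] exI[of _ \<P>]) auto
  qed
  then show ?thesis using \<sigma> by blast
qed

section \<open>Sampling\<close>

text \<open>Entries may repeat, so that sums over samples split off one position at a time.\<close>

definition tuples :: "nat \<Rightarrow> 'a set \<Rightarrow> 'a list set" where
  "tuples N V = {xs. set xs \<subseteq> V \<and> length xs = N}"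

lemma tuples_0 [simp]: "tuples 0 V = {[]}"
  by (auto simp: tuples_def)

lemma tuples_card: "finite V \<Longrightarrow> card (tuples N V) = card V ^ N" "finite V \<Longrightarrow> finite (tuples N V)"
  unfolding tuples_def by (auto simp: card_lists_length_eq finite_lists_length_eq)

lemma sum_tuples_Suc:
  assumes "finite V"
  shows "(\<Sum>xs\<in>tuples (Suc N) V. f xs) = (\<Sum>v\<in>V. \<Sum>xs\<in>tuples N V. f (v # xs))"
proof -
  have "(\<Sum>xs\<in>tuples (Suc N) V. f xs) = (\<Sum>xs\<in>(\<lambda>(xs, n). n # xs) ` (tuples N V \<times> V). f xs)"
    by (simp add: tuples_def lists_length_Suc_eq)
  also have "\<dots> = (\<Sum>(xs, v)\<in>tuples N V \<times> V. f (v # xs))"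
    by (subst sum.reindex) (auto intro!: inj_onI sum.cong simp: case_prod_unfold)
  also have "\<dots> = (\<Sum>v\<in>V. \<Sum>xs\<in>tuples N V. f (v # xs))"
    by (subst sum.cartesian_product[symmetric]) (rule sum.swap)
  finally show ?thesis .
qed

text \<open>The factors \<open>card V\<close> on the left avoid the exponents \<open>N - 1\<close> and \<open>N - 2\<close>.\<close>

lemma sum_tuples_square:
  fixes d :: "'a \<Rightarrow> real"
  assumes fin: "finite V" and d: "(\<Sum>v\<in>V. d v) = 0"
  shows "card V * (\<Sum>xs\<in>tuples N V. (D + sum_list (map d xs))\<^sup>2) =
    real (card V) ^ Suc N * D\<^sup>2 + N * real (card V) ^ N * (\<Sum>v\<in>V. (d v)\<^sup>2)"
\<comment> \<open>The offset \<open>D\<close> absorbs the first entry; the mixed term vanishes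
  because \<open>d\<close> sums to 0.\<close>
proof (induction N arbitrary: D)
  case (Suc N)
  let ?n = "real (card V)" and ?Q = "\<Sum>v\<in>V. (d v)\<^sup>2"
  have "?n * (\<Sum>xs\<in>tuples (Suc N) V. (D + sum_list (map d xs))\<^sup>2) =
      (\<Sum>v\<in>V. ?n * (\<Sum>xs\<in>tuples N V. ((D + d v) + sum_list (map d xs))\<^sup>2))"
    by (simp add: sum_tuples_Suc[OF fin] sum_distrib_left add.assoc)
  also have "\<dots> = (\<Sum>v\<in>V. ?n ^ Suc N * (D + d v)\<^sup>2 + N * ?n ^ N * ?Q)"
    by (simp only: Suc.IH)
  also have "\<dots> = ?n ^ Suc N * (\<Sum>v\<in>V. (D + d v)\<^sup>2) + ?n * (N * ?n ^ N * ?Q)"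
    by (simp add: sum.distrib sum_distrib_left)
  also have "(\<Sum>v\<in>V. (D + d v)\<^sup>2) = ?n * D\<^sup>2 + ?Q"
    using d by (simp add: power2_sum sum.distrib sum_distrib_left[symmetric])
  finally show ?case by (simp add: algebra_simps)
qed simp

lemma sum_tuples_filter:
  assumes fin: "finite V"
  shows "card V * (\<Sum>xs\<in>tuples N V. length (filter P xs)) = N * card V ^ N * card {v\<in>V. P v}"
proof (induction N)
  case (Suc N)
  let ?n = "card V" and ?F = "\<Sum>xs\<in>tuples N V. length (filter P xs)"
  have "(\<Sum>xs\<in>tuples (Suc N) V. length (filter P xs)) =
      (\<Sum>v\<in>V. \<Sum>xs\<in>tuples N V. (if P v then 1 else 0) + length (filter P xs))"
    unfolding sum_tuples_Suc[OF fin] by (intro sum.cong) auto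
  also have "\<dots> = (\<Sum>v\<in>V. ?n ^ N * (if P v then 1 else 0) + ?F)"
    by (simp add: sum.distrib tuples_card[OF fin])
  also have "\<dots> = ?n ^ N * card {v\<in>V. P v} + ?n * ?F"
    using fin by (simp add: sum.distrib sum_distrib_left[symmetric] sum.If_cases Int_def)
  finally have "?n * (\<Sum>xs\<in>tuples (Suc N) V. length (filter P xs)) =
     ?n * (?n ^ N * card {v\<in>V. P v}) + ?n * (N * ?n ^ N * card {v\<in>V. P v})"
    using Suc.IH by (simp add: algebra_simps)
  then show ?case by (simp add: algebra_simps)
qed simp

text \<open>Counts pairs of positions, not of vertices: a repeated \<open>v\<close> conflicts if
  \<open>(v, v) \<in> B\<close>. Each pair is tested in one order only, which suffices for symmetric
  \<open>B\<close>.\<close>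

fun conflicts :: "('a \<times> 'a) set \<Rightarrow> 'a list \<Rightarrow> nat" where
  "conflicts B [] = 0"
| "conflicts B (v # xs) = conflicts B xs + length (filter (\<lambda>x. (v, x) \<in> B) xs)"

lemma no_conflicts:
  assumes "conflicts B xs = 0" "sym B" "i < length xs" "j < length xs" "i \<noteq> j"
  shows "(xs ! i, xs ! j) \<notin> B"
  using assms
proof (induction xs arbitrary: i j)
  case (Cons v xs)
  have v: "\<forall>x\<in>set xs. (v, x) \<notin> B" using Cons.prems(1) by (auto simp: filter_empty_conv)
  then have v': "\<forall>x\<in>set xs. (x, v) \<notin> B" using Cons.prems(2) by (meson symD)
  show ?case using Cons v v' by (cases i; cases j) auto
qed simp

text \<open>A pair of positions hits \<open>B\<close> with frequency
  \<open>card B / (card V)\<^sup>2\<close>, and there are at most \<open>N\<^sup>2\<close>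
  pairs.\<close>

lemma sum_tuples_conflicts:
  assumes fin: "finite V" and B: "B \<subseteq> V \<times> V"
  shows "(card V)\<^sup>2 * (\<Sum>xs\<in>tuples N V. conflicts B xs) \<le> N\<^sup>2 * card V ^ N * card B"
proof (induction N)
  case (Suc N)
  let ?n = "card V" and ?F = "\<Sum>xs\<in>tuples N V. conflicts B xs"
  let ?deg = "\<lambda>v. card {x\<in>V. (v, x) \<in> B}"
  have deg: "(\<Sum>v\<in>V. ?deg v) = card B"
  proof -
    have "B = (SIGMA v:V. {x\<in>V. (v, x) \<in> B})" using B by auto
    then show ?thesis using fin card_SigmaI[of V "\<lambda>v. {x\<in>V. (v, x) \<in> B}"] by simp
  qed
  have "?n\<^sup>2 * (\<Sum>xs\<in>tuples (Suc N) V. conflicts B xs) =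
     ?n * (?n\<^sup>2 * ?F) + ?n * (\<Sum>v\<in>V. ?n * (\<Sum>xs\<in>tuples N V. length (filter (\<lambda>x. (v, x) \<in> B) xs)))"
    by (simp add: sum_tuples_Suc[OF fin] sum.distrib sum_distrib_left power2_eq_square algebra_simps)
  also have "(\<Sum>v\<in>V. ?n * (\<Sum>xs\<in>tuples N V. length (filter (\<lambda>x. (v, x) \<in> B) xs))) = N * ?n ^ N * card B"
    by (simp add: sum_tuples_filter[OF fin] sum_distrib_left[symmetric] deg)
  also have "?n * (?n\<^sup>2 * ?F) \<le> ?n * (N\<^sup>2 * ?n ^ N * card B)" using Suc.IH by (rule mult_le_mono2)
  also have "?n * (N\<^sup>2 * ?n ^ N * card B) + ?n * (N * ?n ^ N * card B) = (N\<^sup>2 + N) * (?n ^ Suc N * card B)"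
    by (simp add: algebra_simps)
  also have "\<dots> \<le> (Suc N)\<^sup>2 * (?n ^ Suc N * card B)" by (rule mult_le_mono1) (simp add: power2_eq_square)
  finally show ?case by (simp add: algebra_simps)
qed simp

text \<open>Chebyshev's inequality for all \<open>\<phi> i\<close> at once: \<open>K\<close> bounds
  the squares summed over \<open>I\<close>, so the estimate does not depend on the size of
  \<open>I\<close>. In the application \<open>I\<close> lists the components.\<close>

lemma sampling:
  fixes \<phi> :: "'i \<Rightarrow> 'a \<Rightarrow> real"
  assumes fin: "finite V" "V \<noteq> {}" and B: "B \<subseteq> V \<times> V" "sym B" and \<epsilon>: "card B \<le> \<epsilon> * (real (card V))\<^sup>2"
    and I: "finite I" and K: "\<And>v. v \<in> V \<Longrightarrow> (\<Sum>i\<in>I. (\<phi> i v)\<^sup>2) \<le> K"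
    and \<beta>: "0 < \<beta>" and N: "0 < N" "(real N)\<^sup>2 * \<epsilon> + K / (N * \<beta>\<^sup>2) < 1"
  shows "\<exists>xs. set xs \<subseteq> V \<and> length xs = N \<and> (\<forall>i<N. \<forall>j<N. i \<noteq> j \<longrightarrow> (xs ! i, xs ! j) \<notin> B) \<and>
    (\<forall>i\<in>I. sum_list (map (\<phi> i) xs) \<le> N * ((\<Sum>v\<in>V. \<phi> i v) / card V + \<beta>))"
proof -
  define n where "n = real (card V)"
  have n: "0 < n" using fin by (simp add: n_def card_gt_0_iff)
  define \<mu> where "\<mu> i = (\<Sum>v\<in>V. \<phi> i v) / n" for i
  define d where "d i v = \<phi> i v - \<mu> i" for i v
  define dev where "dev i xs = sum_list (map (d i) xs)" for i xs
  \<comment> \<open>A value below 1 rules out both failures: \<open>conflicts\<close> is an integer,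
    and a single deviation of \<open>N * \<beta>\<close> already contributes 1. It therefore
    suffices that the average is below 1.\<close>
  define cost where "cost xs = real (conflicts B xs) + (\<Sum>i\<in>I. (dev i xs)\<^sup>2) / (N * \<beta>)\<^sup>2" for xs
  have d0: "(\<Sum>v\<in>V. d i v) = 0" for i
    using n by (simp add: d_def sum_subtractf \<mu>_def n_def)
  have Q: "(\<Sum>v\<in>V. (d i v)\<^sup>2) \<le> (\<Sum>v\<in>V. (\<phi> i v)\<^sup>2)" for i
  proof -
    have "(\<Sum>v\<in>V. (\<phi> i v)\<^sup>2) = (\<Sum>v\<in>V. (d i v)\<^sup>2 + 2 * \<mu> i * d i v + (\<mu> i)\<^sup>2)"
      by (rule sum.cong) (auto simp: d_def power2_eq_square algebra_simps)
    also have "\<dots> = (\<Sum>v\<in>V. (d i v)\<^sup>2) + n * (\<mu> i)\<^sup>2"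
      using d0[of i] by (simp add: sum.distrib sum_distrib_left[symmetric] n_def)
    finally show ?thesis using n by simp
  qed
  have dev2: "(\<Sum>xs\<in>tuples N V. (dev i xs)\<^sup>2) = N * n ^ N * (\<Sum>v\<in>V. (d i v)\<^sup>2) / n" for i
  proof -
    have "n * (\<Sum>xs\<in>tuples N V. (dev i xs)\<^sup>2) = N * n ^ N * (\<Sum>v\<in>V. (d i v)\<^sup>2)"
      unfolding dev_def n_def using sum_tuples_square[OF fin(1) d0[of i], where N = N and D = 0]
      by (simp only: add_0 zero_power2 mult_zero_right)
    then show ?thesis using n by (metis nonzero_mult_div_cancel_left less_irrefl)
  qed
  have "(\<Sum>i\<in>I. \<Sum>v\<in>V. (d i v)\<^sup>2) \<le> (\<Sum>i\<in>I. \<Sum>v\<in>V. (\<phi> i v)\<^sup>2)" by (rule sum_mono) (rule Q)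
  also have "\<dots> = (\<Sum>v\<in>V. \<Sum>i\<in>I. (\<phi> i v)\<^sup>2)" by (rule sum.swap)
  also have "\<dots> \<le> (\<Sum>v\<in>V. K)" by (rule sum_mono) (rule K)
  finally have QK: "(\<Sum>i\<in>I. \<Sum>v\<in>V. (d i v)\<^sup>2) \<le> n * K" by (simp add: n_def)
  have "(\<Sum>xs\<in>tuples N V. \<Sum>i\<in>I. (dev i xs)\<^sup>2) = (\<Sum>i\<in>I. \<Sum>xs\<in>tuples N V. (dev i xs)\<^sup>2)" by (rule sum.swap)
  also have "\<dots> = N * n ^ N / n * (\<Sum>i\<in>I. \<Sum>v\<in>V. (d i v)\<^sup>2)" unfolding dev2 sum_distrib_left[of _ "\<lambda>i. \<Sum>v\<in>V. (d i v)\<^sup>2"] by (intro sum.cong) simp_all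
  also have "\<dots> \<le> N * n ^ N / n * (n * K)" using QK n by (intro mult_left_mono) auto
  also have "\<dots> = N * n ^ N * K" using n by simp
  finally have S1: "(\<Sum>xs\<in>tuples N V. \<Sum>i\<in>I. (dev i xs)\<^sup>2) \<le> N * n ^ N * K" .
  have "n\<^sup>2 * real (\<Sum>xs\<in>tuples N V. conflicts B xs) = real ((card V)\<^sup>2 * (\<Sum>xs\<in>tuples N V. conflicts B xs))"
    by (simp add: n_def)
  also have "\<dots> \<le> real (N\<^sup>2 * card V ^ N * card B)"
    by (rule of_nat_mono[OF sum_tuples_conflicts[OF fin(1) B(1)]])
  also have "\<dots> = (real N)\<^sup>2 * n ^ N * card B" by (simp add: n_def)
  also have "\<dots> \<le> (real N)\<^sup>2 * n ^ N * (\<epsilon> * n\<^sup>2)" using \<epsilon> n by (intro mult_left_mono) (auto simp: n_def)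
  also have "\<dots> = n\<^sup>2 * ((real N)\<^sup>2 * n ^ N * \<epsilon>)" by (simp add: algebra_simps)
  finally have S2: "real (\<Sum>xs\<in>tuples N V. conflicts B xs) \<le> (real N)\<^sup>2 * n ^ N * \<epsilon>"
    using n by simp
  have "(\<Sum>xs\<in>tuples N V. cost xs) = real (\<Sum>xs\<in>tuples N V. conflicts B xs) +
      (\<Sum>xs\<in>tuples N V. \<Sum>i\<in>I. (dev i xs)\<^sup>2) / (N * \<beta>)\<^sup>2"
    by (simp add: cost_def sum.distrib sum_divide_distrib)
  also have "\<dots> \<le> (real N)\<^sup>2 * n ^ N * \<epsilon> + N * n ^ N * K / (N * \<beta>)\<^sup>2"
    using S1 S2 by (intro add_mono divide_right_mono) auto
  also have "\<dots> = n ^ N * ((real N)\<^sup>2 * \<epsilon> + K / (N * \<beta>\<^sup>2))"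
    using N(1) \<beta> by (simp add: field_simps power2_eq_square)
  also have "\<dots> < n ^ N * 1" using N(2) n by (intro mult_strict_left_mono) auto
  finally have lt: "(\<Sum>xs\<in>tuples N V. cost xs) < n ^ N" by simp
  have "\<exists>xs\<in>tuples N V. cost xs < 1"
  proof (rule ccontr)
    assume "\<not> ?thesis"
    then have "(\<Sum>xs\<in>tuples N V. 1) \<le> (\<Sum>xs\<in>tuples N V. cost xs)" by (intro sum_mono) (auto simp: not_less)
    then show False using lt by (simp add: tuples_card[OF fin(1)] n_def)
  qed
  then obtain xs where xs: "set xs \<subseteq> V" "length xs = N" "cost xs < 1" unfolding tuples_def by blast
  have nn: "0 \<le> (\<Sum>i\<in>I. (dev i xs)\<^sup>2) / (N * \<beta>)\<^sup>2" by (intro divide_nonneg_nonneg sum_nonneg) auto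
  then have "real (conflicts B xs) < 1" using xs(3) unfolding cost_def by linarith
  then have c0: "conflicts B xs = 0" by simp
  have "sum_list (map (\<phi> i) xs) \<le> N * ((\<Sum>v\<in>V. \<phi> i v) / card V + \<beta>)" if i: "i \<in> I" for i
  proof -
    have "(\<Sum>i\<in>I. (dev i xs)\<^sup>2) / (N * \<beta>)\<^sup>2 < 1" using xs(3) unfolding cost_def by linarith
    then have "(\<Sum>i\<in>I. (dev i xs)\<^sup>2) < (N * \<beta>)\<^sup>2" using N(1) \<beta> by (simp add: field_simps)
    moreover have "(dev i xs)\<^sup>2 \<le> (\<Sum>i\<in>I. (dev i xs)\<^sup>2)" by (rule member_le_sum[OF i]) (use I in auto)
    ultimately have "(dev i xs)\<^sup>2 < (N * \<beta>)\<^sup>2" by linarith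
    then have "dev i xs < N * \<beta>" by (rule power2_less_imp_less) (use \<beta> in auto)
    moreover have "dev i xs = sum_list (map (\<phi> i) xs) - length xs * \<mu> i"
      unfolding dev_def d_def by (induction xs) (auto simp: algebra_simps)
    ultimately show ?thesis using xs(2) by (simp add: \<mu>_def n_def algebra_simps)
  qed
  then show ?thesis using xs(1,2) no_conflicts[OF c0 B(2)] by blast
qed

section \<open>Covers of path-free colourings\<close>

definition uncovered :: "nat \<Rightarrow> 'a set \<Rightarrow> (nat \<Rightarrow> 'a \<Rightarrow> 'c) \<Rightarrow> (nat \<Rightarrow> 'a \<Rightarrow> nat) \<Rightarrow> ('a \<times> 'a) set" where
  "uncovered r V c h = {(u, v) \<in> V \<times> V. \<not> (\<exists>k<r. c k u = c k v \<and> 2 \<le> h k u + h k v)}"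

text \<open>
  \<open>c k\<close> names the components of colour \<open>k\<close>, and \<open>h k\<close> is twice a half-integral vertex cover of
  them.
\<close>

definition cover_system ::
    "nat \<Rightarrow> 'a set \<Rightarrow> (nat \<Rightarrow> 'a \<Rightarrow> 'c) \<Rightarrow> (nat \<Rightarrow> 'a \<Rightarrow> nat) \<Rightarrow> real \<Rightarrow> real \<Rightarrow> bool" where
  "cover_system r V c h b e \<longleftrightarrow> (\<forall>k v. h k v \<le> 2) \<and>
     (\<forall>k<r. \<forall>x. real (\<Sum>v | v \<in> V \<and> c k v = x. h k v) \<le> b) \<and> real (card (uncovered r V c h)) \<le> e"

lemma cover_system_mono:
  "cover_system r V c h b e \<Longrightarrow> b \<le> b' \<Longrightarrow> e \<le> e' \<Longrightarrow> cover_system r V c h b' e'"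
  unfolding cover_system_def by (meson order_trans)

text \<open>\<open>X\<close> and \<open>Y\<close> may coincide, so that pairs inside one block see a
  colour as well.\<close>

definition hole_free :: "nat \<Rightarrow> (nat \<Rightarrow> 'a \<Rightarrow> 'a \<Rightarrow> bool) \<Rightarrow> 'a set \<Rightarrow> real \<Rightarrow> bool" where
  "hole_free r E V d \<longleftrightarrow> (\<forall>X Y. X \<subseteq> V \<longrightarrow> Y \<subseteq> V \<longrightarrow> d \<le> card X \<longrightarrow> d \<le> card Y \<longrightarrow>
     (\<exists>k<r. \<exists>x\<in>X. \<exists>y\<in>Y. E k x y))"

lemma hole_freeD:
  "hole_free r E V d \<Longrightarrow> X \<subseteq> V \<Longrightarrow> Y \<subseteq> V \<Longrightarrow> d \<le> card X \<Longrightarrow> d \<le> card Y \<Longrightarrow>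
     \<exists>k<r. \<exists>x\<in>X. \<exists>y\<in>Y. E k x y"
  unfolding hole_free_def by blast

definition is_path :: "('a \<Rightarrow> 'a \<Rightarrow> bool) \<Rightarrow> 'a set \<Rightarrow> 'a list \<Rightarrow> bool" where
  "is_path E V xs \<longleftrightarrow> distinct xs \<and> set xs \<subseteq> V \<and> successively E xs"

lemma joined_sym:
  assumes sym: "\<And>x y. E x y \<Longrightarrow> E y x" and "joined E t A B" shows "joined E t B A"
  unfolding joined_def
proof (intro allI impI)
  fix X Y assume "X \<subseteq> B" "Y \<subseteq> A" "t \<le> card X" "t \<le> card Y"
  then obtain y x where "y \<in> Y" "x \<in> X" "E y x" using joinedD[OF assms(2), of Y X] by blast
  then show "\<exists>x\<in>X. \<exists>y\<in>Y. E x y" using sym by blast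
qed

text \<open>\<open>long_path\<close> limits the matchings of ordered pairs in one component by the
  longest path, and \<open>koenig\<close> turns this into a cover. The error term is the loss of
  \<open>12 * t + 1\<close> vertices per matching edge.\<close>

lemma component_cover:
  fixes E :: "'a \<Rightarrow> 'a \<Rightarrow> bool" and m :: real
  assumes sym: "\<And>x y. E x y \<Longrightarrow> E y x" and fin: "finite V" and P: "equipart V s \<P>"
    and R: "R = {(A, B) \<in> \<P> \<times> \<P>. joined E t A B}"
    and t: "1 \<le> t" "card \<P> ^ 3 \<le> 2 * t"
    and m: "\<And>xs. is_path E V xs \<Longrightarrow> real (length xs) \<le> m"
  shows "\<exists>X Y. covers {(A, B) \<in> R. A \<in> R\<^sup>* `` {A0}} X Y \<and>
     (card X + card Y) * real s \<le> m + card \<P> * (12 * t + 1)"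
proof -
  let ?D = "{(A, B) \<in> R. A \<in> R\<^sup>* `` {A0}}"
  have finP: "finite \<P>" "\<forall>A\<in>\<P>. finite A" using equipart_finite[OF P fin] by auto
  have RP: "R \<subseteq> \<P> \<times> \<P>" unfolding R by auto
  have "finite R" using RP finP by (meson finite_SigmaI finite_subset)
  then have "finite ?D" by (rule rev_finite_subset) auto
  from koenig[OF this] obtain M X Y where M: "M \<subseteq> ?D" "inj_on fst M" "inj_on snd M"
    "covers ?D X Y" "card X + card Y \<le> card M" by blast
  have symR: "sym R" unfolding R sym_def using joined_sym[OF sym] by auto
  then have symR': "sym (R\<^sup>*)" by (rule sym_rtrancl)
  have "\<exists>xs. distinct xs \<and> successively E xs \<and> set xs \<subseteq> \<Union>\<P> \<and> card M * (s - 12 * t - 1) \<le> length xs"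
  proof (rule long_path[OF sym finP(1) _ _ RP _ _ M(2,3) _ t])
    show "A \<inter> B = {}" if "A \<in> \<P>" "B \<in> \<P>" "A \<noteq> B" for A B using equipart_disjoint[OF P that] .
    show "finite A \<and> card A = s" if "A \<in> \<P>" for A using finP(2) that equipart_block_card[OF P that] by blast
    show "joined E t A B" if "(A, B) \<in> R" for A B using that unfolding R by auto
    show "M \<subseteq> R" using M(1) by auto
    show "(fst e, fst e') \<in> R\<^sup>*" if "e \<in> M" "e' \<in> M" for e e'
    proof -
      have "(A0, fst e) \<in> R\<^sup>*" "(A0, fst e') \<in> R\<^sup>*" using that M(1) by auto
      then show ?thesis using symR' by (meson rtrancl_trans symD)
    qed
  qed
  then obtain xs where xs: "distinct xs" "successively E xs" "set xs \<subseteq> \<Union>\<P>" "card M * (s - 12 * t - 1) \<le> length xs"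
    by blast
  have "is_path E V xs" using xs P unfolding is_path_def equipart_def by auto
  then have "real (card M * (s - 12 * t - 1)) \<le> m" using m xs(4) by (meson of_nat_le_iff order_trans)
  then have 1: "real (card M) * real (s - 12 * t - 1) \<le> m" by (simp only: of_nat_mult)
  have "real s - real (12 * t + 1) \<le> real (s - 12 * t - 1)" by linarith
  then have "real (card M) * (real s - real (12 * t + 1)) \<le> real (card M) * real (s - 12 * t - 1)"
    by (rule mult_left_mono) simp
  then have 2: "real (card M) * real s \<le> m + real (card M) * real (12 * t + 1)"
    using 1 unfolding right_diff_distrib by linarith
  have "card M \<le> card \<P>" by (rule card_inj_on_le[OF M(2) _ finP(1)]) (use M(1) RP in auto)
  then have "real (card M) * real (12 * t + 1) \<le> real (card \<P>) * real (12 * t + 1)"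
    by (intro mult_right_mono) auto
  then have "card M * real s \<le> m + card \<P> * (12 * t + 1)" using 2 by (simp only: of_nat_mult)
  moreover have "(card X + card Y) * real s \<le> card M * real s" using M(5) by (intro mult_right_mono) auto
  ultimately show ?thesis using M(4) by (intro exI[of _ X] exI[of _ Y]) auto
qed

text \<open>The weight of a vertex counts in how many of the two halves of the Koenig cover its
  block occurs. A joined pair is present in both orders, so its two blocks have total weight at
  least 2.\<close>

lemma parts_cover:
  fixes E :: "nat \<Rightarrow> 'a \<Rightarrow> 'a \<Rightarrow> bool" and m :: real
  assumes sym: "\<And>k x y. E k x y \<Longrightarrow> E k y x" and fin: "finite V" and P: "equipart V s \<P>"
    and hole: "hole_free r E V s"
    and t: "1 \<le> t" "card \<P> ^ 3 \<le> 2 * t"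
    and m: "\<And>k xs. k < r \<Longrightarrow> is_path (E k) V xs \<Longrightarrow> real (length xs) \<le> m" "0 \<le> m"
  shows "\<exists>(c :: nat \<Rightarrow> 'a \<Rightarrow> 'a set set) h. cover_system r V c h (m + card \<P> * (12 * t + 1))
    (2 * (card V * card (V - \<Union>\<P>)) + card (bad_pairs r E t \<P>) * s\<^sup>2)"
proof -
  have finP: "finite \<P>" "\<And>A. A \<in> \<P> \<Longrightarrow> finite A" using equipart_finite[OF P fin] by auto
  define R where "R k = {(A, B) \<in> \<P> \<times> \<P>. joined (E k) t A B}" for k
  define D where "D k C = {(A, B) \<in> R k. A \<in> C}" for k C
  define b where "b = m + card \<P> * (12 * t + 1)"
  have b0: "0 \<le> b" using m(2) unfolding b_def by simp
  have "\<exists>X Y. covers (D k ((R k)\<^sup>* `` {A0})) X Y \<and> (card X + card Y) * real s \<le> b" if "k < r" for k A0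
    unfolding D_def b_def by (rule component_cover[OF sym fin P R_def t m(1)[OF that]])
  \<comment> \<open>Choosing by the component as a set makes all of its blocks use the same
    cover.\<close>
  then have "\<forall>k C. \<exists>X Y. k < r \<and> (\<exists>A0. C = (R k)\<^sup>* `` {A0}) \<longrightarrow>
      covers (D k C) X Y \<and> (card X + card Y) * real s \<le> b" by metis
  then obtain X Y where XY: "\<And>k A0. k < r \<Longrightarrow> covers (D k ((R k)\<^sup>* `` {A0})) (X k ((R k)\<^sup>* `` {A0})) (Y k ((R k)\<^sup>* `` {A0}))"
    "\<And>k A0. k < r \<Longrightarrow> (card (X k ((R k)\<^sup>* `` {A0})) + card (Y k ((R k)\<^sup>* `` {A0}))) * real s \<le> b" by metis
  define part where "part v = (SOME A. A \<in> \<P> \<and> v \<in> A)" for v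
  have part: "part v = A" if "A \<in> \<P>" "v \<in> A" for v A
  proof -
    have "part v \<in> \<P> \<and> v \<in> part v" unfolding part_def by (rule someI[of _ A]) (use that in blast)
    then show ?thesis using equipart_disjoint[OF P, of "part v" A] that by blast
  qed
  \<comment> \<open>Left-over vertices get the name \<open>{}\<close>, which no component has, and
    weight 0.\<close>
  define c where "c k v = (if v \<in> \<Union>\<P> then (R k)\<^sup>* `` {part v} else {})" for k v
  define h where "h k v = (if v \<in> \<Union>\<P> then of_bool (part v \<in> X k (c k v)) + of_bool (part v \<in> Y k (c k v)) else (0::nat))" for k v
  have symR: "sym (R k)" for k unfolding R_def sym_def using joined_sym[OF sym] by auto
  have h2: "h k v \<le> 2" for k v unfolding h_def by auto
  have weight: "real (\<Sum>v | v \<in> V \<and> c k v = C. h k v) \<le> b" if k: "k < r" for k C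
  proof (cases "\<exists>v0\<in>\<Union>\<P>. c k v0 = C")
    case False
    then have "(\<Sum>v | v \<in> V \<and> c k v = C. h k v) = 0" by (intro sum.neutral) (auto simp: h_def)
    then show ?thesis using b0 by simp
  next
    case True
    then obtain A0 where C: "C = (R k)\<^sup>* `` {A0}" by (auto simp: c_def)
    have part_sum: "(\<Sum>v | v \<in> V \<and> c k v = C. if v \<in> \<Union>\<P> then of_bool (part v \<in> Z) else 0) \<le> card Z * s"
      if Z: "finite Z" for Z :: "'a set set"
    proof -
      have "(\<Sum>v | v \<in> V \<and> c k v = C. if v \<in> \<Union>\<P> then of_bool (part v \<in> Z) else (0::nat)) =
          card {v. v \<in> V \<and> c k v = C \<and> v \<in> \<Union>\<P> \<and> part v \<in> Z}"
        using fin by (simp add: of_bool_def sum.If_cases Int_def flip: card_eq_sum)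
      also have "\<dots> \<le> card (\<Union>(Z \<inter> \<P>))"
      proof (rule card_mono)
        show "finite (\<Union>(Z \<inter> \<P>))" using Z finP by auto
        show "{v. v \<in> V \<and> c k v = C \<and> v \<in> \<Union>\<P> \<and> part v \<in> Z} \<subseteq> \<Union>(Z \<inter> \<P>)" using part by auto
      qed
      also have "\<dots> \<le> (\<Sum>A\<in>Z \<inter> \<P>. card A)" using card_UN_le[of "Z \<inter> \<P>" id] Z by simp
      also have "\<dots> = card (Z \<inter> \<P>) * s" using equipart_block_card[OF P] by simp
      also have "\<dots> \<le> card Z * s" using Z by (intro mult_le_mono1 card_mono) auto
      finally show ?thesis .
    qed
    have fXY: "finite (X k C)" "finite (Y k C)" using XY(1)[OF k, of A0] unfolding C covers_def by auto
    have "(\<Sum>v | v \<in> V \<and> c k v = C. h k v) =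
        (\<Sum>v | v \<in> V \<and> c k v = C. if v \<in> \<Union>\<P> then of_bool (part v \<in> X k C) else 0) +
        (\<Sum>v | v \<in> V \<and> c k v = C. if v \<in> \<Union>\<P> then of_bool (part v \<in> Y k C) else 0)"
      unfolding sum.distrib[symmetric] by (rule sum.cong) (auto simp: h_def)
    also have "\<dots> \<le> card (X k C) * s + card (Y k C) * s" by (intro add_mono part_sum fXY)
    finally have "(\<Sum>v | v \<in> V \<and> c k v = C. h k v) \<le> (card (X k C) + card (Y k C)) * s"
      by (simp add: algebra_simps)
    then have "real (\<Sum>v | v \<in> V \<and> c k v = C. h k v) \<le> (card (X k C) + card (Y k C)) * real s"
      by (metis of_nat_le_iff of_nat_mult)
    then show ?thesis using XY(2)[OF k, of A0] unfolding C by linarith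
  qed
  have covered: "\<exists>k<r. c k u = c k v \<and> 2 \<le> h k u + h k v"
    if AB: "A \<in> \<P>" "B \<in> \<P>" "u \<in> A" "v \<in> B" "(A, B) \<notin> bad_pairs r E t \<P>" for A B u v
  proof -
    have "A \<subseteq> V" "B \<subseteq> V" "card A = s" "card B = s"
      using AB equipart_subset[OF P] equipart_block_card[OF P] by auto
    \<comment> \<open>Two blocks are large enough to see some colour; if the pair is regular, they
      are then joined in it.\<close>
    then obtain k where k: "k < r" "present (E k) A B"
      using hole_freeD[OF hole, of A B] unfolding present_def by auto
    then have "joined (E k) t A B" using AB unfolding bad_pairs_def irregular_def by blast
    then have R: "(A, B) \<in> R k" using AB unfolding R_def by auto
    have R': "(B, A) \<in> R k" using symR R by (meson symD)
    have pt: "part u = A" "part v = B" using part AB by auto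
    have cu: "c k u = (R k)\<^sup>* `` {A}" "c k v = (R k)\<^sup>* `` {B}" using AB pt unfolding c_def by auto
    have eq: "c k u = c k v" unfolding cu using R R'
      by (auto intro: converse_rtrancl_into_rtrancl)
    define C where "C = (R k)\<^sup>* `` {A}"
    have "(A, B) \<in> D k C" "(B, A) \<in> D k C" using R R' unfolding D_def C_def by auto
    then have "A \<in> X k C \<or> B \<in> Y k C" "B \<in> X k C \<or> A \<in> Y k C"
      using XY(1)[OF k(1), of A] unfolding C_def covers_def by auto
    moreover have "h k u = of_bool (A \<in> X k C) + of_bool (A \<in> Y k C)"
      "h k v = of_bool (B \<in> X k C) + of_bool (B \<in> Y k C)"
      using AB pt cu eq unfolding h_def C_def by auto
    ultimately have "2 \<le> h k u + h k v" by auto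
    then show ?thesis using k(1) eq by blast
  qed
  let ?W = "V - \<Union>\<P>" and ?Q = "\<Union>(A, B)\<in>bad_pairs r E t \<P>. A \<times> B"
  have BP: "bad_pairs r E t \<P> \<subseteq> \<P> \<times> \<P>" unfolding bad_pairs_def by auto
  have finB: "finite (bad_pairs r E t \<P>)" using BP finP by (meson finite_SigmaI finite_subset)
  have finQ: "finite ?Q" using finB BP finP by auto
  have "uncovered r V c h \<subseteq> (?W \<times> V \<union> V \<times> ?W) \<union> ?Q"
  proof
    fix p assume p: "p \<in> uncovered r V c h"
    obtain u v where uv: "p = (u, v)" "u \<in> V" "v \<in> V" "\<not> (\<exists>k<r. c k u = c k v \<and> 2 \<le> h k u + h k v)"
      using p unfolding uncovered_def by auto
    show "p \<in> (?W \<times> V \<union> V \<times> ?W) \<union> ?Q"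
    proof (cases "u \<in> \<Union>\<P> \<and> v \<in> \<Union>\<P>")
      case True
      then obtain A B where "A \<in> \<P>" "B \<in> \<P>" "u \<in> A" "v \<in> B" by blast
      moreover from this have "(A, B) \<in> bad_pairs r E t \<P>" using covered uv(4) by blast
      ultimately show ?thesis using uv(1) by blast
    next
      case False then show ?thesis using uv by blast
    qed
  qed
  then have "card (uncovered r V c h) \<le> card ((?W \<times> V \<union> V \<times> ?W) \<union> ?Q)"
    by (rule card_mono[rotated]) (use fin finQ in auto)
  also have "\<dots> \<le> card (?W \<times> V \<union> V \<times> ?W) + card ?Q" by (rule card_Un_le)
  also have "card (?W \<times> V \<union> V \<times> ?W) \<le> card (?W \<times> V) + card (V \<times> ?W)" by (rule card_Un_le)
  also have "card ?Q \<le> (\<Sum>p\<in>bad_pairs r E t \<P>. card (case p of (A, B) \<Rightarrow> A \<times> B))" by (rule card_UN_le[OF finB])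
  also have "\<dots> = (\<Sum>p\<in>bad_pairs r E t \<P>. s\<^sup>2)"
  proof (rule sum.cong[OF refl])
    fix p assume "p \<in> bad_pairs r E t \<P>"
    then have "fst p \<in> \<P>" "snd p \<in> \<P>" using BP by auto
    then show "card (case p of (A, B) \<Rightarrow> A \<times> B) = s\<^sup>2"
      using equipart_block_card[OF P] by (simp add: case_prod_unfold card_cartesian_product power2_eq_square)
  qed
  finally have "card (uncovered r V c h) \<le> 2 * (card V * card ?W) + card (bad_pairs r E t \<P>) * s\<^sup>2"
    by (simp add: card_cartesian_product algebra_simps)
  then have "real (card (uncovered r V c h)) \<le> real (2 * (card V * card ?W) + card (bad_pairs r E t \<P>) * s\<^sup>2)"
    by (rule of_nat_mono)
  then show ?thesis using h2 weight unfolding cover_system_def b_def by (intro exI[of _ c] exI[of _ h]) auto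
qed

theorem path_free_cover:
  fixes \<epsilon> :: real and r :: nat
  assumes "0 < \<epsilon>"
  shows "\<exists>(\<eta>::real) n0. 0 < \<eta> \<and> 1 \<le> n0 \<and> (\<forall>(V :: 'a set) E (m::real). finite V \<longrightarrow> n0 \<le> card V \<longrightarrow>
    (\<forall>k x y. E k x y \<longrightarrow> E k y x) \<longrightarrow> hole_free r E V (\<eta> * real (card V)) \<longrightarrow> 0 \<le> m \<longrightarrow>
    (\<forall>k<r. \<forall>xs. is_path (E k) V xs \<longrightarrow> real (length xs) \<le> m) \<longrightarrow>
    (\<exists>(c :: nat \<Rightarrow> 'a \<Rightarrow> 'a set set) h. cover_system r V c h (m + \<epsilon> * real (card V)) (\<epsilon> * (real (card V))\<^sup>2)))"
proof -
  \<comment> \<open>The path error is at most \<open>13 * \<delta> * card V\<close>, half of what is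
    allowed: \<open>12 * \<delta>\<close> from \<open>t\<close>, and one more
    \<open>\<delta>\<close> for rounding \<open>t\<close> once \<open>card V\<close> is at least
    \<open>13 / (\<sigma> * \<delta>)\<close>.\<close>
  define \<delta> where "\<delta> = \<epsilon> / 26"
  have \<delta>: "0 < \<delta>" using assms unfolding \<delta>_def by simp
  have e4: "0 < \<epsilon> / 4" using assms by simp
  obtain \<sigma> n0 where \<sigma>: "(0::real) < \<sigma>" and n0: "1 \<le> n0" and reg: "\<And>(V :: 'a set) E. finite V \<Longrightarrow> n0 \<le> card V \<Longrightarrow>
     (\<exists>s \<P>. coarse \<sigma> (\<epsilon> / 4) V s \<P> \<and> card (bad_pairs r E (nat \<lceil>\<delta> * s\<rceil>) \<P>) * (real s)\<^sup>2 \<le> \<epsilon> / 4 * (card V)\<^sup>2)"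
    using regularity[OF e4 \<delta>, of r] by blast
  \<comment> \<open>The threshold with \<open>\<sigma> ^ 4\<close> makes \<open>t\<close> at least
    \<open>(1 / \<sigma>) ^ 3\<close>, hence at least the cube of the number of blocks, as
    \<open>long_path\<close> demands.\<close>
  define n1 where "n1 = max n0 (nat \<lceil>max (13 / (\<sigma> * \<delta>)) (1 / (\<delta> * \<sigma> ^ 4))\<rceil>)"
  have "\<exists>(c :: nat \<Rightarrow> 'a \<Rightarrow> 'a set set) h. cover_system r V c h (m + \<epsilon> * real (card V)) (\<epsilon> * (real (card V))\<^sup>2)"
    if V: "finite V" "n1 \<le> card V" and sym: "\<forall>k x y. E k x y \<longrightarrow> E k y x"
      and hole: "hole_free r E V (\<sigma> * real (card V))" and m0: "0 \<le> m"
      and m: "\<forall>k<r. \<forall>xs. is_path (E k) V xs \<longrightarrow> real (length xs) \<le> m" for V :: "'a set" and E and m :: real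
  proof -
    let ?n = "real (card V)"
    have n: "n0 \<le> card V" "13 / (\<sigma> * \<delta>) \<le> ?n" "1 / (\<delta> * \<sigma> ^ 4) \<le> ?n"
      using V(2) unfolding n1_def by linarith+
    obtain s \<P> where sP: "coarse \<sigma> (\<epsilon> / 4) V s \<P>"
      and bad: "card (bad_pairs r E (nat \<lceil>\<delta> * s\<rceil>) \<P>) * (real s)\<^sup>2 \<le> \<epsilon> / 4 * (card V)\<^sup>2"
      using reg[OF V(1) n(1)] by blast
    have P: "equipart V s \<P>" and s: "0 < s" "\<sigma> * ?n \<le> real s" and left: "real (card (V - \<Union>\<P>)) \<le> \<epsilon> / 4 * ?n"
      using sP unfolding coarse_def by auto
    have npos: "0 < ?n" using n(1) n0 by simp
    have Ps: "real (card \<P>) * real s \<le> ?n" using equipart_card_le[OF P V(1)] by (metis of_nat_le_iff of_nat_mult)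
    have "real (card \<P>) * (\<sigma> * ?n) \<le> real (card \<P>) * s" using s(2) by (intro mult_left_mono) auto
    then have "real (card \<P>) * (\<sigma> * ?n) \<le> ?n" using Ps by linarith
    then have cP: "real (card \<P>) \<le> 1 / \<sigma>" using npos \<sigma> by (simp add: field_simps)
    define t where "t = nat \<lceil>\<delta> * s\<rceil>"
    have ds: "0 < \<delta> * s" using \<delta> s(1) by simp
    then have t1: "1 \<le> t" unfolding t_def by linarith
    have t2: "\<delta> * s \<le> t" "t \<le> \<delta> * s + 1" using ds unfolding t_def by linarith+
    have "(1 / \<sigma>) ^ 3 = \<delta> * \<sigma> * (1 / (\<delta> * \<sigma> ^ 4))" using \<sigma> \<delta> by (simp add: field_simps power_def numeral_eq_Suc)
    also have "\<dots> \<le> \<delta> * \<sigma> * ?n" using n(3) \<sigma> \<delta> by (intro mult_left_mono) auto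
    also have "\<dots> \<le> \<delta> * s" using s(2) \<delta> by simp
    finally have "(1 / \<sigma>) ^ 3 \<le> t" using t2 by linarith
    moreover have "real (card \<P>) ^ 3 \<le> (1 / \<sigma>) ^ 3" using cP by (intro power_mono) auto
    ultimately have "real (card \<P> ^ 3) \<le> real (2 * t)" by simp
    then have t3: "card \<P> ^ 3 \<le> 2 * t" by (simp only: of_nat_le_iff)
    have hole': "hole_free r E V s" using hole s(2) unfolding hole_free_def by (meson order_trans)
    obtain c :: "nat \<Rightarrow> 'a \<Rightarrow> 'a set set" and h where ch: "cover_system r V c h (m + card \<P> * (12 * t + 1))
        (2 * (card V * card (V - \<Union>\<P>)) + card (bad_pairs r E t \<P>) * s\<^sup>2)"
      using parts_cover[OF _ V(1) P hole' t1 t3, of m] sym m m0 by blast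
    have "card \<P> * (12 * real t + 1) \<le> card \<P> * (12 * \<delta> * s + 13)" using t2 by (intro mult_left_mono) auto
    also have "\<dots> = 12 * \<delta> * (card \<P> * s) + 13 * card \<P>" by (simp add: algebra_simps)
    also have "\<dots> \<le> 12 * \<delta> * ?n + 13 * (1 / \<sigma>)" using Ps cP \<delta> by (intro add_mono mult_left_mono) auto
    also have "13 * (1 / \<sigma>) = \<delta> * (13 / (\<sigma> * \<delta>))" using \<delta> by simp
    also have "\<dots> \<le> \<delta> * ?n" using n(2) \<delta> by (intro mult_left_mono) auto
    finally have "card \<P> * (12 * real t + 1) \<le> 13 * \<delta> * ?n" by simp
    also have "\<dots> \<le> \<epsilon> * ?n" using assms npos unfolding \<delta>_def by simp
    finally have 1: "m + real (card \<P> * (12 * t + 1)) \<le> m + \<epsilon> * ?n" by (simp add: algebra_simps)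
    have "?n * real (card (V - \<Union>\<P>)) \<le> ?n * (\<epsilon> / 4 * ?n)" using left npos by (intro mult_left_mono) auto
    moreover have "real (card (bad_pairs r E t \<P>)) * (real s)\<^sup>2 \<le> \<epsilon> / 4 * ?n\<^sup>2"
      using bad unfolding t_def by simp
    moreover have "2 * (?n * (\<epsilon> / 4 * ?n)) + \<epsilon> / 4 * ?n\<^sup>2 \<le> \<epsilon> * ?n\<^sup>2"
      using assms by (simp add: power2_eq_square field_simps)
    ultimately have "2 * (?n * real (card (V - \<Union>\<P>))) + real (card (bad_pairs r E t \<P>)) * (real s)\<^sup>2 \<le> \<epsilon> * ?n\<^sup>2"
      by linarith
    then have 2: "real (2 * (card V * card (V - \<Union>\<P>)) + card (bad_pairs r E t \<P>) * s\<^sup>2) \<le> \<epsilon> * ?n\<^sup>2"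
      by simp
    show ?thesis using cover_system_mono[OF ch 1 2] by blast
  qed
  moreover have "1 \<le> n1" using n0 unfolding n1_def by linarith
  ultimately show ?thesis using \<sigma> by blast
qed

text \<open>A pair covered in colour \<open>k\<close> has total weight at least 2. By symmetry the
  number of such pairs is at most the sum over \<open>u\<close> of the weight of its component,
  hence at most \<open>card V * b\<close>.\<close>

lemma cover_count:
  fixes c :: "nat \<Rightarrow> 'a \<Rightarrow> 'c"
  assumes fin: "finite V" and cs: "cover_system r V c h b e"
  shows "(real (card V))\<^sup>2 \<le> real r * (real (card V) * b) + e"
proof -
  let ?n = "real (card V)"
  define G where "G k = {(u, v) \<in> V \<times> V. c k u = c k v \<and> 2 \<le> h k u + h k v}" for k
  have finG: "finite (G k)" for k unfolding G_def using fin by (auto intro: finite_subset[of _ "V \<times> V"])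
  have Gk: "real (card (G k)) \<le> ?n * b" if k: "k < r" for k
  proof -
    have swap: "(\<Sum>u\<in>V. \<Sum>v\<in>V. of_bool (c k u = c k v) * h k u) = (\<Sum>u\<in>V. \<Sum>v\<in>V. of_bool (c k u = c k v) * h k v)"
      by (subst sum.swap) (simp add: eq_commute)
    have "2 * card (G k) = (\<Sum>p\<in>G k. 2)" by simp
    also have "\<dots> \<le> (\<Sum>p\<in>G k. case p of (u, v) \<Rightarrow> of_bool (c k u = c k v) * (h k u + h k v))"
      by (rule sum_mono) (auto simp: G_def)
    also have "\<dots> \<le> (\<Sum>p\<in>V \<times> V. case p of (u, v) \<Rightarrow> of_bool (c k u = c k v) * (h k u + h k v))"
      by (rule sum_mono2) (use fin in \<open>auto simp: G_def\<close>)
    also have "\<dots> = (\<Sum>u\<in>V. \<Sum>v\<in>V. of_bool (c k u = c k v) * (h k u + h k v))"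
      by (rule sum.cartesian_product[symmetric])
    also have "\<dots> = 2 * (\<Sum>u\<in>V. \<Sum>v\<in>V. of_bool (c k u = c k v) * h k v)"
      using swap by (simp only: distrib_left sum.distrib mult_2)
    finally have "card (G k) \<le> (\<Sum>u\<in>V. \<Sum>v\<in>V. of_bool (c k u = c k v) * h k v)" by simp
    also have "\<dots> = (\<Sum>u\<in>V. \<Sum>v | v \<in> V \<and> c k v = c k u. h k v)"
    proof (rule sum.cong[OF refl])
      fix u
      have "(\<Sum>v\<in>V. of_bool (c k u = c k v) * h k v) = (\<Sum>v\<in>V. if c k v = c k u then h k v else 0)"
        by (rule sum.cong) auto
      also have "\<dots> = (\<Sum>v | v \<in> V \<and> c k v = c k u. h k v)" using fin by (simp add: sum.If_cases Int_def)
      finally show "(\<Sum>v\<in>V. of_bool (c k u = c k v) * h k v) = (\<Sum>v | v \<in> V \<and> c k v = c k u. h k v)" .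
    qed
    finally have "real (card (G k)) \<le> real (\<Sum>u\<in>V. \<Sum>v | v \<in> V \<and> c k v = c k u. h k v)"
      by (rule of_nat_mono)
    also have "\<dots> = (\<Sum>u\<in>V. real (\<Sum>v | v \<in> V \<and> c k v = c k u. h k v))" by (rule of_nat_sum)
    also have "\<dots> \<le> (\<Sum>u\<in>V. b)" by (rule sum_mono) (use cs k in \<open>auto simp: cover_system_def\<close>)
    finally show ?thesis by simp
  qed
  have "V \<times> V \<subseteq> (\<Union>k<r. G k) \<union> uncovered r V c h" unfolding G_def uncovered_def by auto
  then have "card (V \<times> V) \<le> card ((\<Union>k<r. G k) \<union> uncovered r V c h)"
    by (rule card_mono[rotated]) (use finG fin in \<open>auto simp: uncovered_def intro: finite_subset[of _ "V \<times> V"]\<close>)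
  also have "\<dots> \<le> card (\<Union>k<r. G k) + card (uncovered r V c h)" by (rule card_Un_le)
  also have "card (\<Union>k<r. G k) \<le> (\<Sum>k<r. card (G k))" by (rule card_UN_le) simp
  finally have "card (V \<times> V) \<le> (\<Sum>k<r. card (G k)) + card (uncovered r V c h)" by simp
  from of_nat_mono[OF this, where 'a = real]
  have "real (card (V \<times> V)) \<le> (\<Sum>k<r. real (card (G k))) + real (card (uncovered r V c h))"
    by (simp only: of_nat_add of_nat_sum)
  also have "(\<Sum>k<r. real (card (G k))) \<le> (\<Sum>k<r. ?n * b)" by (rule sum_mono) (use Gk in auto)
  also have "real (card (uncovered r V c h)) \<le> e" using cs unfolding cover_system_def by blast
  finally show ?thesis by (simp add: card_cartesian_product power2_eq_square)
qed

text \<open>In a sample without uncovered pairs, component weights are proportionally almost those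
  in \<open>V\<close>, so \<open>three_colour_cover\<close> for the sample contradicts the bound.
  The gap \<open>1 / 2 - b\<close> fixes the sample size \<open>N\<close>, and only then
  \<open>\<epsilon>\<close> is chosen.\<close>

lemma cover_three:
  fixes b :: real
  assumes "b < 1 / 2"
  shows "\<exists>\<epsilon>::real. 0 < \<epsilon> \<and> (\<forall>(V :: 'a set) (c :: nat \<Rightarrow> 'a \<Rightarrow> 'c) h. finite V \<longrightarrow> V \<noteq> {} \<longrightarrow>
    \<not> cover_system 3 V c h (b * real (card V)) (\<epsilon> * (real (card V))\<^sup>2))"
proof -
  define \<gamma> where "\<gamma> = 1 / 2 - b"
  define \<beta> where "\<beta> = \<gamma> / 2"
  have \<gamma>: "0 < \<gamma>" "0 < \<beta>" using assms unfolding \<gamma>_def \<beta>_def by auto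
  \<comment> \<open>The 24 keeps the variance term below 1/2: three colours contribute squares of at
    most 4 each to \<open>K = 12\<close>. The bound \<open>1 / \<gamma>\<close> pays for one
    discarded position.\<close>
  obtain N :: nat where "max 2 (max (1 / \<gamma>) (24 / \<beta>\<^sup>2)) < N" using reals_Archimedean2 by blast
  then have N: "2 < N" "1 / \<gamma> < N" "24 / \<beta>\<^sup>2 < N" by auto
  define \<epsilon> where "\<epsilon> = 1 / (4 * (real N)\<^sup>2)"
  have \<epsilon>: "0 < \<epsilon>" using N unfolding \<epsilon>_def by simp
  have "(real N)\<^sup>2 * \<epsilon> = 1 / 4" using N unfolding \<epsilon>_def by simp
  moreover have "12 / (N * \<beta>\<^sup>2) < 1 / 2" using N \<gamma> by (simp add: field_simps)
  ultimately have N': "(real N)\<^sup>2 * \<epsilon> + 12 / (N * \<beta>\<^sup>2) < 1" by simp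
  have False if fin: "finite V" "V \<noteq> {}" and cs: "cover_system 3 V c h (b * real (card V)) (\<epsilon> * (real (card V))\<^sup>2)"
    for V :: "'a set" and c :: "nat \<Rightarrow> 'a \<Rightarrow> 'c" and h
  proof -
    have h2: "h k v \<le> 2" for k v using cs unfolding cover_system_def by blast
    have npos: "0 < real (card V)" using fin by (simp add: card_gt_0_iff)
    define I where "I = Sigma {..<3::nat} (\<lambda>k. c k ` V)"
    define \<phi> where "\<phi> = (\<lambda>(k, x) v. if c k v = x then real (h k v) else 0)"
    have finI: "finite I" unfolding I_def using fin by auto
    have K: "(\<Sum>i\<in>I. (\<phi> i v)\<^sup>2) \<le> 12" if v: "v \<in> V" for v
    proof -
      have "(\<Sum>i\<in>I. (\<phi> i v)\<^sup>2) = (\<Sum>k<3. \<Sum>x\<in>c k ` V. (\<phi> (k, x) v)\<^sup>2)"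
        unfolding I_def by (subst sum.Sigma) (use fin in auto)
      also have "\<dots> = (\<Sum>k<3. (real (h k v))\<^sup>2)"
      proof (rule sum.cong[OF refl])
        fix k
        have "(\<Sum>x\<in>c k ` V. (\<phi> (k, x) v)\<^sup>2) = (\<Sum>x\<in>c k ` V. if x = c k v then (real (h k v))\<^sup>2 else 0)"
          by (rule sum.cong) (auto simp: \<phi>_def)
        also have "\<dots> = (real (h k v))\<^sup>2" using fin v by simp
        finally show "(\<Sum>x\<in>c k ` V. (\<phi> (k, x) v)\<^sup>2) = (real (h k v))\<^sup>2" .
      qed
      also have "\<dots> \<le> (\<Sum>k<(3::nat). 2\<^sup>2)"
      proof (intro sum_mono power_mono)
        show "real (h k v) \<le> 2" for k using h2[of k v] by linarith
      qed simp
      finally show ?thesis by simp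
    qed
    have B: "uncovered 3 V c h \<subseteq> V \<times> V" "sym (uncovered 3 V c h)"
      unfolding uncovered_def sym_def by (auto simp: add.commute)
    have e: "card (uncovered 3 V c h) \<le> \<epsilon> * (real (card V))\<^sup>2" using cs unfolding cover_system_def by blast
    have "0 < N" using N(1) by simp
    have "\<exists>xs. set xs \<subseteq> V \<and> length xs = N \<and>
      (\<forall>i<N. \<forall>j<N. i \<noteq> j \<longrightarrow> (xs ! i, xs ! j) \<notin> uncovered 3 V c h) \<and>
      (\<forall>i\<in>I. sum_list (map (\<phi> i) xs) \<le> N * ((\<Sum>v\<in>V. \<phi> i v) / card V + \<beta>))"
      by (rule sampling[OF fin B e finI _ \<gamma>(2) \<open>0 < N\<close> N']) (rule K)
    then obtain xs where xs0: "set xs \<subseteq> V \<and> length xs = N \<and>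
      (\<forall>i<N. \<forall>j<N. i \<noteq> j \<longrightarrow> (xs ! i, xs ! j) \<notin> uncovered 3 V c h) \<and>
      (\<forall>i\<in>I. sum_list (map (\<phi> i) xs) \<le> N * ((\<Sum>v\<in>V. \<phi> i v) / card V + \<beta>))" ..
    note xs = xs0[THEN conjunct1] xs0[THEN conjunct2, THEN conjunct1]
      xs0[THEN conjunct2, THEN conjunct2, THEN conjunct1, rule_format]
      xs0[THEN conjunct2, THEN conjunct2, THEN conjunct2, rule_format]
    have xV: "xs ! i \<in> V" if "i < N" for i using xs(1,2) that by auto
    \<comment> \<open>A position can be paired with itself only if it has positive weight in some
      colour. Two positions without weight would be an uncovered pair, so at most one is
      discarded.\<close>
    define W where "W = {i. i < N \<and> (\<exists>k<3. 1 \<le> h k (xs ! i))}"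
    have pair: "\<exists>k<3. c k (xs ! i) = c k (xs ! j) \<and> 2 \<le> h k (xs ! i) + h k (xs ! j)"
      if "i < N" "j < N" "i \<noteq> j" for i j
      using xs(3)[OF that] xV that unfolding uncovered_def by blast
    have "card ({..<N} - W) \<le> 1"
    proof (rule ccontr)
      assume "\<not> ?thesis"
      then obtain i j where "i \<in> {..<N} - W" "j \<in> {..<N} - W" "i \<noteq> j"
        by (metis card_le_Suc0_iff_eq finite_Diff finite_lessThan One_nat_def)
      then show False using pair[of i j] unfolding W_def by fastforce
    qed
    moreover have "card ({..<N} - W) = N - card W" by (subst card_Diff_subset) (auto simp: W_def)
    ultimately have cW: "N \<le> card W + 1" by linarith
    have finW: "finite W" unfolding W_def by simp
    have "W \<noteq> {}" using cW N(1) by auto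
    have "\<exists>k<3. \<exists>x. card W \<le> 2 * (\<Sum>i | i \<in> W \<and> c k (xs ! i) = x. h k (xs ! i))"
    proof (rule three_colour_cover[OF finW \<open>W \<noteq> {}\<close> h2])
      fix i j assume ij: "i \<in> W" "j \<in> W"
      show "\<exists>k<3. c k (xs ! i) = c k (xs ! j) \<and> 2 \<le> h k (xs ! i) + h k (xs ! j)"
      proof (cases "i = j")
        case True
        then obtain k where "k < 3" "1 \<le> h k (xs ! i)" using ij unfolding W_def by blast
        then show ?thesis using True by (intro exI[of _ k]) auto
      next
        case False then show ?thesis using pair[of i j] ij unfolding W_def by blast
      qed
    qed
    then obtain k x where kx: "k < 3" "card W \<le> 2 * (\<Sum>i | i \<in> W \<and> c k (xs ! i) = x. h k (xs ! i))" by blast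
    have "\<exists>i\<in>W. c k (xs ! i) = x"
    proof (rule ccontr)
      assume "\<not> ?thesis"
      then have "{i. i \<in> W \<and> c k (xs ! i) = x} = {}" by blast
      then have "(\<Sum>i | i \<in> W \<and> c k (xs ! i) = x. h k (xs ! i)) = 0" by (simp only: sum.empty)
      then show False using kx(2) cW N(1) by linarith
    qed
    then have kI: "(k, x) \<in> I" using kx(1) xV unfolding I_def W_def by blast
    have "real (\<Sum>i | i \<in> W \<and> c k (xs ! i) = x. h k (xs ! i)) = (\<Sum>i | i \<in> W \<and> c k (xs ! i) = x. \<phi> (k, x) (xs ! i))"
      unfolding of_nat_sum by (rule sum.cong) (auto simp: \<phi>_def)
    also have "\<dots> \<le> (\<Sum>i<N. \<phi> (k, x) (xs ! i))" by (rule sum_mono2) (auto simp: \<phi>_def W_def)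
    also have "\<dots> = sum_list (map (\<phi> (k, x)) xs)" using xs(2) by (simp add: sum_list_sum_nth atLeast0LessThan)
    also have "\<dots> \<le> N * ((\<Sum>v\<in>V. \<phi> (k, x) v) / card V + \<beta>)" by (rule xs(4)[OF kI])
    finally have 1: "real (\<Sum>i | i \<in> W \<and> c k (xs ! i) = x. h k (xs ! i)) \<le> N * ((\<Sum>v\<in>V. \<phi> (k, x) v) / card V + \<beta>)" .
    have "(\<Sum>v\<in>V. \<phi> (k, x) v) = real (\<Sum>v | v \<in> V \<and> c k v = x. h k v)"
      using fin by (simp add: \<phi>_def sum.If_cases Int_def)
    also have "\<dots> \<le> b * real (card V)" using cs kx(1) unfolding cover_system_def by blast
    finally have "(\<Sum>v\<in>V. \<phi> (k, x) v) / card V \<le> b" using npos by (simp add: field_simps)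
    then have "N * ((\<Sum>v\<in>V. \<phi> (k, x) v) / card V + \<beta>) \<le> N * (b + \<beta>)" by (intro mult_left_mono) auto
    then have 2: "real (\<Sum>i | i \<in> W \<and> c k (xs ! i) = x. h k (xs ! i)) \<le> N * (b + \<beta>)" using 1 by linarith
    have "real N \<le> 2 * real (\<Sum>i | i \<in> W \<and> c k (xs ! i) = x. h k (xs ! i)) + 1"
      using cW kx(2) by linarith
    then have "real N \<le> 2 * (N * (b + \<beta>)) + 1" using 2 by linarith
    moreover have "2 * (real N * (b + \<beta>)) = N - N * \<gamma>" unfolding \<beta>_def \<gamma>_def by (simp add: field_simps)
    ultimately have "N * \<gamma> \<le> 1" by linarith
    then show False using N(2) \<gamma> by (simp add: field_simps)
  qed
  then show ?thesis using \<epsilon> by blast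
qed

section \<open>Monochromatic paths forced by the absence of holes\<close>

definition path_forcing :: "nat \<Rightarrow> real \<Rightarrow> bool" where
  "path_forcing r b \<longleftrightarrow> (\<exists>\<eta>>0. \<exists>n0. \<forall>(V :: nat set) E. finite V \<longrightarrow> n0 \<le> card V \<longrightarrow>
     (\<forall>k x y. E k x y \<longrightarrow> E k y x) \<longrightarrow> hole_free r E V (\<eta> * real (card V)) \<longrightarrow>
     (\<exists>k<r. \<exists>xs. is_path (E k) V xs \<and> b * real (card V) \<le> real (length xs)))"

lemma path_forcing_if_no_cover:
  assumes b: "0 \<le> b" and \<epsilon>: "0 < \<epsilon>"
    and nc: "\<And>(V :: nat set) (c :: nat \<Rightarrow> nat \<Rightarrow> nat set set) h. finite V \<Longrightarrow> V \<noteq> {} \<Longrightarrow>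
      \<not> cover_system r V c h ((b + \<epsilon>) * real (card V)) (\<epsilon> * (real (card V))\<^sup>2)"
  shows "path_forcing r b"
proof -
  obtain \<eta> :: real and n0 where \<eta>: "0 < \<eta>" "1 \<le> n0" and pc: "\<And>(V :: nat set) E (m::real).
    finite V \<Longrightarrow> n0 \<le> card V \<Longrightarrow> \<forall>k x y. E k x y \<longrightarrow> E k y x \<Longrightarrow> hole_free r E V (\<eta> * real (card V)) \<Longrightarrow> 0 \<le> m \<Longrightarrow>
    \<forall>k<r. \<forall>xs. is_path (E k) V xs \<longrightarrow> real (length xs) \<le> m \<Longrightarrow>
    \<exists>(c :: nat \<Rightarrow> nat \<Rightarrow> nat set set) h. cover_system r V c h (m + \<epsilon> * real (card V)) (\<epsilon> * (real (card V))\<^sup>2)"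
    using path_free_cover[OF \<epsilon>, of r, where 'a = nat] by blast
  have "\<exists>k<r. \<exists>xs. is_path (E k) V xs \<and> b * real (card V) \<le> real (length xs)"
    if V: "finite V" "n0 \<le> card V" "\<forall>k x y. E k x y \<longrightarrow> E k y x" "hole_free r E V (\<eta> * real (card V))"
    for V :: "nat set" and E
  proof (rule ccontr)
    assume "\<not> ?thesis"
    then have "\<forall>k<r. \<forall>xs. is_path (E k) V xs \<longrightarrow> real (length xs) \<le> b * real (card V)" by fastforce
    then obtain c :: "nat \<Rightarrow> nat \<Rightarrow> nat set set" and h where
      "cover_system r V c h (b * real (card V) + \<epsilon> * real (card V)) (\<epsilon> * (real (card V))\<^sup>2)"
      using pc[OF V, of "b * real (card V)"] b by auto
    moreover have "V \<noteq> {}" using V(2) \<eta>(2) by auto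
    ultimately show False using nc[OF V(1), of c h] by (simp add: distrib_right)
  qed
  then show ?thesis using \<eta>(1) unfolding path_forcing_def by blast
qed

lemma path_forcing_many:
  assumes "1 \<le> r" "0 < \<alpha>" "\<alpha> \<le> 1 / real r"
  shows "path_forcing r (1 / real r - \<alpha>)"
\<comment> \<open>With this \<open>\<epsilon>\<close>, the bounds on covered and uncovered pairs add
  up to only \<open>1 - r * \<alpha> / 2\<close> of all pairs.\<close>
proof (rule path_forcing_if_no_cover[where \<epsilon> = "real r * \<alpha> / (2 * (real r + 1))"])
  let ?e = "real r * \<alpha> / (2 * (real r + 1))"
  show "0 < ?e" using assms by simp
  show "0 \<le> 1 / real r - \<alpha>" using assms by simp
  show "\<not> cover_system r V c h ((1 / real r - \<alpha> + ?e) * real (card V)) (?e * (real (card V))\<^sup>2)"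
    if V: "finite V" "V \<noteq> {}" for V :: "nat set" and c :: "nat \<Rightarrow> nat \<Rightarrow> nat set set" and h
  proof
    let ?n = "real (card V)"
    have n: "0 < ?n" using V by (simp add: card_gt_0_iff)
    assume "cover_system r V c h ((1 / real r - \<alpha> + ?e) * ?n) (?e * ?n\<^sup>2)"
    note cnt = cover_count[OF V(1) this]
    have eq: "real r * (?n * (x * ?n)) + y * ?n\<^sup>2 = (real r * x + y) * ?n\<^sup>2" for x y
      by (simp add: algebra_simps power2_eq_square)
    have "1 * ?n\<^sup>2 \<le> (real r * (1 / real r - \<alpha> + ?e) + ?e) * ?n\<^sup>2" using cnt unfolding eq mult_1 .
    then have "1 \<le> real r * (1 / real r - \<alpha> + ?e) + ?e"
      by (rule mult_right_le_imp_le) (use n in simp)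
    also have "\<dots> = 1 - real r * \<alpha> + (real r + 1) * ?e"
      using assms(1) by (simp add: algebra_simps add_divide_distrib)
    also have "(real r + 1) * ?e = real r * \<alpha> / 2" by (simp add: field_simps)
    finally have "real r * \<alpha> \<le> 0" by linarith
    moreover have "0 < real r * \<alpha>" using assms by (intro mult_pos_pos) auto
    ultimately show False by simp
  qed
qed

lemma path_forcing_three:
  assumes "0 < \<alpha>" "\<alpha> \<le> 1 / 2"
  shows "path_forcing 3 (1 / 2 - \<alpha>)"
proof -
  have "(1 / 2 - \<alpha> / 2 :: real) < 1 / 2" using assms by simp
  from cover_three[OF this, where 'a = nat and 'c = "nat set set"] obtain e where e: "(0::real) < e" and
    nc: "\<And>(V :: nat set) (c :: nat \<Rightarrow> nat \<Rightarrow> nat set set) h. finite V \<Longrightarrow> V \<noteq> {} \<Longrightarrow>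
    \<not> cover_system 3 V c h ((1 / 2 - \<alpha> / 2) * real (card V)) (e * (real (card V))\<^sup>2)" by blast
  show ?thesis
  proof (rule path_forcing_if_no_cover[where \<epsilon> = "min e (\<alpha> / 2)"])
    show "0 \<le> 1 / 2 - \<alpha>" "0 < min e (\<alpha> / 2)" using assms e by auto
    show "\<not> cover_system 3 V c h ((1 / 2 - \<alpha> + min e (\<alpha> / 2)) * real (card V)) (min e (\<alpha> / 2) * (real (card V))\<^sup>2)"
      if "finite V" "V \<noteq> {}" for V :: "nat set" and c :: "nat \<Rightarrow> nat \<Rightarrow> nat set set" and h
    proof
      assume "cover_system 3 V c h ((1 / 2 - \<alpha> + min e (\<alpha> / 2)) * real (card V)) (min e (\<alpha> / 2) * (real (card V))\<^sup>2)"
      then have "cover_system 3 V c h ((1 / 2 - \<alpha> / 2) * real (card V)) (e * (real (card V))\<^sup>2)"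
        by (rule cover_system_mono) (intro mult_right_mono; simp add: min_def)+
      then show False using nc that by blast
    qed
  qed
qed

section \<open>The random graph\<close>

lemma has_copy_path:
  assumes "is_path (\<lambda>x y. {x, y} \<in> F) V xs" "m \<le> length xs"
  shows "has_copy (V, F) (path_graph m)"
proof -
  let ?f = "\<lambda>i. xs ! i"
  have "inj_on ?f {..<m}" using assms by (auto simp: is_path_def inj_on_def nth_eq_iff_index_eq)
  moreover have "?f ` {..<m} \<subseteq> V" using assms by (auto simp: is_path_def subset_iff)
  moreover have "?f ` e \<in> F" if "e \<in> {{i, Suc i} | i. Suc i < m}" for e
    using that assms by (auto simp: is_path_def successively_conv_nth)
  ultimately show ?thesis unfolding has_copy_def path_graph_def by (intro exI[of _ ?f]) auto
qed

text \<open>Disjointness makes distinct pairs of vertices distinct edges, as the probability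
  estimate requires; overlapping sets are recovered by removing a part of \<open>X\<close> from
  \<open>Y\<close>.\<close>

definition no_hole :: "'a ugraph \<Rightarrow> real \<Rightarrow> bool" where
  "no_hole G d \<longleftrightarrow> (\<forall>X Y. X \<subseteq> fst G \<longrightarrow> Y \<subseteq> fst G \<longrightarrow> X \<inter> Y = {} \<longrightarrow> d \<le> card X \<longrightarrow> d \<le> card Y \<longrightarrow>
     (\<exists>x\<in>X. \<exists>y\<in>Y. {x, y} \<in> snd G))"

lemma no_hole_overlapping:
  assumes nh: "no_hole G d" and fin: "finite (fst G)" and d: "0 \<le> d" "2 * d + 1 \<le> d'"
    and X: "X \<subseteq> fst G" "d' \<le> card X" and Y: "Y \<subseteq> fst G" "d' \<le> card Y"
  shows "\<exists>x\<in>X. \<exists>y\<in>Y. {x, y} \<in> snd G"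
proof -
  have "nat \<lceil>d\<rceil> \<le> card X" using d X(2) by linarith
  then obtain X' where X': "X' \<subseteq> X" "card X' = nat \<lceil>d\<rceil>" "finite X'" by (rule obtain_subset_with_card_n)
  have "card Y - card X' \<le> card (Y - X')" using X'(3) by (rule diff_card_le_card_Diff)
  then have "d \<le> card (Y - X')" using X'(2) d Y(2) by linarith
  moreover have "d \<le> card X'" using X'(2) by linarith
  moreover have "X' \<subseteq> fst G" "Y - X' \<subseteq> fst G" "X' \<inter> (Y - X') = {}" using X X' Y by auto
  ultimately have "\<exists>x\<in>X'. \<exists>y\<in>Y - X'. {x, y} \<in> snd G"
    using nh[unfolded no_hole_def, rule_format, of X' "Y - X'"] by blast
  then show ?thesis using X'(1) by blast
qed

lemma forcing_arrows:
  assumes pf: "path_forcing r b" and b: "0 \<le> b"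
  shows "\<exists>\<eta>>0. \<exists>n0. \<forall>(G :: nat ugraph) m. finite (fst G) \<longrightarrow> n0 \<le> card (fst G) \<longrightarrow>
     no_hole G (\<eta> * real (card (fst G))) \<longrightarrow> real m \<le> b * real (card (fst G)) \<longrightarrow> arrows G (path_graph m) r"
proof -
  obtain \<eta> n0 where \<eta>: "0 < \<eta>" and pf: "\<And>(V :: nat set) E. finite V \<Longrightarrow> n0 \<le> card V \<Longrightarrow>
     \<forall>k x y. E k x y \<longrightarrow> E k y x \<Longrightarrow> hole_free r E V (\<eta> * real (card V)) \<Longrightarrow>
     \<exists>k<r. \<exists>xs. is_path (E k) V xs \<and> b * real (card V) \<le> real (length xs)"
    using pf unfolding path_forcing_def by blast
  \<comment> \<open>Two disjoint parts use two thirds of \<open>\<eta>\<close>; the last third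
    covers rounding.\<close>
  define n1 where "n1 = max n0 (nat \<lceil>3 / \<eta>\<rceil>)"
  have "arrows G (path_graph m) r"
    if fin: "finite (fst G)" and n: "n1 \<le> card (fst G)" and nh: "no_hole G (\<eta> / 3 * real (card (fst G)))"
      and m: "real m \<le> b * real (card (fst G))" for G :: "nat ugraph" and m
    unfolding arrows_def
  proof
    fix col assume col: "col \<in> snd G \<rightarrow> {..<r}"
    let ?V = "fst G"
    define E where "E k x y \<longleftrightarrow> {x, y} \<in> {e \<in> snd G. col e = k}" for k x y
    have n': "n0 \<le> card ?V" "3 / \<eta> \<le> card ?V" using n unfolding n1_def by linarith+
    then have "3 \<le> \<eta> * card ?V" using \<eta> by (simp add: field_simps)
    then have d: "2 * (\<eta> / 3 * card ?V) + 1 \<le> \<eta> * card ?V" by simp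
    have sym: "\<forall>k x y. E k x y \<longrightarrow> E k y x" unfolding E_def by (simp add: insert_commute)
    have "hole_free r E ?V (\<eta> * card ?V)" unfolding hole_free_def
    proof (intro allI impI)
      fix X Y assume XY: "X \<subseteq> ?V" "Y \<subseteq> ?V" "\<eta> * card ?V \<le> card X" "\<eta> * card ?V \<le> card Y"
      have "0 \<le> \<eta> / 3 * card ?V" using \<eta> by simp
      from no_hole_overlapping[OF nh fin this d XY(1,3) XY(2,4)]
      obtain x y where xy: "x \<in> X" "y \<in> Y" "{x, y} \<in> snd G" by blast
      then have "col {x, y} < r" using col by auto
      then show "\<exists>k<r. \<exists>x\<in>X. \<exists>y\<in>Y. E k x y" using xy unfolding E_def by blast
    qed
    from pf[OF fin n'(1) sym this] obtain k xs where
      k: "k < r" "is_path (E k) ?V xs" "b * real (card ?V) \<le> real (length xs)" by blast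
    have "m \<le> length xs" using m k(3) by linarith
    then have "has_copy (?V, {e \<in> snd G. col e = k}) (path_graph m)"
      using has_copy_path k(2) unfolding E_def by blast
    then show "\<exists>k<r. has_copy (?V, {e \<in> snd G. col e = k}) (path_graph m)" using k(1) by blast
  qed
  moreover have "0 < \<eta> / 3" using \<eta> by simp
  ultimately show ?thesis by blast
qed

section \<open>Holes in the random graph\<close>

lemma prob_no_edges:
  assumes "finite A" "F \<subseteq> A" "0 \<le> p" "p \<le> 1"
  shows "measure_pmf.prob (Pi_pmf A False (\<lambda>_. bernoulli_pmf p)) {b. \<forall>e\<in>F. \<not> b e} = (1 - p) ^ card F"
proof -
  let ?B = "\<lambda>e. if e \<in> F then {False} else UNIV"
  have "{b. \<forall>e\<in>F. \<not> b e} = Pi A ?B" using assms(2) by (auto simp: Pi_def split: if_splits)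
  then have "measure_pmf.prob (Pi_pmf A False (\<lambda>_. bernoulli_pmf p)) {b. \<forall>e\<in>F. \<not> b e} =
      (\<Prod>e\<in>A. measure_pmf.prob (bernoulli_pmf p) (?B e))"
    by (simp only: measure_Pi_pmf_Pi[OF assms(1)])
  also have "\<dots> = (\<Prod>e\<in>A. if e \<in> F then 1 - p else 1)"
    using assms(3,4) by (intro prod.cong) (auto simp: measure_pmf_single)
  also have "\<dots> = (1 - p) ^ card F"
    using assms(1,2) by (simp add: prod.If_cases Int_absorb1)
  finally show ?thesis .
qed

text \<open>Union bound over at most \<open>4 ^ n\<close> pairs of sets, each with at least
  \<open>d\<^sup>2\<close> possible edges between them.\<close>

lemma prob_hole:
  assumes p: "0 \<le> p" "p \<le> 1" and d: "0 \<le> d"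
  shows "measure_pmf.prob (binomial_graph n p) {G. \<not> no_hole G d} \<le> 4 ^ n * exp (- p * d\<^sup>2)"
proof -
  let ?N = "{1..n}" and ?A = "nsets {1..n} 2"
  let ?M = "Pi_pmf ?A False (\<lambda>_. bernoulli_pmf p)"
  define I where "I = {(X, Y) \<in> Pow ?N \<times> Pow ?N. X \<inter> Y = {} \<and> d \<le> card X \<and> d \<le> card Y}"
  define F where "F = (\<lambda>(X, Y). (\<lambda>(x, y). {x, y}) ` (X \<times> Y :: (nat \<times> nat) set))"
  have finA: "finite ?A" by (simp add: finite_imp_finite_nsets)
  have IP: "I \<subseteq> Pow ?N \<times> Pow ?N" unfolding I_def by auto
  then have finI: "finite I" by (rule finite_subset) simp
  have FA: "F i \<subseteq> ?A" if "i \<in> I" for i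
    using that unfolding I_def F_def by (auto simp: nsets_2_eq doubleton_eq_iff) blast
  have single: "measure_pmf.prob ?M {b. \<forall>e\<in>F i. \<not> b e} \<le> exp (- p * d\<^sup>2)" if i: "i \<in> I" for i
  proof -
    obtain X Y where XY: "i = (X, Y)" "X \<subseteq> ?N" "Y \<subseteq> ?N" "X \<inter> Y = {}" "d \<le> card X" "d \<le> card Y"
      using i unfolding I_def by auto
    have "inj_on (\<lambda>(x, y). {x, y}) (X \<times> Y)" using XY(4) by (auto simp: inj_on_def doubleton_eq_iff)
    then have "card (F i) = card X * card Y" unfolding F_def XY(1) by (simp add: card_image card_cartesian_product)
    then have "d\<^sup>2 \<le> card (F i)" using XY(5,6) d by (simp add: power2_eq_square mult_mono)
    then have "p * d\<^sup>2 \<le> p * card (F i)" using p by (intro mult_left_mono) auto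
    have "(1 - p) ^ card (F i) \<le> exp (- p) ^ card (F i)"
      using p exp_ge_add_one_self[of "- p"] by (intro power_mono) auto
    also have "\<dots> = exp (- (p * card (F i)))" by (simp add: exp_of_nat_mult[symmetric] mult.commute)
    also have "\<dots> \<le> exp (- p * d\<^sup>2)" using \<open>p * d\<^sup>2 \<le> p * card (F i)\<close> by simp
    finally show ?thesis using prob_no_edges[OF finA FA[OF i] p] by simp
  qed
  let ?G = "\<lambda>b. ({1..n}, {e \<in> ?A. b e})"
  have sub: "?G -` {G. \<not> no_hole G d} \<subseteq> (\<Union>i\<in>I. {b. \<forall>e\<in>F i. \<not> b e})"
  proof
    fix b assume "b \<in> ?G -` {G. \<not> no_hole G d}"
    then obtain X Y where XY: "X \<subseteq> ?N" "Y \<subseteq> ?N" "X \<inter> Y = {}" "d \<le> card X" "d \<le> card Y"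
      "\<forall>x\<in>X. \<forall>y\<in>Y. {x, y} \<notin> {e \<in> ?A. b e}"
      unfolding no_hole_def by auto
    have i: "(X, Y) \<in> I" using XY unfolding I_def by auto
    have "\<not> b e" if e: "e \<in> F (X, Y)" for e
    proof -
      obtain x y where "e = {x, y}" "x \<in> X" "y \<in> Y" using e unfolding F_def by auto
      then have "e \<notin> {e \<in> ?A. b e}" using XY(6) by metis
      moreover have "e \<in> ?A" using FA[OF i] e by auto
      ultimately show ?thesis by simp
    qed
    then show "b \<in> (\<Union>i\<in>I. {b. \<forall>e\<in>F i. \<not> b e})" using i by blast
  qed
  have "measure_pmf.prob (binomial_graph n p) {G. \<not> no_hole G d} = measure_pmf.prob ?M (?G -` {G. \<not> no_hole G d})"
    unfolding binomial_graph_def by (rule measure_map_pmf)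
  also have "\<dots> \<le> measure_pmf.prob ?M (\<Union>i\<in>I. {b. \<forall>e\<in>F i. \<not> b e})"
    by (rule measure_pmf.finite_measure_mono[OF sub]) simp
  also have "\<dots> \<le> (\<Sum>i\<in>I. measure_pmf.prob ?M {b. \<forall>e\<in>F i. \<not> b e})"
    by (rule measure_pmf.finite_measure_subadditive_finite[OF finI]) auto
  also have "\<dots> \<le> (\<Sum>i\<in>I. exp (- p * d\<^sup>2))" by (rule sum_mono) (rule single)
  also have "\<dots> = card I * exp (- p * d\<^sup>2)" by simp
  also have "\<dots> \<le> 4 ^ n * exp (- p * d\<^sup>2)"
  proof (rule mult_right_mono)
    have "card I \<le> card (Pow ?N \<times> Pow ?N)" by (rule card_mono[OF _ IP]) simp
    also have "\<dots> = 2 ^ n * 2 ^ n" by (simp add: card_cartesian_product card_Pow)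
    also have "\<dots> = (2 * 2) ^ n" by (rule power_mult_distrib[symmetric])
    finally have "real (card I) \<le> real ((2 * 2) ^ n)" by (rule of_nat_mono)
    then show "real (card I) \<le> 4 ^ n" by simp
  qed simp
  finally show ?thesis .
qed

lemma hole_prob_tendsto:
  assumes adm: "admissible p" and \<eta>: "0 < \<eta>"
  shows "(\<lambda>n. measure_pmf.prob (binomial_graph n (p n)) {G. \<not> no_hole G (\<eta> * real n)}) \<longlonglongrightarrow> 0"
proof (rule tendsto_sandwich[OF _ _ tendsto_const])
  have p: "0 \<le> p n" "p n \<le> 1" for n using adm unfolding admissible_def by auto
  show "\<forall>\<^sub>F n in sequentially. 0 \<le> measure_pmf.prob (binomial_graph n (p n)) {G. \<not> no_hole G (\<eta> * real n)}"
    by simp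
  have "filterlim (\<lambda>n. real n * p n) at_top sequentially" using adm unfolding admissible_def by blast
  \<comment> \<open>The exponent \<open>p * \<eta>\<^sup>2 * n\<^sup>2\<close> has to beat
    \<open>n * ln 4\<close> by \<open>n\<close>; this is where \<open>n * p\<close> tending to
    infinity enters.\<close>
  then have ev: "\<forall>\<^sub>F n in sequentially. (ln 4 + 1) / \<eta>\<^sup>2 \<le> real n * p n"
    by (simp add: filterlim_at_top)
  show "\<forall>\<^sub>F n in sequentially. measure_pmf.prob (binomial_graph n (p n)) {G. \<not> no_hole G (\<eta> * real n)} \<le> exp (- real n)"
    using ev
  proof eventually_elim
    case (elim n)
    have "(ln 4 + 1) \<le> real n * p n * \<eta>\<^sup>2" using elim \<eta> by (simp add: field_simps)
    then have "real n * (ln 4 + 1) \<le> real n * (real n * p n * \<eta>\<^sup>2)" by (intro mult_left_mono) auto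
    then have le: "real n * ln 4 + - p n * (\<eta> * real n)\<^sup>2 \<le> - real n"
      by (simp add: algebra_simps power2_eq_square)
    have "measure_pmf.prob (binomial_graph n (p n)) {G. \<not> no_hole G (\<eta> * real n)} \<le> 4 ^ n * exp (- p n * (\<eta> * real n)\<^sup>2)"
      using \<eta> by (intro prob_hole p) simp
    also have "4 ^ n = exp (real n * ln (4::real))" by (simp add: exp_of_nat_mult)
    also have "exp (real n * ln 4) * exp (- p n * (\<eta> * real n)\<^sup>2) = exp (real n * ln 4 + - p n * (\<eta> * real n)\<^sup>2)"
      by (simp only: exp_add)
    also have "\<dots> \<le> exp (- real n)" using le by (simp only: exp_le_cancel_iff)
    finally show ?case .
  qed
  show "(\<lambda>n. exp (- real n)) \<longlonglongrightarrow> 0"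
    by (intro filterlim_compose[OF exp_at_bot] filterlim_compose[OF filterlim_uminus_at_bot_at_top] filterlim_real_sequentially)
qed

lemma binomial_graph_vertices: "G \<in> set_pmf (binomial_graph n p) \<Longrightarrow> fst G = {1..n} \<and> snd G \<subseteq> nsets {1..n} 2"
  unfolding binomial_graph_def by auto

text \<open>The implication is asked only on the support, where the vertex set is known to be
  \<open>{1..n}\<close>.\<close>

lemma aas_mono:
  assumes "aas p Q" "\<forall>\<^sub>F n in sequentially. \<forall>G\<in>set_pmf (binomial_graph n (p n)). Q n G \<longrightarrow> Q' n G"
  shows "aas p Q'"
  unfolding aas_def
proof (rule tendsto_sandwich[OF _ _ assms(1)[unfolded aas_def] tendsto_const])
  show "\<forall>\<^sub>F n in sequentially. measure_pmf.prob (binomial_graph n (p n)) {G. Q n G} \<le> measure_pmf.prob (binomial_graph n (p n)) {G. Q' n G}"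
    using assms(2)
  proof eventually_elim
    case (elim n)
    have "measure_pmf.prob (binomial_graph n (p n)) {G. Q n G} = measure_pmf.prob (binomial_graph n (p n)) ({G. Q n G} \<inter> set_pmf (binomial_graph n (p n)))"
      by (rule measure_Int_set_pmf[symmetric])
    also have "\<dots> \<le> measure_pmf.prob (binomial_graph n (p n)) {G. Q' n G}"
      by (rule measure_pmf.finite_measure_mono) (use elim in auto)
    finally show ?case .
  qed
  show "\<forall>\<^sub>F n in sequentially. measure_pmf.prob (binomial_graph n (p n)) {G. Q' n G} \<le> 1" by simp
qed

lemma aas_no_hole:
  assumes "admissible p" "0 < \<eta>" shows "aas p (\<lambda>n G. no_hole G (\<eta> * real n))"
proof -
  have "measure_pmf.prob (binomial_graph n (p n)) {G. no_hole G (\<eta> * real n)} =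
      1 - measure_pmf.prob (binomial_graph n (p n)) {G. \<not> no_hole G (\<eta> * real n)}" for n
  proof -
    have "{G :: nat ugraph. no_hole G (\<eta> * real n)} = UNIV - {G. \<not> no_hole G (\<eta> * real n)}" by blast
    moreover have "measure_pmf.prob (binomial_graph n (p n)) (space (binomial_graph n (p n)) - {G. \<not> no_hole G (\<eta> * real n)})
        = 1 - measure_pmf.prob (binomial_graph n (p n)) {G. \<not> no_hole G (\<eta> * real n)}"
      by (rule measure_pmf.prob_compl) simp
    ultimately show ?thesis by (simp only: space_measure_pmf)
  qed
  then show ?thesis unfolding aas_def
    using tendsto_diff[OF tendsto_const[of 1] hole_prob_tendsto[OF assms]] by simp
qed

lemma aas_path:
  assumes adm: "admissible p" and b: "0 \<le> b" "x < b" and pf: "path_forcing r b"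
  shows "aas p (\<lambda>n G. arrows G (rpath (x * real n)) r)"
proof -
  obtain \<eta> n0 where \<eta>: "0 < \<eta>" and fa: "\<And>(G :: nat ugraph) m. finite (fst G) \<Longrightarrow> n0 \<le> card (fst G) \<Longrightarrow>
     no_hole G (\<eta> * real (card (fst G))) \<Longrightarrow> real m \<le> b * real (card (fst G)) \<Longrightarrow> arrows G (path_graph m) r"
    using forcing_arrows[OF pf b(1)] by blast
  show ?thesis
  proof (rule aas_mono[OF aas_no_hole[OF adm \<eta>]])
    \<comment> \<open>From here on \<open>(b - x) * n\<close> is at least 1, more than the rounding
      error 1/2 in \<open>rpath\<close>.\<close>
    have "\<forall>\<^sub>F n in sequentially. max n0 (nat \<lceil>1 / (b - x)\<rceil>) \<le> n" by (rule eventually_ge_at_top)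
    then show "\<forall>\<^sub>F n in sequentially. \<forall>G\<in>set_pmf (binomial_graph n (p n)).
        no_hole G (\<eta> * real n) \<longrightarrow> arrows G (rpath (x * real n)) r"
    proof eventually_elim
      case (elim n)
      have n: "n0 \<le> n" "1 / (b - x) \<le> n" using elim by linarith+
      then have "1 \<le> (b - x) * n" using b by (simp add: field_simps)
      then have 1: "x * n + 1 / 2 \<le> b * n" by (simp add: algebra_simps)
      have 0: "0 \<le> b * n" using b by simp
      have "of_int (round (x * real n)) \<le> x * real n + 1 / 2" by (rule of_int_round_le)
      then have m: "real (nat (round (x * real n))) \<le> b * n"
        using 0 1 by (cases "0 \<le> round (x * real n)") auto
      show ?case
      proof (intro ballI impI)
        fix G assume G: "G \<in> set_pmf (binomial_graph n (p n))" "no_hole G (\<eta> * real n)"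
        show "arrows G (rpath (x * real n)) r" unfolding rpath_def
          by (rule fa) (use G binomial_graph_vertices[OF G(1)] n m in auto)
      qed
    qed
  qed
qed

text \<open>
  The classes modulo 4 are the vertices of a \<open>K\<^sub>4\<close> whose three perfect matchings are the three
  colours; \<open>side k\<close> names the edge of matching \<open>k\<close> through a vertex.
\<close>

definition side :: "nat \<Rightarrow> nat \<Rightarrow> nat" where
  "side k x = (if k = 0 then x mod 4 div 2 else if k = 1 then x mod 2 else (x + 1) mod 4 div 2)"

text \<open>Edges are unordered, hence the quantifiers over both ends. Edges inside a class modulo 4
  get colour 0.\<close>

definition matching_colour :: "nat set \<Rightarrow> nat" where
  "matching_colour e = (if \<forall>x\<in>e. \<forall>y\<in>e. side 0 x = side 0 y then 0
     else if \<forall>x\<in>e. \<forall>y\<in>e. side 1 x = side 1 y then 1 else 2)"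

lemma side_cases: "side 0 x = side 0 y \<or> side 1 x = side 1 y \<or> side 2 x = side 2 y"
proof -
  have s: "side 1 z = z mod 4 mod 2" "side 2 z = (z mod 4 + 1) mod 4 div 2" for z
    by (simp_all add: side_def mod_mod_cancel mod_Suc_eq)
  have s0: "side 0 z = z mod 4 div 2" for z by (simp add: side_def)
  have "x mod 4 \<in> {0, 1, 2, 3}" "y mod 4 \<in> {0, 1, 2, 3}" by auto
  then show ?thesis unfolding s s0 by auto
qed

lemma matching_colour_side: "side (matching_colour {x, y}) x = side (matching_colour {x, y}) y"
proof -
  have "(\<forall>a\<in>{x, y}. \<forall>b\<in>{x, y}. side k a = side k b) \<longleftrightarrow> side k x = side k y" for k by auto
  then have "matching_colour {x, y} = (if side 0 x = side 0 y then 0 else if side 1 x = side 1 y then 1 else 2)"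
    unfolding matching_colour_def by simp
  then show ?thesis using side_cases[of x y] by (cases "side 0 x = side 0 y"; cases "side 1 x = side 1 y") simp_all
qed

lemma matching_colour_less: "matching_colour e < 3"
  by (simp add: matching_colour_def)

lemma card_mod_class: "card {v \<in> {1..n}. v mod 4 = a} \<le> n div 4 + 1"
proof -
  have "inj_on (\<lambda>v. v div 4) {v \<in> {1..n}. v mod 4 = a}"
    by (rule inj_onI) (metis (mono_tags, lifting) div_mult_mod_eq mem_Collect_eq)
  moreover have "(\<lambda>v. v div 4) ` {v \<in> {1..n}. v mod 4 = a} \<subseteq> {0..n div 4}" by (auto intro: div_le_mono)
  ultimately have "card {v \<in> {1..n}. v mod 4 = a} \<le> card {0..n div 4}" by (rule card_inj_on_le) simp
  then show ?thesis by simp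
qed

text \<open>A side is a union of two classes modulo 4. All \<open>a\<close> other than 0 are treated
  like 1, which includes the values never taken.\<close>

lemma card_side: "card {v \<in> {1..n}. side k v = a} \<le> 2 * (n div 4 + 1)"
proof -
  have two: ?thesis if "\<And>v. side k v = a \<Longrightarrow> v mod 4 = b \<or> v mod 4 = c" for b c
  proof -
    have "{v \<in> {1..n}. side k v = a} \<subseteq> {v \<in> {1..n}. v mod 4 = b} \<union> {v \<in> {1..n}. v mod 4 = c}" using that by auto
    then have "card {v \<in> {1..n}. side k v = a} \<le> card ({v \<in> {1..n}. v mod 4 = b} \<union> {v \<in> {1..n}. v mod 4 = c})"
      by (rule card_mono[rotated]) simp
    also have "\<dots> \<le> card {v \<in> {1..n}. v mod 4 = b} + card {v \<in> {1..n}. v mod 4 = c}" by (rule card_Un_le)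
    also have "\<dots> \<le> (n div 4 + 1) + (n div 4 + 1)" by (intro add_mono card_mod_class)
    finally show ?thesis by simp
  qed
  have s: "side 1 z = z mod 4 mod 2" "2 \<le> k \<Longrightarrow> side k z = (z mod 4 + 1) mod 4 div 2" for z
    by (simp_all add: side_def mod_mod_cancel mod_Suc_eq)
  have s0: "side 0 z = z mod 4 div 2" for z by (simp add: side_def)
  have m: "v mod 4 = 0 \<or> v mod 4 = 1 \<or> v mod 4 = 2 \<or> v mod 4 = 3" for v :: nat by auto
  consider "k = 0" | "k = 1" | "2 \<le> k" by linarith
  then show ?thesis
  proof cases
    case 1
    show ?thesis
    proof (cases "a = 0")
      case True
      show ?thesis
      proof (rule two[of 0 1])
        fix v assume "side k v = a"
        then have "v mod 4 div 2 = 0" using True 1 s0[of v] by simp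
        then show "v mod 4 = 0 \<or> v mod 4 = 1" using m[of v] by auto
      qed
    next
      case False
      show ?thesis
      proof (rule two[of 2 3])
        fix v assume "side k v = a"
        then have "v mod 4 div 2 \<noteq> 0" using False 1 s0[of v] by simp
        then show "v mod 4 = 2 \<or> v mod 4 = 3" using m[of v] by auto
      qed
    qed
  next
    case 2
    show ?thesis
    proof (cases "a = 0")
      case True
      show ?thesis
      proof (rule two[of 0 2])
        fix v assume "side k v = a"
        then have "v mod 4 mod 2 = 0" using True 2 s(1)[of v] by simp
        then show "v mod 4 = 0 \<or> v mod 4 = 2" using m[of v] by auto
      qed
    next
      case False
      show ?thesis
      proof (rule two[of 1 3])
        fix v assume "side k v = a"
        then have "v mod 4 mod 2 \<noteq> 0" using False 2 s(1)[of v] by simp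
        then show "v mod 4 = 1 \<or> v mod 4 = 3" using m[of v] by auto
      qed
    qed
  next
    case 3
    show ?thesis
    proof (cases "a = 0")
      case True
      show ?thesis
      proof (rule two[of 0 3])
        fix v assume "side k v = a"
        then have "(v mod 4 + 1) mod 4 div 2 = 0" using True  s(2)[OF 3, of v] by simp
        then show "v mod 4 = 0 \<or> v mod 4 = 3" using m[of v] by auto
      qed
    next
      case False
      show ?thesis
      proof (rule two[of 1 2])
        fix v assume "side k v = a"
        then have "(v mod 4 + 1) mod 4 div 2 \<noteq> 0" using False  s(2)[OF 3, of v] by simp
        then show "v mod 4 = 1 \<or> v mod 4 = 2" using m[of v] by auto
      qed
    qed
  qed
qed

text \<open>The value of \<open>side k\<close> is constant along a path of colour \<open>k\<close>,
  which confines the path to two of the four classes.\<close>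

lemma not_arrows:
  assumes V: "fst G = {1..n}" and m: "2 * (n div 4 + 1) < m"
  shows "\<not> arrows G (path_graph m) 3"
proof
  assume "arrows G (path_graph m) 3"
  moreover have "matching_colour \<in> snd G \<rightarrow> {..<3}" using matching_colour_less by auto
  ultimately obtain k where "has_copy ({1..n}, {e \<in> snd G. matching_colour e = k}) (path_graph m)"
    unfolding arrows_def V by blast
  then obtain f where f: "inj_on f {..<m}" "f ` {..<m} \<subseteq> {1..n}"
    "\<forall>e\<in>{{i, Suc i} | i. Suc i < m}. f ` e \<in> {e \<in> snd G. matching_colour e = k}"
    unfolding has_copy_def path_graph_def fst_conv snd_conv by (elim exE conjE) (rule that)
  have edge: "matching_colour {f i, f (Suc i)} = k" if "Suc i < m" for i
  proof -
    have "{i, Suc i} \<in> {{i, Suc i} | i. Suc i < m}" using that by blast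
    then have "f ` {i, Suc i} \<in> {e \<in> snd G. matching_colour e = k}" by (rule f(3)[rule_format])
    then show ?thesis by simp
  qed
  have "side k (f i) = side k (f 0)" if "i < m" for i
    using that
  proof (induction i)
    case (Suc i)
    have "side k (f i) = side k (f (Suc i))" using matching_colour_side[of "f i" "f (Suc i)"] edge[OF Suc.prems] by simp
    then show ?case using Suc by simp
  qed simp
  then have "f ` {..<m} \<subseteq> {v \<in> {1..n}. side k v = side k (f 0)}" using f(2) by auto
  then have "card {..<m} \<le> card {v \<in> {1..n}. side k v = side k (f 0)}"
    by (intro card_inj_on_le[OF f(1)]) auto
  then show False using card_side[of n k "side k (f 0)"] m by simp
qed

lemma aas_not_arrows:
  assumes "1 / 2 < x"
  shows "aas p (\<lambda>n G. \<not> arrows G (rpath (x * real n)) 3)"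
proof (rule aas_mono[where Q = "\<lambda>_ _. True"])
  show "aas p (\<lambda>_ _. True)" unfolding aas_def by simp
  have "\<forall>\<^sub>F n in sequentially. nat \<lceil>3 / (x - 1 / 2)\<rceil> \<le> n" by (rule eventually_ge_at_top)
  then show "\<forall>\<^sub>F n in sequentially. \<forall>G\<in>set_pmf (binomial_graph n (p n)). True \<longrightarrow> \<not> arrows G (rpath (x * real n)) 3"
  proof eventually_elim
    case (elim n)
    have "3 / (x - 1 / 2) \<le> n" using elim by linarith
    then have "3 \<le> (x - 1 / 2) * n" using assms by (simp add: field_simps)
    \<comment> \<open>The 3 leaves room for the 2 in \<open>2 * (n div 4 + 1)\<close> and for
      rounding by 1/2.\<close>
    then have "n / 2 + 3 \<le> x * n" by (simp add: algebra_simps)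
    moreover have "x * real n - 1 / 2 \<le> of_int (round (x * real n))" using of_int_round_ge[of "x * real n"] by simp
    moreover have "real (n div 4) \<le> n / 4" by linarith
    ultimately have "real (2 * (n div 4 + 1)) < of_int (round (x * real n))" by simp
    then have "2 * (n div 4 + 1) < nat (round (x * real n))" by linarith
    then show ?case using not_arrows binomial_graph_vertices unfolding rpath_def by blast
  qed
qed

section \<open>Arbitrary slack and the value of the path constant\<close>

lemma aas_arrows_many:
  assumes "admissible p" "1 \<le> r" "0 < \<alpha>"
  shows "aas p (\<lambda>n G. arrows G (rpath ((1 / real r - \<alpha>) * real n)) r)"
proof -
  \<comment> \<open>A smaller slack leaves a gap for rounding, and the cap keeps the forced
    proportion nonnegative when \<open>\<alpha>\<close> is large.\<close>
  define \<alpha>' where "\<alpha>' = min (\<alpha> / 2) (1 / real r)"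
  have a: "0 < \<alpha>'" "\<alpha>' \<le> 1 / real r" "\<alpha>' < \<alpha>" using assms unfolding \<alpha>'_def by auto
  show ?thesis by (rule aas_path[OF assms(1) _ _ path_forcing_many[OF assms(2) a(1,2)]]) (use a in auto)
qed

lemma aas_arrows_three:
  assumes "admissible p" "0 < \<alpha>"
  shows "aas p (\<lambda>n G. arrows G (rpath ((1 / 2 - \<alpha>) * real n)) 3)"
proof -
  define \<alpha>' where "\<alpha>' = min (\<alpha> / 2) (1 / 2)"
  have a: "0 < \<alpha>'" "\<alpha>' \<le> 1 / 2" "\<alpha>' < \<alpha>" using assms unfolding \<alpha>'_def by auto
  show ?thesis by (rule aas_path[OF assms(1) _ _ path_forcing_three[OF a(1,2)]]) (use a in auto)
qed

text \<open>\<open>b\<close> itself need not belong to the set in the supremum, but every positive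
  \<open>c\<close> below it does, with slack \<open>b - c\<close>.\<close>

lemma path_const_ge:
  assumes "0 < b" "b \<le> 1" and "\<And>p \<alpha>. admissible p \<Longrightarrow> 0 < \<alpha> \<Longrightarrow> aas p (\<lambda>n G. arrows G (rpath ((b - \<alpha>) * real n)) r)"
  shows "b \<le> path_const r"
proof (rule dense_le_bounded[OF assms(1)])
  fix c assume c: "0 < c" "c < b"
  have "aas p (\<lambda>n G. arrows G (rpath (c * real n)) r)" if "admissible p" for p
    using assms(3)[OF that, of "b - c"] c by simp
  then have "c \<in> {c \<in> {0..1}. \<forall>p. admissible p \<longrightarrow> aas p (\<lambda>n G. arrows G (rpath (c * real n)) r)}"
    using c assms(2) by auto
  then show "c \<le> path_const r" unfolding path_const_def by (rule cSup_upper) (auto intro: bdd_aboveI[of _ 1])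
qed

lemma aas_not_both:
  assumes "aas p Q" "aas p (\<lambda>n G. \<not> Q n G)" shows False
proof -
  have "measure_pmf.prob (binomial_graph n (p n)) {G. \<not> Q n G} = 1 - measure_pmf.prob (binomial_graph n (p n)) {G. Q n G}" for n
  proof -
    have "{G. \<not> Q n G} = UNIV - {G. Q n G}" by blast
    moreover have "measure_pmf.prob (binomial_graph n (p n)) (space (binomial_graph n (p n)) - {G. Q n G})
        = 1 - measure_pmf.prob (binomial_graph n (p n)) {G. Q n G}"
      by (rule measure_pmf.prob_compl) simp
    ultimately show ?thesis by (simp only: space_measure_pmf)
  qed
  then have "(\<lambda>n. measure_pmf.prob (binomial_graph n (p n)) {G. \<not> Q n G}) \<longlonglongrightarrow> 1 - 1"
    using tendsto_diff[OF tendsto_const[of 1] assms(1)[unfolded aas_def]] by simp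
  then have "(1::real) = 1 - 1" using LIMSEQ_unique[OF assms(2)[unfolded aas_def]] by blast
  then show False by simp
qed

lemma admissible_one: "admissible (\<lambda>_. 1)"
  unfolding admissible_def by (simp add: filterlim_real_sequentially)

theorem theorem4p1:
  fixes \<alpha> :: real and p :: "nat \<Rightarrow> real"
  assumes "\<alpha> > 0" and "admissible p"
  shows "(\<forall>r\<ge>4. aas p (\<lambda>n G. arrows G (rpath ((1 / real r - \<alpha>) * real n)) r)
                 \<and> path_const r \<ge> 1 / real r) \<and>
         (aas p (\<lambda>n G. arrows G (rpath ((1 / 2 - \<alpha>) * real n)) 3)
          \<and> aas p (\<lambda>n G. \<not> arrows G (rpath ((1 / 2 + \<alpha>) * real n)) 3)
          \<and> path_const 3 = 1 / 2)"
proof (intro conjI allI impI)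
  fix r :: nat assume r: "4 \<le> r"
  show "aas p (\<lambda>n G. arrows G (rpath ((1 / real r - \<alpha>) * real n)) r)"
    using aas_arrows_many[OF assms(2) _ assms(1)] r by simp
  show "path_const r \<ge> 1 / real r"
    by (rule path_const_ge) (use r aas_arrows_many in auto)
next
  show "aas p (\<lambda>n G. arrows G (rpath ((1 / 2 - \<alpha>) * real n)) 3)"
    by (rule aas_arrows_three[OF assms(2,1)])
  show "aas p (\<lambda>n G. \<not> arrows G (rpath ((1 / 2 + \<alpha>) * real n)) 3)"
    by (rule aas_not_arrows) (use assms(1) in simp)
  show "path_const 3 = 1 / 2"
  proof (rule antisym)
    show "1 / 2 \<le> path_const 3" by (rule path_const_ge) (use aas_arrows_three in auto)
    show "path_const 3 \<le> 1 / 2" unfolding path_const_def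
    proof (rule cSup_least)
      \<comment> \<open>Slack 1/2 shows that 0 belongs to the set.\<close>
      show "{c \<in> {0..1}. \<forall>p. admissible p \<longrightarrow> aas p (\<lambda>n G. arrows G (rpath (c * real n)) 3)} \<noteq> {}"
        using aas_arrows_three[of _ "1 / 2"] by (auto intro!: exI[of _ 0])
      fix c :: real
      assume "c \<in> {c \<in> {0..1}. \<forall>p. admissible p \<longrightarrow> aas p (\<lambda>n G. arrows G (rpath (c * real n)) 3)}"
      \<comment> \<open>A single admissible sequence is enough for the upper bound.\<close>
      then have c: "aas (\<lambda>_. 1) (\<lambda>n G. arrows G (rpath (c * real n)) 3)" using admissible_one by blast
      show "c \<le> 1 / 2"
      proof (rule ccontr)
        assume "\<not> ?thesis"
        then have "aas (\<lambda>_. 1) (\<lambda>n G. \<not> arrows G (rpath (c * real n)) 3)" by (intro aas_not_arrows) simp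
        then show False using aas_not_both[OF c] by blast
      qed
    qed
  qed
qed

end
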